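(* Let $X\subset\mathbb{R}^n$ be a bounded smooth domain with boundary $M=\partial X$. Define $B_2\colon\left(C^1(\overline{X})\cap C^2(M)\right)^2\to C^0(M)$ by $$B_2(v,w)=\frac12\left(v_n\overline{\Delta}w+w_n\overline{\Delta}v+L(\overline{\nabla}v,\overline{\nabla}w)+Hv_nw_n\right).$$ Then the multilinear form $\mathcal{Q}_2\colon\left(C^2(\overline{X})\right)^3\to\mathbb{R}$ given by $$\mathcal{Q}_2(u,v,w)=-\int_X u\,\sigma_2(D^2v,D^2w)\,dx+\oint_M u\,B_2(v,w)\,d\mu$$ is symmetric in $u,v,w$.
   Context: $dx$ is Lebesgue measure on $X$, $d\mu$ is the induced volume measure on $M$, and $D^2w$ is the Euclidean Hessian. For symmetric matrices $A,B$, $\sigma_2(A,B):=\frac{1}{2}\left(\operatorname{tr}A\,\operatorname{tr}B-\operatorname{tr}(AB)\right)$ is the polarization of the second elementary symmetric function $\sigma_2$ of the eigenvalues. $C^1(\overline X)\cap C^2(M)$ denotes the functions in $C^1(\overline X)$ whose restriction to $M$ is $C^2$. Along $M$: $v_n$ is the derivative of $v$ in the direction of the outward-pointing unit normal; $\overline\nabla$ and $\overline\Delta$ are the tangential gradient and tangential Laplacian, i.e. those of the induced metric on $M$, applied to restrictions to $M$; $L$ is the second fundamental form of $M$, with the sign convention that $D^2v|_{TM}=\overline{D}^2v+v_nL$, where $\overline D^2$ is the Hessian of the induced metric (so $L$ is positive definite on round spheres bounding balls); and $H=\operatorname{tr}L$ is the mean curvature. *)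

theory Defs
  imports "HOL-Analysis.Analysis"
begin

subsection \<open>Function spaces\<close>

text \<open>\<open>Ck_on k S f\<close>: \<open>f\<close> is of class \<open>C^k\<close> on the open set \<open>S\<close>.\<close>

primrec Ck_on :: "nat \<Rightarrow> 'a::euclidean_space set \<Rightarrow> ('a \<Rightarrow> real) \<Rightarrow> bool" where
  "Ck_on 0 S f \<longleftrightarrow> continuous_on S f"
| "Ck_on (Suc k) S f \<longleftrightarrow>
     (\<forall>x\<in>S. f differentiable (at x)) \<and> (\<forall>h. Ck_on k S (\<lambda>x. frechet_derivative f (at x) h))"

definition smooth_on :: "'a::euclidean_space set \<Rightarrow> ('a \<Rightarrow> real) \<Rightarrow> bool" where
  "smooth_on S f \<longleftrightarrow> (\<forall>k. Ck_on k S f)"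

definition extends_to_closure :: "'a::euclidean_space set \<Rightarrow> ('a \<Rightarrow> real) \<Rightarrow> bool" where
  "extends_to_closure X f \<longleftrightarrow> (\<exists>g. continuous_on (closure X) g \<and> (\<forall>x\<in>X. g x = f x))"

text \<open>\<open>f\<close> is \<open>C^k\<close> in the open set \<open>X\<close>, and all its iterated directional derivatives of
  order at most \<open>k\<close> extend continuously to the closure.\<close>

primrec Ck_up_to_boundary :: "nat \<Rightarrow> 'a::euclidean_space set \<Rightarrow> ('a \<Rightarrow> real) \<Rightarrow> bool" where
  "Ck_up_to_boundary 0 X f \<longleftrightarrow> extends_to_closure X f"
| "Ck_up_to_boundary (Suc k) X f \<longleftrightarrow>
     extends_to_closure X f \<and> (\<forall>x\<in>X. f differentiable (at x)) \<and>
     (\<forall>h. Ck_up_to_boundary k X (\<lambda>x. frechet_derivative f (at x) h))"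

text \<open>The space \<open>C^k\<close> of the closure of \<open>X\<close>. Its elements are total functions, of which only
  the values on \<open>closure X\<close> matter.\<close>

definition C_closure :: "nat \<Rightarrow> 'a::euclidean_space set \<Rightarrow> ('a \<Rightarrow> real) set" where
  "C_closure k X = {u. continuous_on (closure X) u \<and> Ck_up_to_boundary k X u}"

text \<open>Functions whose restriction to the (embedded, smooth) submanifold \<open>M\<close> is \<open>C^k\<close>: near each
  point of \<open>M\<close> the restriction extends to a \<open>C^k\<close> function on an open set of the ambient space.\<close>

definition C_submanifold :: "nat \<Rightarrow> 'a::euclidean_space set \<Rightarrow> ('a \<Rightarrow> real) set" where
  "C_submanifold k M =
     {f. \<forall>p\<in>M. \<exists>V g. open V \<and> p \<in> V \<and> Ck_on k V g \<and> (\<forall>x\<in>V \<inter> M. f x = g x)}"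

definition grad :: "(real^'n::finite \<Rightarrow> real) \<Rightarrow> real^'n \<Rightarrow> real^'n" where
  "grad f x = (\<chi> i. frechet_derivative f (at x) (axis i 1))"

definition hess :: "(real^'n::finite \<Rightarrow> real) \<Rightarrow> real^'n \<Rightarrow> real^'n^'n" where
  "hess f x = jacobian (grad f) (at x)"

definition sigma2 :: "real^'n::finite^'n \<Rightarrow> real^'n^'n \<Rightarrow> real" where
  "sigma2 A B = 1/2 * (trace A * trace B - trace (A ** B))"


subsection \<open>Smooth domains and the induced volume measure\<close>

text \<open>A smooth function of the coordinates other than the \<open>k\<close>-th.\<close>

definition graph_function :: "'n::finite \<Rightarrow> (real^'n \<Rightarrow> real) \<Rightarrow> bool" where
  "graph_function k \<gamma> \<longleftrightarrow>
     smooth_on UNIV \<gamma> \<and> (\<forall>x y. (\<forall>i. i \<noteq> k \<longrightarrow> x $ i = y $ i) \<longrightarrow> \<gamma> x = \<gamma> y)"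

text \<open>Locally, up to the choice of a coordinate axis \<open>k\<close> and of the side \<open>s\<close>, the domain is the
  set of points on one side of the graph of a smooth function.\<close>

definition smooth_domain :: "(real^'n::finite) set \<Rightarrow> bool" where
  "smooth_domain X \<longleftrightarrow> open X \<and> connected X \<and> X \<noteq> {} \<and>
     (\<forall>p\<in>frontier X. \<exists>V k \<gamma>. \<exists>s\<in>{-1, 1}. open V \<and> p \<in> V \<and> graph_function k \<gamma> \<and>
        X \<inter> V = {x \<in> V. s * x $ k < s * \<gamma> x})"

text \<open>The \<open>(n-1)\<close>-dimensional Lebesgue measure on the hyperplane of the points whose \<open>k\<close>-th
  coordinate vanishes (for \<open>n = 1\<close>, the unit mass at the origin).\<close>

definition hyperplane_lborel :: "'n::finite \<Rightarrow> (real^'n) measure" where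
  "hyperplane_lborel k =
     distr (Pi\<^sub>M (UNIV - {k}) (\<lambda>_. lborel)) borel (\<lambda>y. \<chi> i. if i = k then 0 else y i)"

definition graph_map :: "'n::finite \<Rightarrow> (real^'n \<Rightarrow> real) \<Rightarrow> real^'n \<Rightarrow> real^'n" where
  "graph_map k \<gamma> y = (\<chi> i. if i = k then \<gamma> y else y $ i)"

text \<open>\<open>\<mu>\<close> is the Riemannian volume measure of the metric induced on the hypersurface \<open>M\<close>, seen as a
  Borel measure on the ambient space carried by \<open>M\<close>. In a graph chart \<open>y \<mapsto> graph_map k \<gamma> y\<close> the
  induced metric is \<open>\<delta>\<^sub>i\<^sub>j + \<partial>\<^sub>i\<gamma> \<partial>\<^sub>j\<gamma>\<close>, whose volume density (square root of the
  determinant) is \<open>sqrt (1 + |grad \<gamma>|^2)\<close>. If graph charts cover \<open>M\<close>, as for the boundary of a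
  smooth domain, these formulas determine \<open>\<mu>\<close> uniquely.\<close>

definition induced_volume_measure :: "(real^'n::finite) set \<Rightarrow> (real^'n) measure \<Rightarrow> bool" where
  "induced_volume_measure M \<mu> \<longleftrightarrow>
     sets \<mu> = sets borel \<and> emeasure \<mu> (- M) = 0 \<and>
     (\<forall>k \<gamma> V. graph_function k \<gamma> \<and> open V \<and> M \<inter> V = {x \<in> V. x $ k = \<gamma> x} \<longrightarrow>
        (\<forall>A\<in>sets borel. A \<subseteq> M \<inter> V \<longrightarrow>
           emeasure \<mu> A =
             (\<integral>\<^sup>+ y. indicator A (graph_map k \<gamma> y) * ennreal (sqrt (1 + (norm (grad \<gamma> y))\<^sup>2))
                \<partial>hyperplane_lborel k)))"


subsection \<open>Geometry of the boundary\<close>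

text \<open>Velocities at \<open>x\<close> of curves in \<open>M\<close>.\<close>

definition tangent_space :: "'a::euclidean_space set \<Rightarrow> 'a \<Rightarrow> 'a set" where
  "tangent_space M x =
     {Y. \<exists>c e. e > 0 \<and> (\<forall>t. \<bar>t\<bar> < e \<longrightarrow> c t \<in> M) \<and> c 0 = x \<and>
          (c has_vector_derivative Y) (at (0::real))}"

definition outward_normal :: "'a::euclidean_space set \<Rightarrow> 'a \<Rightarrow> 'a" where
  "outward_normal X x =
     (THE \<nu>. norm \<nu> = 1 \<and> (\<forall>Y\<in>tangent_space (frontier X) x. \<nu> \<bullet> Y = 0) \<and>
        eventually (\<lambda>t. x + t *\<^sub>R \<nu> \<notin> closure X) (at_right 0))"

text \<open>\<open>v\<^sub>n\<close>. As \<open>v\<close> is only given on \<open>closure X\<close>, the derivative is one-sided, from inside \<open>X\<close>.\<close>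

definition normal_deriv :: "'a::euclidean_space set \<Rightarrow> ('a \<Rightarrow> real) \<Rightarrow> 'a \<Rightarrow> real" where
  "normal_deriv X v x =
     vector_derivative (\<lambda>t. v (x + t *\<^sub>R outward_normal X x)) (at 0 within {..0})"

text \<open>The differential at \<open>x\<close> of the restriction of \<open>F\<close> to the boundary. The derivative of \<open>F\<close> within
  the boundary is determined only on tangent vectors; it is made a unique linear map on the whole
  space by letting it vanish on the normal.\<close>

definition bdry_deriv ::
  "'a::euclidean_space set \<Rightarrow> ('a \<Rightarrow> 'b::real_normed_vector) \<Rightarrow> 'a \<Rightarrow> 'a \<Rightarrow> 'b" where
  "bdry_deriv X F x =
     (THE F'. (F has_derivative F') (at x within frontier X) \<and> F' (outward_normal X x) = 0)"

definition tangential_part :: "'a::euclidean_space set \<Rightarrow> 'a \<Rightarrow> 'a \<Rightarrow> 'a" where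
  "tangential_part X x h = h - (h \<bullet> outward_normal X x) *\<^sub>R outward_normal X x"

text \<open>Trace of a bilinear form on the tangent space with respect to the induced metric. Projecting an
  orthonormal basis of the ambient space gives the same sum as an orthonormal basis of the tangent
  space.\<close>

definition tangential_trace :: "'a::euclidean_space set \<Rightarrow> 'a \<Rightarrow> ('a \<Rightarrow> 'a \<Rightarrow> real) \<Rightarrow> real" where
  "tangential_trace X x b = (\<Sum>e\<in>Basis. b (tangential_part X x e) (tangential_part X x e))"

text \<open>The vector representing the differential of \<open>f\<close> along the boundary. It is tangent to the
  boundary because \<open>bdry_deriv\<close> vanishes on the normal.\<close>

definition bdry_grad :: "'a::euclidean_space set \<Rightarrow> ('a \<Rightarrow> real) \<Rightarrow> 'a \<Rightarrow> 'a" where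
  "bdry_grad X f x = (\<Sum>e\<in>Basis. bdry_deriv X f x e *\<^sub>R e)"

text \<open>Hessian of the induced metric: the covariant derivative of the gradient. The Levi-Civita
  connection of the induced metric is the tangential part of the Euclidean derivative.
  \<open>Y\<close> and \<open>Z\<close> are tangent vectors.\<close>

definition bdry_hess :: "'a::euclidean_space set \<Rightarrow> ('a \<Rightarrow> real) \<Rightarrow> 'a \<Rightarrow> 'a \<Rightarrow> 'a \<Rightarrow> real" where
  "bdry_hess X f x Y Z = tangential_part X x (bdry_deriv X (bdry_grad X f) x Y) \<bullet> Z"

definition bdry_laplacian :: "'a::euclidean_space set \<Rightarrow> ('a \<Rightarrow> real) \<Rightarrow> 'a \<Rightarrow> real" where
  "bdry_laplacian X f x = tangential_trace X x (bdry_hess X f x)"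

text \<open>The second fundamental form, for tangent vectors \<open>Y\<close>, \<open>Z\<close>. On the boundary of a ball of radius
  \<open>r\<close> the outward normal at \<open>x\<close> is \<open>(x - centre) / r\<close>, so the form is \<open>1/r\<close> times the metric.
  Differentiating \<open>grad v = bdry_grad v + v\<^sub>n \<nu>\<close> tangentially shows that the Euclidean Hessian
  restricted to tangent vectors is \<open>bdry_hess v + v\<^sub>n second_fundamental_form\<close>.\<close>

definition second_fundamental_form :: "'a::euclidean_space set \<Rightarrow> 'a \<Rightarrow> 'a \<Rightarrow> 'a \<Rightarrow> real" where
  "second_fundamental_form X x Y Z = bdry_deriv X (outward_normal X) x Y \<bullet> Z"

definition mean_curvature :: "'a::euclidean_space set \<Rightarrow> 'a \<Rightarrow> real" where
  "mean_curvature X x = tangential_trace X x (second_fundamental_form X x)"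


subsection \<open>The boundary operator and the form\<close>

definition B2 :: "'a::euclidean_space set \<Rightarrow> ('a \<Rightarrow> real) \<Rightarrow> ('a \<Rightarrow> real) \<Rightarrow> 'a \<Rightarrow> real" where
  "B2 X v w x = 1/2 *
     (normal_deriv X v x * bdry_laplacian X w x + normal_deriv X w x * bdry_laplacian X v x
      + second_fundamental_form X x (bdry_grad X v x) (bdry_grad X w x)
      + mean_curvature X x * normal_deriv X v x * normal_deriv X w x)"

text \<open>\<open>\<mu>\<close> is the volume measure of the boundary.\<close>

definition Q2 :: "(real^'n::finite) set \<Rightarrow> (real^'n) measure \<Rightarrow>
    (real^'n \<Rightarrow> real) \<Rightarrow> (real^'n \<Rightarrow> real) \<Rightarrow> (real^'n \<Rightarrow> real) \<Rightarrow> real" where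
  "Q2 X \<mu> u v w =
     - (LINT x:X|lborel. u x * sigma2 (hess v x) (hess w x))
     + (LINT x:frontier X|\<mu>. u x * B2 X v w x)"

definition trilinear_on ::
  "('a \<Rightarrow> real) set \<Rightarrow> (('a \<Rightarrow> real) \<Rightarrow> ('a \<Rightarrow> real) \<Rightarrow> ('a \<Rightarrow> real) \<Rightarrow> real) \<Rightarrow> bool" where
  "trilinear_on S Q \<longleftrightarrow>
     (\<forall>f\<in>S. \<forall>g\<in>S. \<forall>v\<in>S. \<forall>w\<in>S. \<forall>a b.
        Q (\<lambda>x. a * f x + b * g x) v w = a * Q f v w + b * Q g v w \<and>
        Q v (\<lambda>x. a * f x + b * g x) w = a * Q v f w + b * Q v g w \<and>
        Q v w (\<lambda>x. a * f x + b * g x) = a * Q v w f + b * Q v w g)"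

definition symmetric_on ::
  "('a \<Rightarrow> real) set \<Rightarrow> (('a \<Rightarrow> real) \<Rightarrow> ('a \<Rightarrow> real) \<Rightarrow> ('a \<Rightarrow> real) \<Rightarrow> real) \<Rightarrow> bool" where
  "symmetric_on S Q \<longleftrightarrow>
     (\<forall>u\<in>S. \<forall>v\<in>S. \<forall>w\<in>S.
        Q u v w = Q u w v \<and> Q u v w = Q v u w \<and> Q u v w = Q v w u \<and>
        Q u v w = Q w u v \<and> Q u v w = Q w v u)"

end

theory Submission
  imports Defs
begin

text \<open>Write \<open>M\<close> for the boundary, \<open>\<nu>\<close> for its outward normal, and \<open>A\<close>, \<open>Z\<close>, \<open>Y\<close> for the gradients of \<open>u\<close>,
\<open>v\<close>, \<open>w\<close>. The form is symmetric because an integration by parts brings it to the shape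

\<open>2 Q(u,v,w) = \<integral>\<^sub>X ((A \<bullet> Y) tr DZ - DZ Y \<bullet> A) dx - \<integral>\<^sub>M v\<^sub>n (A' \<bullet> Y') d\<mu>\<close>,

where a prime denotes the tangential part. The right-hand side does not change when \<open>u\<close> and \<open>w\<close> are
exchanged, since \<open>DZ\<close> is a Hessian; the definition of the form does not change when \<open>v\<close> and \<open>w\<close> are
exchanged, since the second fundamental form is symmetric. The two transpositions generate all
permutations of the arguments (\<open>Q2_formula\<close>, \<open>Q2_swap_outer\<close>, \<open>Q2_swap_inner\<close>). Linearity in the
first argument is that of the integral, and symmetry carries it to the other two.

The integration by parts rests on two facts. On \<open>X\<close>, the function \<open>2 u \<sigma>\<^sub>2(D\<^sup>2v,D\<^sup>2w)\<close> is a sum of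
Jacobian minors \<open>\<partial>\<^sub>i a \<partial>\<^sub>j b - \<partial>\<^sub>j a \<partial>\<^sub>i b\<close> with \<open>a\<close> a partial derivative of \<open>v\<close> and \<open>b\<close> equal to
\<open>u\<close> times a partial derivative of \<open>w\<close>, up to the volume integrand displayed above, which is of first
order in \<open>u\<close> and \<open>w\<close>. Stokes' theorem moves the minors to \<open>M\<close>, where they add up to \<open>u (w\<^sub>n tr DZ - DZ Y \<bullet> \<nu>)\<close>. On \<open>M\<close>, the Gauss formula
shows that \<open>2 u B\<^sub>2(v,w)\<close> is this same density plus the tangential divergence of \<open>u v\<^sub>n Y'\<close> minus
\<open>v\<^sub>n (A' \<bullet> Y')\<close> (\<open>B2_divergence_form\<close>), and a tangential divergence integrates to zero over the closed
hypersurface \<open>M\<close> (\<open>surf_sdiv_eq_0\<close>).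

Since \<open>v\<close> is only \<open>C\<^sup>2\<close>, its partial derivatives are only \<open>C\<^sup>1\<close>, and the textbook proof of Stokes' theorem
through \<open>d \<circ> d = 0\<close> would need one more derivative. It is replaced by a translation argument
(\<open>stokes_two_form\<close>): with \<open>K(z) = \<integral>\<^sub>X b(x) a(x + z) dx\<close>, the divergence theorem rewrites the first
derivatives of \<open>K\<close> so that they can be differentiated once more, and the identity says that the mixed
second derivatives of \<open>K\<close> at \<open>0\<close> coincide. The same identity with \<open>b = 1\<close> gives the tangential divergence
theorem on \<open>M\<close>, so that the only integral identity proved in boundary charts is the divergence theorem for \<open>C\<^sup>1\<close>
functions. There, a shear along a coordinate axis turns the domain into a half space, and Fubini's
theorem reduces everything to the fundamental theorem of calculus.

To have functions on the whole space at hand, every function that is \<open>C\<^sup>1\<close> up to the boundary is first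
extended to a compactly supported \<open>C\<^sup>1\<close> function by reflection in boundary charts (\<open>C1_extension\<close>). A
\<open>C\<^sup>2\<close> function \<open>v\<close> is represented by such extensions of \<open>v\<close> and, separately, of its partial derivatives
(\<open>jet_extension\<close>); all quantities in the form can be read off from them. In the same way, \<open>B\<^sub>2(v,w)\<close>
is continuous on \<open>M\<close> because near each point it is an expression in ambient \<open>C\<^sup>1\<close> functions and their
derivatives (\<open>B2_local\<close>).\<close>

section \<open>Continuously differentiable functions\<close>

lemma grad_eqI:
  assumes "(f has_derivative (\<lambda>h. g \<bullet> h)) (at x)"
  shows "grad f x = g"
proof -
  have "frechet_derivative f (at x) = (\<lambda>h. g \<bullet> h)"
    using frechet_derivative_at[OF assms] by simp
  then show ?thesis by (simp add: grad_def vec_eq_iff inner_axis)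
qed

lemma has_derivative_grad:
  assumes "f differentiable (at x)"
  shows "(f has_derivative (\<lambda>h. grad f x \<bullet> h)) (at x)"
proof -
  have d: "(f has_derivative frechet_derivative f (at x)) (at x)"
    using assms frechet_derivative_works by blast
  then interpret l: linear "frechet_derivative f (at x)" by (rule has_derivative_linear)
  have "frechet_derivative f (at x) h = grad f x \<bullet> h" for h
  proof -
    have "frechet_derivative f (at x) h = frechet_derivative f (at x) (\<Sum>i\<in>UNIV. h $ i *s axis i 1)"
      by (simp add: basis_expansion)
    also have "\<dots> = (\<Sum>i\<in>UNIV. h $ i * frechet_derivative f (at x) (axis i 1))"
      by (simp add: l.sum l.scaleR vector_scalar_mult_def scalar_mult_eq_scaleR)
    finally show ?thesis by (simp add: grad_def inner_vec_def mult.commute)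
  qed
  then show ?thesis using d by presburger
qed

text \<open>The case \<open>k = 1\<close> of \<open>Ck_on\<close> (see \<open>Ck_on_1\<close>), with all directional derivatives collected in one
vector field.\<close>

definition C1_on :: "(real^'n::finite) set \<Rightarrow> (real^'n \<Rightarrow> real) \<Rightarrow> bool" where
  "C1_on S f \<longleftrightarrow>
     (\<forall>x\<in>S. (f has_derivative (\<lambda>h. grad f x \<bullet> h)) (at x)) \<and> continuous_on S (grad f)"

lemma continuous_on_vec_iff:
  "continuous_on S (g :: 'a::topological_space \<Rightarrow> real^'n::finite) \<longleftrightarrow> (\<forall>i. continuous_on S (\<lambda>x. g x $ i))"
proof
  assume "\<forall>i. continuous_on S (\<lambda>x. g x $ i)"
  then have "continuous_on S (\<lambda>x. \<chi> i. g x $ i)" by (intro continuous_on_vec_lambda) auto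
  then show "continuous_on S g" by simp
qed (auto intro: continuous_intros)

lemma frechet_grad:
  "f differentiable (at x) \<Longrightarrow> frechet_derivative f (at x) h = grad f x \<bullet> h"
  using has_derivative_grad[of f x] frechet_derivative_at by metis

lemma Ck_on_Suc:
  "Ck_on (Suc k) S f \<longleftrightarrow> (\<forall>x\<in>S. f differentiable (at x)) \<and> (\<forall>h. Ck_on k S (\<lambda>x. frechet_derivative f (at x) h))"
  by simp

lemma Ck_on_1: "Ck_on (Suc 0) S f \<longleftrightarrow> C1_on S f"
proof
  assume a: "Ck_on (Suc 0) S f"
  then have "continuous_on S (\<lambda>x. grad f x $ i)" for i by (simp add: grad_def)
  with a show "C1_on S f" by (simp add: C1_on_def has_derivative_grad continuous_on_vec_iff)
next
  assume a: "C1_on S f"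
  then have d: "f differentiable (at x)" if "x \<in> S" for x
    using that by (auto simp: C1_on_def differentiable_def)
  have "continuous_on S (\<lambda>x. grad f x \<bullet> h)" for h
    using a by (auto simp: C1_on_def intro!: continuous_intros)
  then have "continuous_on S (\<lambda>x. frechet_derivative f (at x) h)" for h
    by (rule continuous_on_eq) (simp add: frechet_grad d)
  with d show "Ck_on (Suc 0) S f" by simp
qed

lemma C1_onI:
  assumes "\<And>x. x \<in> S \<Longrightarrow> (f has_derivative (\<lambda>h. g x \<bullet> h)) (at x)" "continuous_on S g"
  shows "C1_on S f"
proof -
  have "grad f x = g x" if "x \<in> S" for x using assms(1)[OF that] by (rule grad_eqI)
  then show ?thesis using assms by (auto simp: C1_on_def cong: continuous_on_cong)
qed

lemma C1_on_has_derivative: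
  "C1_on S f \<Longrightarrow> x \<in> S \<Longrightarrow> (f has_derivative (\<lambda>h. grad f x \<bullet> h)) (at x)"
  by (auto simp: C1_on_def)

lemma C1_on_grad: "C1_on S f \<Longrightarrow> continuous_on S (grad f)"
  by (auto simp: C1_on_def)

lemma C1_on_continuous_on: "C1_on S f \<Longrightarrow> continuous_on S f"
  by (meson C1_on_def continuous_at_imp_continuous_on has_derivative_continuous)

lemma C1_on_subset: "C1_on S f \<Longrightarrow> T \<subseteq> S \<Longrightarrow> C1_on T f"
  by (auto simp: C1_on_def intro: continuous_on_subset)

lemma C1_on_cong:
  assumes "C1_on S f" "open S" "\<And>x. x \<in> S \<Longrightarrow> f x = g x"
  shows "C1_on S g"
proof (rule C1_onI)
  show "(g has_derivative (\<lambda>h. grad f x \<bullet> h)) (at x)" if "x \<in> S" for x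
    using has_derivative_transform_within_open[OF C1_on_has_derivative[OF assms(1) that] assms(2) that]
      assms(3) by auto
qed (rule C1_on_grad[OF assms(1)])

lemma C1_on_local:
  assumes "\<And>x. x \<in> S \<Longrightarrow> \<exists>U. open U \<and> x \<in> U \<and> C1_on U f"
  shows "C1_on S f"
  unfolding C1_on_def
proof (intro conjI ballI)
  show "continuous_on S (grad f)"
    unfolding continuous_on_eq_continuous_within
  proof
    fix x assume "x \<in> S"
    then obtain U where "open U" "x \<in> U" "C1_on U f" using assms by blast
    then have "isCont (grad f) x" using C1_on_grad continuous_on_eq_continuous_at by blast
    then show "continuous (at x within S) (grad f)" using continuous_at_imp_continuous_at_within by blast
  qed
qed (use assms C1_on_has_derivative in blast)

lemma C1_on_const: "C1_on S (\<lambda>x. c)"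
  by (rule C1_onI[where g = "\<lambda>_. 0"]) auto

lemma C1_on_component: "C1_on S (\<lambda>x. x $ i)"
  by (rule C1_onI[where g = "\<lambda>_. axis i 1"])
     (auto simp: inner_axis' intro!: bounded_linear.has_derivative[OF bounded_linear_vec_nth] has_derivative_ident)

lemma C1_on_add:
  assumes "C1_on S f" "C1_on S g" shows "C1_on S (\<lambda>x. f x + g x)"
  by (rule C1_onI[where g = "\<lambda>x. grad f x + grad g x"])
     (use assms in \<open>auto simp: inner_add_left C1_on_def intro!: continuous_intros has_derivative_add\<close>)

lemma C1_on_mult:
  assumes "C1_on S f" "C1_on S g" shows "C1_on S (\<lambda>x. f x * g x)"
proof (rule C1_onI[where g = "\<lambda>x. f x *\<^sub>R grad g x + g x *\<^sub>R grad f x"])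
  show "((\<lambda>x. f x * g x) has_derivative (\<lambda>h. (f x *\<^sub>R grad g x + g x *\<^sub>R grad f x) \<bullet> h)) (at x)"
    if "x \<in> S" for x
    using has_derivative_mult[OF C1_on_has_derivative[OF assms(1) that] C1_on_has_derivative[OF assms(2) that]]
    by (simp add: inner_add_left mult.commute)
qed (use assms C1_on_continuous_on C1_on_grad in \<open>auto intro!: continuous_intros\<close>)

lemma C1_on_cmult: "C1_on S f \<Longrightarrow> C1_on S (\<lambda>x. c * f x)"
  by (rule C1_on_mult[OF C1_on_const])

lemma C1_on_diff:
  assumes "C1_on S f" "C1_on S g" shows "C1_on S (\<lambda>x. f x - g x)"
  using C1_on_add[OF assms(1) C1_on_cmult[OF assms(2), of "-1"]] by simp

lemma C1_on_sum:
  "(\<And>i. i \<in> I \<Longrightarrow> C1_on S (f i)) \<Longrightarrow> C1_on S (\<lambda>x. \<Sum>i\<in>I. f i x)"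
  by (induction I rule: infinite_finite_induct) (auto intro: C1_on_const C1_on_add)

lemma C1_on_compose_real:
  assumes f: "C1_on S f"
    and h: "\<And>x. x \<in> S \<Longrightarrow> (h has_real_derivative h' (f x)) (at (f x))"
    and c: "continuous_on (f ` S) h'"
  shows "C1_on S (\<lambda>x. h (f x))"
proof (rule C1_onI[where g = "\<lambda>x. h' (f x) *\<^sub>R grad f x"])
  show "((\<lambda>x. h (f x)) has_derivative (\<lambda>k. (h' (f x) *\<^sub>R grad f x) \<bullet> k)) (at x)" if "x \<in> S" for x
    using has_derivative_compose[OF C1_on_has_derivative[OF f that]
        has_field_derivative_imp_has_derivative[OF h[OF that]]]
    by simp
  show "continuous_on S (\<lambda>x. h' (f x) *\<^sub>R grad f x)"
    using f c by (intro continuous_intros continuous_on_compose2[OF c])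
      (auto simp: C1_on_continuous_on C1_on_grad)
qed

lemmas C1_on_intros = C1_on_const C1_on_component C1_on_add C1_on_diff C1_on_mult C1_on_sum

definition C1_field :: "(real^'n::finite) set \<Rightarrow> (real^'n \<Rightarrow> real^'n) \<Rightarrow> bool" where
  "C1_field S Z \<longleftrightarrow> (\<forall>i. C1_on S (\<lambda>x. Z x $ i))"

definition dfield :: "(real^'n::finite \<Rightarrow> real^'n) \<Rightarrow> real^'n \<Rightarrow> real^'n \<Rightarrow> real^'n" where
  "dfield Z x h = (\<chi> i. grad (\<lambda>y. Z y $ i) x \<bullet> h)"

lemma has_derivative_vec_iff:
  "((Z :: 'a::real_normed_vector \<Rightarrow> real^'n::finite) has_derivative D) F \<longleftrightarrow> (\<forall>i. ((\<lambda>x. Z x $ i) has_derivative (\<lambda>h. D h $ i)) F)"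
proof
  assume "(Z has_derivative D) F"
  then show "\<forall>i. ((\<lambda>x. Z x $ i) has_derivative (\<lambda>h. D h $ i)) F"
    by (auto intro!: derivative_intros bounded_linear.has_derivative[OF bounded_linear_vec_nth])
next
  assume a: "\<forall>i. ((\<lambda>x. Z x $ i) has_derivative (\<lambda>h. D h $ i)) F"
  have "((\<lambda>x. \<Sum>i\<in>UNIV. Z x $ i *\<^sub>R (axis i 1 :: real^'n)) has_derivative
      (\<lambda>h. \<Sum>i\<in>UNIV. D h $ i *\<^sub>R (axis i 1 :: real^'n))) F"
    by (intro has_derivative_sum has_derivative_scaleR_left) (use a in blast)
  moreover have "(\<Sum>i\<in>UNIV. z $ i *\<^sub>R axis i 1) = z" for z :: "real^'n"
    using basis_expansion[of z] by (simp add: scalar_mult_eq_scaleR)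
  ultimately show "(Z has_derivative D) F" by simp
qed

lemma C1_field_has_derivative:
  "C1_field S Z \<Longrightarrow> x \<in> S \<Longrightarrow> (Z has_derivative dfield Z x) (at x)"
  unfolding has_derivative_vec_iff dfield_def C1_field_def
  using C1_on_has_derivative by fastforce

lemma dfield_eqI: "(Z has_derivative D) (at x) \<Longrightarrow> C1_field S Z \<Longrightarrow> x \<in> S \<Longrightarrow> dfield Z x = D"
  using C1_field_has_derivative has_derivative_unique by blast

lemma C1_field_continuous_dfield:
  "C1_field S Z \<Longrightarrow> continuous_on S y \<Longrightarrow> continuous_on S (\<lambda>x. dfield Z x (y x))"
  unfolding dfield_def C1_field_def
  by (intro continuous_on_vec_lambda continuous_intros) (auto simp: C1_on_grad)

lemma C1_field_continuous_on: "C1_field S Z \<Longrightarrow> continuous_on S Z"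
  by (simp add: C1_field_def continuous_on_vec_iff C1_on_continuous_on)

lemma C1_on_compose:
  assumes f: "C1_on T f" and G: "C1_field S G" and "G ` S \<subseteq> T"
  shows "C1_on S (\<lambda>x. f (G x))"
proof (rule C1_onI[where g = "\<lambda>x. \<Sum>i\<in>UNIV. grad f (G x) $ i *\<^sub>R grad (\<lambda>y. G y $ i) x"])
  show "((\<lambda>x. f (G x)) has_derivative
      (\<lambda>h. (\<Sum>i\<in>UNIV. grad f (G x) $ i *\<^sub>R grad (\<lambda>y. G y $ i) x) \<bullet> h)) (at x)" if "x \<in> S" for x
  proof -
    have "G x \<in> T" using assms(3) that by auto
    from has_derivative_compose[OF C1_field_has_derivative[OF G that] C1_on_has_derivative[OF f this]]
    show ?thesis by (simp add: dfield_def inner_sum_left inner_vec_def[of "grad f (G x)"])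
  qed
  show "continuous_on S (\<lambda>x. \<Sum>i\<in>UNIV. grad f (G x) $ i *\<^sub>R grad (\<lambda>y. G y $ i) x)"
    using G assms(3) unfolding C1_field_def
    by (intro continuous_intros continuous_on_compose2[OF C1_on_grad[OF f]] C1_field_continuous_on[OF G])
       (auto simp: C1_on_grad)
qed

lemma C1_field_inner:
  assumes "C1_field S Y" "C1_field S Z" shows "C1_on S (\<lambda>x. Y x \<bullet> Z x)"
  using assms unfolding inner_vec_def C1_field_def by (auto intro!: C1_on_intros)

lemma C1_field_scaleR:
  assumes "C1_on S f" "C1_field S Z" shows "C1_field S (\<lambda>x. f x *\<^sub>R Z x)"
  using assms unfolding C1_field_def by (auto intro!: C1_on_intros)

lemma C1_field_diff:
  assumes "C1_field S Y" "C1_field S Z" shows "C1_field S (\<lambda>x. Y x - Z x)"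
  using assms unfolding C1_field_def by (auto intro!: C1_on_intros)

lemma C1_field_subset: "C1_field S Z \<Longrightarrow> T \<subseteq> S \<Longrightarrow> C1_field T Z"
  unfolding C1_field_def using C1_on_subset by blast

text \<open>Compact support makes values and derivatives bounded and integrable, and is kept by multiplication
with \<open>C\<^sup>1\<close> functions.\<close>

definition C1c :: "(real^'n::finite \<Rightarrow> real) \<Rightarrow> bool" where
  "C1c f \<longleftrightarrow> C1_on UNIV f \<and> (\<exists>R. \<forall>x. R < norm x \<longrightarrow> f x = 0)"

lemma C1c_C1_on: "C1c f \<Longrightarrow> C1_on S f"
  unfolding C1c_def using C1_on_subset by blast

lemma C1c_mult_left: "C1c f \<Longrightarrow> C1_on UNIV g \<Longrightarrow> C1c (\<lambda>x. f x * g x)"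
  unfolding C1c_def by (auto intro: C1_on_mult) 

lemma C1c_mult: "C1c f \<Longrightarrow> C1c g \<Longrightarrow> C1c (\<lambda>x. f x * g x)"
  using C1c_mult_left C1c_C1_on by blast

lemma C1c_0: "C1c (\<lambda>x. 0)"
  unfolding C1c_def by (auto intro: C1_on_const)

lemma C1c_cmult: "C1c f \<Longrightarrow> C1c (\<lambda>x. c * f x)"
  unfolding C1c_def by (auto intro: C1_on_cmult)

lemma C1c_add: assumes "C1c f" "C1c g" shows "C1c (\<lambda>x. f x + g x)"
proof -
  obtain R1 R2 where "\<forall>x. R1 < norm x \<longrightarrow> f x = 0" "\<forall>x. R2 < norm x \<longrightarrow> g x = 0"
    using assms by (auto simp: C1c_def)
  then have "\<forall>x. max R1 R2 < norm x \<longrightarrow> f x + g x = 0" by auto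
  then show ?thesis using assms C1_on_add unfolding C1c_def by blast
qed

lemma C1c_diff: "C1c f \<Longrightarrow> C1c g \<Longrightarrow> C1c (\<lambda>x. f x - g x)"
  using C1c_add[of f "\<lambda>x. - 1 * g x"] C1c_cmult[of g "-1"] by simp

lemma C1c_sum: "(\<And>i. i \<in> I \<Longrightarrow> C1c (f i)) \<Longrightarrow> C1c (\<lambda>x. \<Sum>i\<in>I. f i x)"
  by (induction I rule: infinite_finite_induct) (auto intro: C1c_0 C1c_add)

lemma grad_outside_support:
  assumes "\<And>x. R < norm x \<Longrightarrow> f x = 0" "R < norm x"
  shows "grad f x = 0"
proof (rule grad_eqI)
  have o: "open {x::real^'n. R < norm x}"
    by (simp add: open_Collect_less continuous_on_norm_id)
  have "((\<lambda>x. 0) has_derivative (\<lambda>h. 0)) (at x)" by simp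
  then show "(f has_derivative (\<lambda>h. 0 \<bullet> h)) (at x)"
    using has_derivative_transform_within_open[OF _ o, of "\<lambda>x. 0" "\<lambda>h. 0" x UNIV f] assms by auto
qed

lemma bounded_of_compact_support:
  fixes f :: "real^'n::finite \<Rightarrow> 'b::real_normed_vector"
  assumes "continuous_on UNIV f" "\<And>x. R < norm x \<Longrightarrow> f x = 0"
  obtains B where "B > 0" "\<And>x. norm (f x) \<le> B"
proof -
  have "compact (f ` cball 0 R)"
    by (rule compact_continuous_image) (auto intro: continuous_on_subset[OF assms(1)])
  then obtain B where B: "\<forall>y\<in>f ` cball 0 R. norm y \<le> B" using compact_imp_bounded bounded_iff by blast
  have "norm (f x) \<le> \<bar>B\<bar> + 1" for x
  proof (cases "norm x \<le> R")
    case True then show ?thesis using B by force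
  next
    case False then show ?thesis using assms(2)[of x] by simp
  qed
  then show thesis using that[of "\<bar>B\<bar> + 1"] by auto
qed

lemma C1c_bounded:
  assumes "C1c f" obtains B where "B > 0" "\<And>x. \<bar>f x\<bar> \<le> B"
proof -
  obtain R where R: "\<And>x. R < norm x \<Longrightarrow> f x = 0" using assms by (auto simp: C1c_def)
  have "continuous_on UNIV f" using assms C1_on_continuous_on C1c_C1_on by blast
  from bounded_of_compact_support[OF this R] show thesis using that by auto
qed

lemma C1c_grad_bounded:
  assumes "C1c f" obtains B where "B > 0" "\<And>x. norm (grad f x) \<le> B"
proof -
  obtain R where R: "\<And>x. R < norm x \<Longrightarrow> f x = 0" using assms by (auto simp: C1c_def)
  have "continuous_on UNIV (grad f)" using assms C1_on_grad C1c_C1_on by blast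
  then obtain B where "B > 0" "\<And>x. norm (grad f x) \<le> B"
    using bounded_of_compact_support[of "grad f" R] grad_outside_support[of R f] R by blast
  then show thesis using that by blast
qed

lemma C1_on_sqrt:
  assumes "C1_on S f" "\<And>x. x \<in> S \<Longrightarrow> f x > 0" shows "C1_on S (\<lambda>x. sqrt (f x))"
proof (rule C1_on_compose_real[OF assms(1), where h' = "\<lambda>t. inverse (sqrt t) / 2"])
  show "(sqrt has_real_derivative inverse (sqrt (f x)) / 2) (at (f x))" if "x \<in> S" for x
    using DERIV_real_sqrt[OF assms(2)[OF that]] .
qed (use assms(2) in \<open>force intro!: continuous_intros\<close>)

section \<open>Partitions of unity\<close>

text \<open>Squaring removes the corner of the positive part. This gives \<open>C\<^sup>1\<close> bump functions without any
exponential, and one continuous derivative is all that is used below.\<close>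

lemma C1_on_max_sq:
  assumes "C1_on S f" shows "C1_on S (\<lambda>x. (max 0 (f x))\<^sup>2)"
proof -
  have "((\<lambda>t::real. (max 0 t)\<^sup>2) has_real_derivative 2 * max 0 t) (at t)" for t
  proof -
    consider "t > 0" | "t < 0" | "t = 0" by linarith
    then show ?thesis
    proof cases
      case 1
      have "((\<lambda>t::real. t\<^sup>2) has_real_derivative 2 * max 0 t) (at t)"
        using 1 by (auto intro!: derivative_eq_intros)
      then show ?thesis
        by (rule has_field_derivative_transform_within_open[of _ _ _ "{0<..}"]) (use 1 in auto)
    next
      case 2
      have "((\<lambda>t::real. 0) has_real_derivative 2 * max 0 t) (at t)"
        using 2 by (auto intro!: derivative_eq_intros)
      then show ?thesis
        by (rule has_field_derivative_transform_within_open[of _ _ _ "{..<0}"]) (use 2 in auto)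
    next
      case 3
      have "((\<lambda>h::real. max 0 h) \<longlongrightarrow> max 0 0) (at 0)" by (intro tendsto_intros)
      then have "((\<lambda>h::real. max 0 h) \<longlongrightarrow> 0) (at 0)" by simp
      then have "((\<lambda>h::real. (max 0 h)\<^sup>2 / h) \<longlongrightarrow> 0) (at 0)"
        by (rule Lim_transform_within[of _ _ _ _ 1]) (auto simp: max_def power2_eq_square)
      then show ?thesis using 3 by (simp add: DERIV_def)
    qed
  qed
  then show ?thesis
    by (rule C1_on_compose_real[OF assms]) (intro continuous_intros)
qed

lemma C1_on_inverse:
  assumes "C1_on S f" "\<And>x. x \<in> S \<Longrightarrow> f x \<noteq> 0" shows "C1_on S (\<lambda>x. inverse (f x))"
proof (rule C1_on_compose_real[OF assms(1), where h' = "\<lambda>t. - (inverse t ^ 2)"])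
  show "(inverse has_real_derivative - (inverse (f x) ^ 2)) (at (f x))" if "x \<in> S" for x
    using DERIV_inverse[of "f x" UNIV] assms(2)[OF that] by (simp add: numeral_2_eq_2)
qed (use assms(2) in \<open>auto intro!: continuous_intros\<close>)

lemma C1_on_dist_sq: "C1_on S (\<lambda>x. (dist x p)\<^sup>2)"
proof -
  have "(\<lambda>x. (dist x p)\<^sup>2) = (\<lambda>x. \<Sum>i\<in>UNIV. (x $ i - p $ i) * (x $ i - p $ i))"
    by (simp add: dist_norm power2_norm_eq_inner inner_vec_def)
  then show ?thesis by (auto intro!: C1_on_intros)
qed

text \<open>The bump at \<open>p\<close> is \<open>(max 0 (r\<^sup>2 - |x - p|\<^sup>2))\<^sup>2\<close>; finitely many of them have a positive sum on \<open>K\<close>, by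
which they are divided.\<close>

lemma partition_of_unity:
  fixes K :: "(real^'n::finite) set"
  assumes K: "compact K" and Op: "\<And>p. p \<in> K \<Longrightarrow> open (W p) \<and> p \<in> W p"
  obtains A \<eta> where "finite A" "A \<subseteq> K" "\<And>p. p \<in> A \<Longrightarrow> C1c (\<eta> p)"
    "\<And>p. p \<in> A \<Longrightarrow> \<exists>C. compact C \<and> C \<subseteq> W p \<and> (\<forall>x. x \<notin> C \<longrightarrow> \<eta> p x = 0)"
    "\<And>x. x \<in> K \<Longrightarrow> (\<Sum>p\<in>A. \<eta> p x) = (1::real)"
proof -
  have "\<forall>p\<in>K. \<exists>r>0. cball p r \<subseteq> W p" using Op open_contains_cball by blast
  then obtain r where r: "\<And>p. p \<in> K \<Longrightarrow> r p > 0" "\<And>p. p \<in> K \<Longrightarrow> cball p (r p) \<subseteq> W p" by metis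
  have "K \<subseteq> (\<Union>p\<in>K. ball p (r p))" using r(1) by force
  then obtain A where A: "A \<subseteq> K" "finite A" "K \<subseteq> (\<Union>p\<in>A. ball p (r p))"
    using compactE_image[OF K, of K "\<lambda>p. ball p (r p)"] by (metis open_ball)
  define \<theta> where "\<theta> p x = (max 0 ((r p)\<^sup>2 - (dist x p)\<^sup>2))\<^sup>2" for p x
  define \<sigma> where "\<sigma> x = (\<Sum>p\<in>A. \<theta> p x)" for x
  have C\<theta>: "C1_on S (\<theta> p)" for S p
    unfolding \<theta>_def by (intro C1_on_max_sq C1_on_diff C1_on_const C1_on_dist_sq)
  have C\<sigma>: "C1_on S \<sigma>" for S unfolding \<sigma>_def by (intro C1_on_sum C\<theta>)
  have \<theta>0: "\<theta> p x \<ge> 0" for p x by (simp add: \<theta>_def)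
  have \<sigma>0: "\<sigma> x \<ge> 0" for x by (auto simp: \<sigma>_def intro: sum_nonneg \<theta>0)
  have \<theta>out: "\<theta> p x = 0" if "p \<in> A" "x \<notin> cball p (r p)" for p x
  proof -
    have "r p > 0" using r(1) that A(1) by blast
    then have "(r p)\<^sup>2 \<le> (dist x p)\<^sup>2" using that(2) by (auto simp: dist_commute intro: power_mono)
    then show ?thesis by (simp add: \<theta>_def)
  qed
  have \<sigma>pos: "\<sigma> x > 0" if x: "x \<in> K" for x
  proof -
    obtain p where p: "p \<in> A" "dist x p < r p" using A(3) x by (auto simp: dist_commute)
    then have "(dist x p)\<^sup>2 < (r p)\<^sup>2" by (simp add: power_strict_mono)
    then have "\<theta> p x > 0" by (simp add: \<theta>_def)
    then show ?thesis unfolding \<sigma>_def using p A(2) \<theta>0 by (simp add: sum_pos2)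
  qed
  obtain c where c: "c > 0" "\<And>x. x \<in> K \<Longrightarrow> c \<le> \<sigma> x"
  proof (cases "K = {}")
    case True then show thesis using that[of 1] by auto
  next
    case False
    have "continuous_on K \<sigma>" using C\<sigma> C1_on_continuous_on by blast
    from continuous_attains_inf[OF K False this] obtain z where "z \<in> K" "\<forall>y\<in>K. \<sigma> z \<le> \<sigma> y" by blast
    then show thesis using that[of "\<sigma> z"] \<sigma>pos by auto
  qed
  \<comment> \<open>A denominator that agrees with \<open>\<sigma>\<close> on \<open>K\<close> but vanishes nowhere.\<close>
  define d where "d x = \<sigma> x + (max 0 (c - \<sigma> x))\<^sup>2" for x
  have Cd: "C1_on UNIV d" unfolding d_def by (intro C1_on_add C1_on_max_sq C1_on_diff C1_on_const C\<sigma>)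
  have dpos: "d x \<noteq> 0" for x
    using \<sigma>0[of x] c(1) unfolding d_def
    by (cases "\<sigma> x > 0") (auto simp: add_nonneg_eq_0_iff)
  have dK: "d x = \<sigma> x" if "x \<in> K" for x using c(2)[OF that] by (simp add: d_def)
  define \<eta> where "\<eta> p x = \<theta> p x * inverse (d x)" for p x
  show thesis
  proof (rule that[of A \<eta>])
    show "C1c (\<eta> p)" if "p \<in> A" for p
      unfolding C1c_def
    proof
      show "C1_on UNIV (\<eta> p)" unfolding \<eta>_def by (intro C1_on_mult C\<theta> C1_on_inverse Cd dpos)
      have "\<eta> p x = 0" if x: "norm p + r p < norm x" for x
      proof -
        have "dist p x > r p" using norm_triangle_ineq2[of x p] x by (simp add: dist_norm norm_minus_commute)
        then show ?thesis using \<theta>out[OF \<open>p \<in> A\<close>, of x] by (simp add: \<eta>_def)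
      qed
      then show "\<exists>R. \<forall>x. R < norm x \<longrightarrow> \<eta> p x = 0" by blast
    qed
    show "\<exists>C. compact C \<and> C \<subseteq> W p \<and> (\<forall>x. x \<notin> C \<longrightarrow> \<eta> p x = 0)" if "p \<in> A" for p
      using r(2)[of p] that A(1) \<theta>out[OF that]
      by (intro exI[of _ "cball p (r p)"]) (auto simp: \<eta>_def)
    show "(\<Sum>p\<in>A. \<eta> p x) = 1" if "x \<in> K" for x
      using \<sigma>pos[OF that] dK[OF that]
      by (simp add: \<eta>_def sum_distrib_right[symmetric] \<sigma>_def[symmetric])
  qed (use A in auto)
qed

lemma C1c_mult_local:
  assumes "C1c \<eta>" "compact C" "C \<subseteq> U" "\<forall>x. x \<notin> C \<longrightarrow> \<eta> x = 0" "open U" "C1_on U g"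
  shows "C1c (\<lambda>x. \<eta> x * g x)"
  unfolding C1c_def
proof
  show "C1_on UNIV (\<lambda>x. \<eta> x * g x)"
  proof (rule C1_on_local)
    fix x
    show "\<exists>V. open V \<and> x \<in> V \<and> C1_on V (\<lambda>x. \<eta> x * g x)"
    proof (cases "x \<in> C")
      case True
      then show ?thesis using assms by (intro exI[of _ U]) (auto intro: C1_on_mult C1c_C1_on)
    next
      case False
      have "open (- C)" using assms(2) by (simp add: compact_imp_closed open_Compl)
      moreover have "C1_on (- C) (\<lambda>x. \<eta> x * g x)"
        by (rule C1_on_cong[OF C1_on_const[of _ 0] \<open>open (- C)\<close>]) (use assms(4) in auto)
      ultimately show ?thesis using False by auto
    qed
  qed
  show "\<exists>R. \<forall>x. R < norm x \<longrightarrow> \<eta> x * g x = 0" using assms(1) by (auto simp: C1c_def)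
qed

text \<open>Gluing local extensions with a partition of unity. It serves both for functions on the closed domain
and for the unit normal on the boundary.\<close>

lemma C1c_of_local:
  fixes K :: "(real^'n::finite) set"
  assumes K: "compact K"
    and loc: "\<And>p. p \<in> K \<Longrightarrow> \<exists>U g. open U \<and> p \<in> U \<and> C1_on U g \<and> (\<forall>x\<in>U \<inter> K. g x = f x)"
  shows "\<exists>F. C1c F \<and> (\<forall>x\<in>K. F x = f x)"
proof -
  obtain U g where U: "\<And>p. p \<in> K \<Longrightarrow> open (U p) \<and> p \<in> U p"
    and g: "\<And>p. p \<in> K \<Longrightarrow> C1_on (U p) (g p) \<and> (\<forall>x\<in>U p \<inter> K. g p x = f x)"
    using loc by metis
  obtain A \<eta> where A: "finite A" "A \<subseteq> K" "\<And>p. p \<in> A \<Longrightarrow> C1c (\<eta> p)"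
    "\<And>p. p \<in> A \<Longrightarrow> \<exists>C. compact C \<and> C \<subseteq> U p \<and> (\<forall>x. x \<notin> C \<longrightarrow> \<eta> p x = 0)"
    "\<And>x. x \<in> K \<Longrightarrow> (\<Sum>p\<in>A. \<eta> p x) = (1::real)"
    using partition_of_unity[OF K U] by blast
  define F where "F x = (\<Sum>p\<in>A. \<eta> p x * g p x)" for x
  have "C1c F" unfolding F_def
  proof (rule C1c_sum)
    fix p assume p: "p \<in> A"
    obtain C where "compact C" "C \<subseteq> U p" "\<forall>x. x \<notin> C \<longrightarrow> \<eta> p x = 0" using A(4)[OF p] by blast
    then show "C1c (\<lambda>x. \<eta> p x * g p x)"
      using C1c_mult_local A(3)[OF p] U g p A(2) by blast
  qed
  moreover have "F x = f x" if "x \<in> K" for x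
  proof -
    have "\<eta> p x * g p x = \<eta> p x * f x" if p: "p \<in> A" for p
    proof (cases "x \<in> U p")
      case True
      have "p \<in> K" using p A(2) by blast
      then have "g p x = f x" using g True \<open>x \<in> K\<close> by blast
      then show ?thesis by simp
    next
      case False
      then have "\<eta> p x = 0" using A(4)[OF p] by blast
      then show ?thesis by simp
    qed
    then have "F x = (\<Sum>p\<in>A. \<eta> p x) * f x"
      unfolding F_def sum_distrib_right by (rule sum.cong[OF refl])
    then show ?thesis using A(5)[OF that] by simp
  qed
  ultimately show ?thesis by blast
qed

section \<open>Symmetry of mixed partial derivatives\<close>

text \<open>Both sides are limits of the second difference \<open>K h h - K h 0 - K 0 h + K 0 0\<close> divided by \<open>h\<^sup>2\<close>, which
the mean value theorem evaluates in either order of the variables. The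
hypotheses speak of derivatives of \<open>K\<close> in the two variables separately, which is the form in which
\<open>stokes_two_form\<close> obtains them.\<close>

lemma mixed_partials_eq:
  fixes K A B C D :: "real \<Rightarrow> real \<Rightarrow> real"
  assumes \<delta>: "\<delta> > 0"
    and A: "\<And>p q. \<bar>p\<bar> < \<delta> \<Longrightarrow> \<bar>q\<bar> < \<delta> \<Longrightarrow> ((\<lambda>p. K p q) has_real_derivative A p q) (at p)"
    and B: "\<And>p q. \<bar>p\<bar> < \<delta> \<Longrightarrow> \<bar>q\<bar> < \<delta> \<Longrightarrow> ((\<lambda>q. K p q) has_real_derivative B p q) (at q)"
    and C: "\<And>p q. \<bar>p\<bar> < \<delta> \<Longrightarrow> \<bar>q\<bar> < \<delta> \<Longrightarrow> ((\<lambda>q. A p q) has_real_derivative C p q) (at q)"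
    and D: "\<And>p q. \<bar>p\<bar> < \<delta> \<Longrightarrow> \<bar>q\<bar> < \<delta> \<Longrightarrow> ((\<lambda>p. B p q) has_real_derivative D p q) (at p)"
    and cC: "isCont (\<lambda>z. C (fst z) (snd z)) (0, 0)"
    and cD: "isCont (\<lambda>z. D (fst z) (snd z)) (0, 0)"
  shows "C 0 0 = D 0 0"
proof (rule ccontr)
  assume ne: "C 0 0 \<noteq> D 0 0"
  define \<epsilon> where "\<epsilon> = \<bar>C 0 0 - D 0 0\<bar> / 2"
  have \<epsilon>: "\<epsilon> > 0" using ne by (simp add: \<epsilon>_def)
  obtain d1 where d1: "d1 > 0" "\<And>z. dist z (0, 0) < d1 \<Longrightarrow> \<bar>C (fst z) (snd z) - C 0 0\<bar> < \<epsilon>"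
    using cC \<epsilon> unfolding continuous_at_eps_delta by (fastforce simp: dist_real_def)
  obtain d2 where d2: "d2 > 0" "\<And>z. dist z (0, 0) < d2 \<Longrightarrow> \<bar>D (fst z) (snd z) - D 0 0\<bar> < \<epsilon>"
    using cD \<epsilon> unfolding continuous_at_eps_delta by (fastforce simp: dist_real_def)
  define h where "h = min \<delta> (min d1 d2) / 2"
  have h: "0 < h" "h < \<delta>" "2 * h \<le> d1" "2 * h \<le> d2" using \<delta> d1(1) d2(1) by (auto simp: h_def)
  have near: "dist (p, q) (0, 0) < 2 * h" if "0 < p" "p < h" "0 < q" "q < h" for p q :: real
  proof -
    have "dist (p, q) (0, 0) \<le> \<bar>p\<bar> + \<bar>q\<bar>"
      using norm_Pair_le[of p q] by (simp add: dist_norm)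
    then show ?thesis using that by simp
  qed
  have dK: "((\<lambda>p. K p h - K p 0) has_real_derivative A p h - A p 0) (at p)" if "0 \<le> p" "p \<le> h" for p
    using that h by (intro DERIV_diff A) auto
  have dK': "((\<lambda>q. K h q - K 0 q) has_real_derivative B h q - B 0 q) (at q)" if "0 \<le> q" "q \<le> h" for q
    using that h by (intro DERIV_diff B) auto
  have dA: "(A p has_real_derivative C p q) (at q)" if "0 < p" "p < h" "0 \<le> q" "q \<le> h" for p q
    using that h by (intro C) auto
  have dB: "((\<lambda>p. B p q) has_real_derivative D p q) (at p)" if "0 < q" "q < h" "0 \<le> p" "p \<le> h" for p q
    using that h by (intro D) auto
  obtain p where p: "0 < p" "p < h" "(K h h - K h 0) - (K 0 h - K 0 0) = (h - 0) * (A p h - A p 0)"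
    using MVT2[of 0 h "\<lambda>p. K p h - K p 0" "\<lambda>p. A p h - A p 0"] h(1) dK by auto
  obtain q where q: "0 < q" "q < h" "A p h - A p 0 = (h - 0) * C p q"
    using MVT2[of 0 h "\<lambda>q. A p q" "\<lambda>q. C p q"] h(1) dA[OF p(1,2)] by auto
  obtain q' where q': "0 < q'" "q' < h" "(K h h - K 0 h) - (K h 0 - K 0 0) = (h - 0) * (B h q' - B 0 q')"
    using MVT2[of 0 h "\<lambda>q. K h q - K 0 q" "\<lambda>q. B h q - B 0 q"] h(1) dK' by auto
  obtain p' where p': "0 < p'" "p' < h" "B h q' - B 0 q' = (h - 0) * D p' q'"
    using MVT2[of 0 h "\<lambda>p. B p q'" "\<lambda>p. D p q'"] h(1) dB[OF q'(1,2)] by auto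
  have "h * (h * C p q) = h * (h * D p' q')" 
    using p(3) q(3) q'(3) p'(3) by (simp add: algebra_simps)
  with h(1) have "C p q = D p' q'" by simp
  moreover have "\<bar>C p q - C 0 0\<bar> < \<epsilon>" using d1(2)[of "(p, q)"] near[OF p(1,2) q(1,2)] h by simp
  moreover have "\<bar>D p' q' - D 0 0\<bar> < \<epsilon>" using d2(2)[of "(p', q')"] near[OF p'(1,2) q'(1,2)] h by simp
  moreover have "\<bar>C 0 0 - D 0 0\<bar> \<le> \<bar>C p q - D 0 0\<bar> + \<bar>C p q - C 0 0\<bar>" by linarith
  ultimately have "\<bar>C 0 0 - D 0 0\<bar> < \<epsilon> + \<epsilon>" by simp
  then show False by (simp add: \<epsilon>_def)
qed

lemma has_real_derivative_line:
  assumes "(f has_derivative f') (at (x + t *\<^sub>R e))"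
  shows "((\<lambda>t. f (x + t *\<^sub>R e)) has_real_derivative f' e) (at t)"
proof -
  have l: "((\<lambda>t. x + t *\<^sub>R e) has_derivative (\<lambda>k. k *\<^sub>R e)) (at t)"
    by (auto intro!: derivative_eq_intros)
  interpret linear f' by (rule has_derivative_linear[OF assms])
  from has_derivative_compose[OF l assms] show ?thesis
    by (simp add: has_field_derivative_def scaleR mult.commute[of _ "f' e"])
qed

text \<open>The two sides are the mixed derivatives of \<open>f (x + p h + q k)\<close> at the origin.\<close>

lemma second_derivative_symmetric:
  assumes S: "open S" "x \<in> S" and f: "C1_on S f" and Z: "C1_field S Z"
    and fZ: "\<And>y. y \<in> S \<Longrightarrow> grad f y = Z y"
  shows "dfield Z x h \<bullet> k = dfield Z x k \<bullet> h"
proof -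
  obtain e where e: "e > 0" "ball x e \<subseteq> S" using S open_contains_ball by blast
  define \<delta> where "\<delta> = e / (norm h + norm k + 1)"
  have np: "norm h + norm k + 1 > 0" using norm_ge_zero[of h] norm_ge_zero[of k] by linarith
  have \<delta>: "\<delta> > 0" using e(1) np by (simp add: \<delta>_def)
  have inS: "x + p *\<^sub>R h + q *\<^sub>R k \<in> S" if "\<bar>p\<bar> < \<delta>" "\<bar>q\<bar> < \<delta>" for p q
  proof -
    have "norm (p *\<^sub>R h + q *\<^sub>R k) \<le> \<bar>p\<bar> * norm h + \<bar>q\<bar> * norm k"
      using norm_triangle_ineq[of "p *\<^sub>R h" "q *\<^sub>R k"] by simp
    also have "\<dots> \<le> \<delta> * norm h + \<delta> * norm k" using that by (intro add_mono mult_right_mono) auto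
    also have "\<dots> < \<delta> * (norm h + norm k + 1)" using \<delta> by (simp add: algebra_simps)
    also have "\<dots> = e" using np by (simp add: \<delta>_def)
    finally have "x + (p *\<^sub>R h + q *\<^sub>R k) \<in> ball x e" by (metis add_diff_cancel_left' dist_commute dist_norm mem_ball)
    then show ?thesis using e(2) by (auto simp: add.assoc)
  qed
  let ?y = "\<lambda>p q. x + p *\<^sub>R h + q *\<^sub>R k"
  have df: "(f has_derivative (\<lambda>v. Z y \<bullet> v)) (at y)" if "y \<in> S" for y
    using C1_on_has_derivative[OF f that] fZ[OF that] by simp
  have dZ: "((\<lambda>y. Z y \<bullet> w) has_derivative (\<lambda>v. dfield Z y v \<bullet> w)) (at y)" if "y \<in> S" for y w
    using has_derivative_inner_left[OF C1_field_has_derivative[OF Z that]] .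
  have cont: "isCont (\<lambda>z. dfield Z (?y (fst z) (snd z)) v \<bullet> w) (0, 0)" for v w
  proof -
    have "isCont (\<lambda>y. dfield Z y v \<bullet> w) x"
      using C1_field_continuous_dfield[OF Z, of "\<lambda>_. v"] S
      by (auto intro!: continuous_intros simp: continuous_on_eq_continuous_at)
    then have a: "isCont (\<lambda>y. dfield Z y v \<bullet> w) (?y (fst (0::real, 0::real)) (snd (0::real, 0::real)))" by simp
    have i: "isCont (\<lambda>z::real \<times> real. ?y (fst z) (snd z)) (0, 0)" by (intro continuous_intros)
    show ?thesis by (rule isCont_o2[OF i a])
  qed
  have sw: "?y p q = (x + q *\<^sub>R k) + p *\<^sub>R h" for p q by (simp add: algebra_simps)
  have "dfield Z (?y 0 0) k \<bullet> h = dfield Z (?y 0 0) h \<bullet> k"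
  proof (rule mixed_partials_eq[OF \<delta>, where K = "\<lambda>p q. f (?y p q)"
        and A = "\<lambda>p q. Z (?y p q) \<bullet> h" and B = "\<lambda>p q. Z (?y p q) \<bullet> k"
        and C = "\<lambda>p q. dfield Z (?y p q) k \<bullet> h" and D = "\<lambda>p q. dfield Z (?y p q) h \<bullet> k"])
    fix p q :: real assume pq: "\<bar>p\<bar> < \<delta>" "\<bar>q\<bar> < \<delta>"
    note i = inS[OF pq]
    show "((\<lambda>q. f (?y p q)) has_real_derivative Z (?y p q) \<bullet> k) (at q)"
      by (rule has_real_derivative_line[OF df[OF i]])
    show "((\<lambda>q. Z (?y p q) \<bullet> h) has_real_derivative dfield Z (?y p q) k \<bullet> h) (at q)"
      by (rule has_real_derivative_line[OF dZ[OF i]])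
    show "((\<lambda>p. f (?y p q)) has_real_derivative Z (?y p q) \<bullet> h) (at p)"
      unfolding sw by (rule has_real_derivative_line[OF df]) (use i sw[of p q] in simp)
    show "((\<lambda>p. Z (?y p q) \<bullet> k) has_real_derivative dfield Z (?y p q) h \<bullet> k) (at p)"
      unfolding sw by (rule has_real_derivative_line[OF dZ]) (use i sw[of p q] in simp)
  qed (rule cont)+
  then show ?thesis by simp
qed

section \<open>Boundary charts\<close>

text \<open>A segment that crosses the hyperplane meets it once, so the fundamental theorem of calculus with a
finite exceptional set controls \<open>f\<close> along it by the oscillation of \<open>g\<close>. Segments inside the hyperplane
are limits of such segments.\<close>

lemma C1_across_hyperplane:
  fixes f :: "real^'n::finite \<Rightarrow> real"
  assumes U: "open U" and f: "continuous_on U f" and g: "continuous_on U g"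
    and d: "\<And>x. x \<in> U \<Longrightarrow> x $ k \<noteq> 0 \<Longrightarrow> (f has_derivative (\<lambda>h. g x \<bullet> h)) (at x)"
  shows "C1_on U f"
proof (rule C1_onI[OF _ g])
  fix a assume a: "a \<in> U"
  show "(f has_derivative (\<lambda>h. g a \<bullet> h)) (at a)"
    unfolding has_derivative_at_alt
  proof (intro conjI allI impI)
    fix e :: real assume e: "e > 0"
    obtain d1 where d1: "d1 > 0" "ball a d1 \<subseteq> U" using U a open_contains_ball by blast
    have "isCont g a" using g U a continuous_on_eq_continuous_at by blast
    then obtain d2 where d2: "d2 > 0" "\<And>x. dist x a < d2 \<Longrightarrow> dist (g x) (g a) < e"
      using e unfolding continuous_at_eps_delta by blast
    define \<delta> where "\<delta> = min d1 d2"
    have \<delta>: "\<delta> > 0" using d1 d2 by (simp add: \<delta>_def)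
    have inU: "x \<in> U" if "x \<in> ball a \<delta>" for x using that d1(2) by (auto simp: \<delta>_def)
    have gd: "norm (g x - g a) \<le> e" if "x \<in> ball a \<delta>" for x
      using d2(2)[of x] that by (simp add: \<delta>_def dist_commute[of a] dist_norm[of "g x"])
      have transversal: "norm (f y - f x - g a \<bullet> (y - x)) \<le> e * norm (y - x)"
      if x: "x \<in> ball a \<delta>" and y: "y \<in> ball a \<delta>" and ne: "x $ k \<noteq> y $ k" for x y
    proof -
      let ?z = "\<lambda>t. x + t *\<^sub>R (y - x)"
      have z: "?z t \<in> ball a \<delta>" if "t \<in> {0..1}" for t
        using convexD_alt[OF convex_ball x y, of t] that by (simp add: algebra_simps)
      define q where "q t = f (?z t) - g a \<bullet> ?z t" for t
      define T where "T = {t. x $ k + t * (y $ k - x $ k) = 0}"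
      have "t = - x $ k / (y $ k - x $ k)" if "t \<in> T" for t
        using that ne by (simp add: T_def field_simps)
      then have "T \<subseteq> {- x $ k / (y $ k - x $ k)}" by blast
      then have T: "finite T" by (rule finite_subset) simp
      have "((\<lambda>t. (g (?z t) - g a) \<bullet> (y - x)) has_integral (q 1 - q 0)) {0..1}"
      proof (rule fundamental_theorem_of_calculus_interior_strong[OF T])
        fix t assume t: "t \<in> {0<..<1} - T"
        have zk: "?z t $ k \<noteq> 0" using t by (auto simp: T_def)
        have zU: "?z t \<in> U" using t inU[OF z[of t]] by simp
        have "((\<lambda>z. f z - g a \<bullet> z) has_derivative (\<lambda>h. g (?z t) \<bullet> h - g a \<bullet> h)) (at (?z t))"
          by (intro derivative_intros d[OF zU zk])
        from has_real_derivative_line[OF this]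
        show "(q has_vector_derivative (g (?z t) - g a) \<bullet> (y - x)) (at t)"
          by (simp add: q_def[abs_def] inner_diff_left has_real_derivative_iff_has_vector_derivative)
      next
        show "continuous_on {0..1} q" unfolding q_def
          by (intro continuous_intros continuous_on_compose2[OF f]) (use z inU in auto)
      qed simp
      moreover have "norm ((g (?z t) - g a) \<bullet> (y - x)) \<le> e * norm (y - x)" if "t \<in> {0..1}" for t
        using Cauchy_Schwarz_ineq2[of "g (?z t) - g a" "y - x"]
          mult_right_mono[OF gd[OF z[OF that]], of "norm (y - x)"] by simp
      ultimately have "norm (q 1 - q 0) \<le> e * norm (y - x) * measure lborel {0..1::real}"
        using e by (intro has_integral_bound_real[where S = "{}"]) auto
      then show ?thesis by (simp add: q_def inner_diff_right algebra_simps)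
    qed
    show "\<exists>d>0. \<forall>y. norm (y - a) < d \<longrightarrow> norm (f y - f a - g a \<bullet> (y - a)) \<le> e * norm (y - a)"
    proof (intro exI[of _ \<delta>] conjI allI impI \<delta>)
      fix y assume "norm (y - a) < \<delta>"
      then have y: "y \<in> ball a \<delta>" by (simp add: dist_norm norm_minus_commute)
      have ab: "a \<in> ball a \<delta>" using \<delta> by simp
      let ?w = "\<lambda>t. y + t *\<^sub>R axis k 1"
      have "isCont f y" using f U inU[OF y] continuous_on_eq_continuous_at by blast
      then have c: "isCont f (?w 0)" by simp
      have "((\<lambda>t. ?w t) \<longlongrightarrow> ?w 0) (at 0)" by (intro tendsto_intros)
      from isCont_tendsto_compose[OF c this] have fw: "((\<lambda>t. f (?w t)) \<longlongrightarrow> f y) (at 0)" by simp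
      have w: "((\<lambda>t. ?w t) \<longlongrightarrow> y) (at 0)" by (auto intro!: tendsto_eq_intros)
      have ev: "\<forall>\<^sub>F t in at 0. norm (f (?w t) - f a - g a \<bullet> (?w t - a)) \<le> e * norm (?w t - a)"
      proof -
        have "\<forall>\<^sub>F t in at 0. ?w t \<in> ball a \<delta>" using topological_tendstoD[OF w open_ball y] .
        moreover have "\<forall>\<^sub>F t in at 0. a $ k \<noteq> y $ k + t"
        proof (cases "a $ k = y $ k")
          case True then show ?thesis by (simp add: eventually_at_filter)
        next
          case False
          have "((\<lambda>t. y $ k + t) \<longlongrightarrow> y $ k) (at 0)" by (auto intro!: tendsto_eq_intros)
          from tendsto_imp_eventually_ne[OF this, of "a $ k"] False show ?thesis
            by (auto elim: eventually_mono)
        qed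
        ultimately show ?thesis
          by eventually_elim (rule transversal, auto simp: \<delta>)
      qed
      show "norm (f y - f a - g a \<bullet> (y - a)) \<le> e * norm (y - a)"
        by (rule tendsto_le[OF _ _ _ ev]) (auto intro!: tendsto_intros fw w)
    qed
  qed (rule bounded_linear_inner_right)
qed

text \<open>One of the local descriptions of a smooth domain. The function \<open>\<rho>\<close> below is a defining function: on
\<open>V\<close> it is negative in \<open>X\<close>, zero on the boundary and positive outside of the closure, and its
gradient \<open>d\<rho>\<close> has norm at least \<open>1\<close>.\<close>

locale boundary_chart =
  fixes X V :: "(real^'n::finite) set" and k :: 'n and \<gamma> :: "real^'n \<Rightarrow> real" and s :: real
  assumes openX: "open X" and openV: "open V" and graph: "graph_function k \<gamma>"
    and s: "s \<in> {-1, 1}" and X_chart: "X \<inter> V = {x \<in> V. s * x $ k < s * \<gamma> x}"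
begin

definition \<rho> :: "real^'n \<Rightarrow> real" where "\<rho> x = s * (x $ k - \<gamma> x)"

definition d\<rho> :: "real^'n \<Rightarrow> real^'n" where "d\<rho> x = s *\<^sub>R (axis k 1 - grad \<gamma> x)"

lemma ss [simp]: "s * s = 1" using s by auto

lemma Ck_\<gamma>: "Ck_on j UNIV \<gamma>" using graph by (simp add: graph_function_def smooth_on_def)

lemma C1_\<gamma>: "C1_on S \<gamma>" using Ck_\<gamma>[of "Suc 0"] C1_on_subset[of UNIV] unfolding Ck_on_1 by blast

lemma C1_grad_\<gamma>: "C1_field S (grad \<gamma>)"
proof -
  have "C1_on UNIV (\<lambda>x. grad \<gamma> x $ i)" for i
    using Ck_\<gamma>[of "Suc (Suc 0)"] unfolding Ck_on_Suc[of "Suc 0"] Ck_on_1 grad_def by simp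
  then show ?thesis unfolding C1_field_def using C1_on_subset by blast
qed

lemma \<gamma>_shift [simp]: "\<gamma> (x + t *\<^sub>R axis k 1) = \<gamma> x"
  using graph unfolding graph_function_def by (auto simp: axis_def)

lemma grad_\<gamma>_k [simp]: "grad \<gamma> x $ k = 0"
proof -
  have "((\<lambda>t. \<gamma> (x + t *\<^sub>R axis k 1)) has_real_derivative grad \<gamma> (x + 0 *\<^sub>R axis k 1) \<bullet> axis k 1) (at 0)"
    by (rule has_real_derivative_line[OF C1_on_has_derivative[OF C1_\<gamma>[of UNIV]]]) simp
  moreover have "((\<lambda>t. \<gamma> (x + t *\<^sub>R axis k 1)) has_real_derivative 0) (at 0)" by simp
  ultimately have "grad \<gamma> (x + 0 *\<^sub>R axis k 1) \<bullet> axis k 1 = 0" by (rule DERIV_unique)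
  then show ?thesis by (simp add: inner_axis)
qed

lemma C1_\<rho>: "C1_on S \<rho>"
  unfolding \<rho>_def[abs_def] by (intro C1_on_intros C1_\<gamma>)

lemma \<rho>_deriv: "(\<rho> has_derivative (\<lambda>h. d\<rho> x \<bullet> h)) (at x)"
proof -
  have "((\<lambda>x. x $ k) has_derivative (\<lambda>h. h $ k)) (at x)"
    by (intro bounded_linear.has_derivative[OF bounded_linear_vec_nth] has_derivative_ident)
  then have "((\<lambda>x. s * (x $ k - \<gamma> x)) has_derivative (\<lambda>h. s * (h $ k - grad \<gamma> x \<bullet> h))) (at x)"
    by (intro derivative_intros C1_on_has_derivative[OF C1_\<gamma>[of UNIV]]) auto
  then show ?thesis by (simp add: \<rho>_def[abs_def] d\<rho>_def inner_diff_left inner_axis')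
qed

lemma C1_d\<rho>: "C1_field S d\<rho>"
  using C1_grad_\<gamma>[of S] unfolding d\<rho>_def C1_field_def by (auto intro!: C1_on_intros)

lemma \<rho>_shift [simp]: "\<rho> (x + t *\<^sub>R axis k 1) = \<rho> x + s * t"
  by (simp add: \<rho>_def algebra_simps)

lemma \<rho>_cont: "continuous_on S \<rho>" by (rule C1_on_continuous_on[OF C1_\<rho>])

lemma in_X_iff: "x \<in> V \<Longrightarrow> x \<in> X \<longleftrightarrow> \<rho> x < 0"
  using X_chart by (auto simp: \<rho>_def right_diff_distrib)

lemma shift_in_X:
  assumes "x \<in> V" "\<rho> x \<le> 0"
  shows "\<forall>\<^sub>F t in at_right 0. x + (- s * t) *\<^sub>R axis k 1 \<in> X"
proof -
  have "((\<lambda>t. x + (- s * t) *\<^sub>R axis k 1) \<longlongrightarrow> x) (at_right 0)" by (auto intro!: tendsto_eq_intros)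
  then have "\<forall>\<^sub>F t in at_right 0. x + (- s * t) *\<^sub>R axis k 1 \<in> V"
    using topological_tendstoD openV assms(1) by blast
  moreover have "\<forall>\<^sub>F t::real in at_right 0. 0 < t" by (simp add: eventually_at_right_less)
  ultimately show ?thesis
    by eventually_elim (use assms(2) in \<open>auto simp: in_X_iff \<rho>_shift mult.assoc[symmetric] simp del: scaleR_minus_left\<close>)
qed

lemma in_closure_iff: "x \<in> V \<Longrightarrow> x \<in> closure X \<longleftrightarrow> \<rho> x \<le> 0"
proof
  assume x: "x \<in> V" "x \<in> closure X"
  show "\<rho> x \<le> 0"
  proof (rule ccontr)
    assume "\<not> \<rho> x \<le> 0"
    define O1 where "O1 = V \<inter> {x. \<rho> x > 0}"
    have "open O1" unfolding O1_def using openV \<rho>_cont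
      by (auto intro!: open_Int open_Collect_less continuous_intros)
    moreover have "x \<in> O1" using x \<open>\<not> \<rho> x \<le> 0\<close> by (simp add: O1_def)
    ultimately have "O1 \<inter> X \<noteq> {}" using x(2) open_Int_closure_eq_empty by blast
    then show False using in_X_iff by (force simp: O1_def)
  qed
next
  assume x: "x \<in> V" "\<rho> x \<le> 0"
  have "((\<lambda>t. x + (- s * t) *\<^sub>R axis k 1) \<longlongrightarrow> x) (at_right 0)" by (auto intro!: tendsto_eq_intros)
  moreover have "\<forall>\<^sub>F t in at_right 0. x + (- s * t) *\<^sub>R axis k 1 \<in> closure X"
    using shift_in_X[OF x] closure_subset by (auto elim!: eventually_mono)
  ultimately show "x \<in> closure X"
    by (intro Lim_in_closed_set[of "closure X"]) auto
qed

lemma in_frontier_iff: "x \<in> V \<Longrightarrow> x \<in> frontier X \<longleftrightarrow> \<rho> x = 0"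
  using in_X_iff in_closure_iff openX by (auto simp: frontier_def interior_open)

lemma frontier_chart: "frontier X \<inter> V = {x \<in> V. x $ k = \<gamma> x}"
  using in_frontier_iff s by (auto simp: \<rho>_def)

text \<open>A volume-preserving change of coordinates that flattens the graph to the hyperplane where the
\<open>k\<close>-th coordinate vanishes.\<close>

definition shear :: "real^'n \<Rightarrow> real^'n" where "shear x = x + \<gamma> x *\<^sub>R axis k 1"
definition unshear :: "real^'n \<Rightarrow> real^'n" where "unshear x = x - \<gamma> x *\<^sub>R axis k 1"

lemma unshear_eq: "unshear x = x + (- \<gamma> x) *\<^sub>R axis k 1" by (simp add: unshear_def)

lemma shear_unshear [simp]: "shear (unshear x) = x" "unshear (shear x) = x"
  by (simp_all add: shear_def unshear_eq del: scaleR_minus_left) (simp_all add: scaleR_minus_left)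

lemma C1_shear: "C1_field S shear"
  unfolding C1_field_def shear_def by (auto intro!: C1_on_intros C1_\<gamma>)

lemma C1_unshear: "C1_field S unshear"
  unfolding C1_field_def unshear_def by (auto intro!: C1_on_intros C1_\<gamma>)

lemma shear_k: "shear x $ k - \<gamma> (shear x) = x $ k"
  by (simp add: shear_def)

lemma \<rho>_shear: "\<rho> (shear x) = s * x $ k" by (simp add: \<rho>_def shear_k)

lemma shear_deriv: "(shear has_derivative (\<lambda>h. h + (grad \<gamma> x \<bullet> h) *\<^sub>R axis k 1)) (at x)"
  unfolding shear_def[abs_def]
  by (intro derivative_intros has_derivative_scaleR_left C1_on_has_derivative[OF C1_\<gamma>[of UNIV]]) auto

lemma C1_across_graph:
  assumes U: "open U" and f: "continuous_on U f" and g: "continuous_on U g"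
    and d: "\<And>x. x \<in> U \<Longrightarrow> \<rho> x \<noteq> 0 \<Longrightarrow> (f has_derivative (\<lambda>h. g x \<bullet> h)) (at x)"
  shows "C1_on U f"
proof -
  define U' where "U' = shear -` U"
  have cs: "continuous_on S shear" for S by (rule C1_field_continuous_on[OF C1_shear])
  have U': "open U'" unfolding U'_def by (rule open_vimage[OF U cs])
  have "C1_on U' (\<lambda>x. f (shear x))"
  proof (rule C1_across_hyperplane[OF U', where k = k
        and g = "\<lambda>x. g (shear x) + (g (shear x) $ k) *\<^sub>R grad \<gamma> x"])
    show "continuous_on U' (\<lambda>x. f (shear x))"
      by (rule continuous_on_compose2[OF f cs]) (auto simp: U'_def)
    have cg: "continuous_on U' (\<lambda>x. g (shear x))"
      by (rule continuous_on_compose2[OF g cs]) (auto simp: U'_def)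
    show "continuous_on U' (\<lambda>x. g (shear x) + (g (shear x) $ k) *\<^sub>R grad \<gamma> x)"
      by (intro continuous_intros cg C1_on_grad[OF C1_\<gamma>])
    fix x assume x: "x \<in> U'" "x $ k \<noteq> 0"
    have "\<rho> (shear x) \<noteq> 0" using x(2) s by (auto simp: \<rho>_shear)
    from has_derivative_compose[OF shear_deriv d[OF _ this]] x(1)
    show "((\<lambda>x. f (shear x)) has_derivative
        (\<lambda>h. (g (shear x) + (g (shear x) $ k) *\<^sub>R grad \<gamma> x) \<bullet> h)) (at x)"
      by (simp add: U'_def inner_add_left inner_add_right inner_axis mult.commute)
  qed
  from C1_on_compose[OF this C1_unshear[of U]] show ?thesis by (simp add: U'_def image_subset_iff)
qed

text \<open>The \<open>k\<close>-axis line through \<open>x\<close> is scaled by the factor \<open>1 - c\<close> about the point where it meets the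
graph. Thus \<open>refl 1\<close> projects to the graph, and \<open>refl c\<close> with \<open>c > 1\<close> takes exterior points to
interior ones near the graph.\<close>

definition refl :: "real \<Rightarrow> real^'n \<Rightarrow> real^'n" where
  "refl c x = x + (- (s * c * \<rho> x)) *\<^sub>R axis k 1"

lemma \<rho>_refl: "\<rho> (refl c x) = (1 - c) * \<rho> x"
proof -
  have "\<rho> (refl c x) = \<rho> x - (s * s) * (c * \<rho> x)" unfolding refl_def \<rho>_shift by (simp add: algebra_simps)
  then show ?thesis by (simp add: algebra_simps)
qed

lemma refl_cont: "continuous_on S (refl c)"
  unfolding refl_def[abs_def] by (intro continuous_intros \<rho>_cont)

lemma refl_deriv: "(refl c has_derivative (\<lambda>h. h + (- (s * c * (d\<rho> x \<bullet> h))) *\<^sub>R axis k 1)) (at x)"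
  unfolding refl_def[abs_def]
  by (intro derivative_intros has_derivative_scaleR_left \<rho>_deriv) 

text \<open>Outside of the domain put \<open>F = 3 f \<circ> refl 2 - 2 f \<circ> refl 3\<close>. The weights add up to \<open>1\<close>, so the values
match on the graph; weighted with the factors \<open>1 - c = -1, -2\<close> by which the reflections scale the
transversal direction, they again add up to \<open>1\<close>, so the first derivatives match as well.\<close>

lemma C1_extension_local:
  assumes p: "p \<in> V" "\<rho> p = 0" and fc: "continuous_on (closure X) f"
    and gc: "continuous_on (closure X) g"
    and d: "\<And>x. x \<in> X \<Longrightarrow> (f has_derivative (\<lambda>h. g x \<bullet> h)) (at x)"
  shows "\<exists>U F. open U \<and> p \<in> U \<and> C1_on U F \<and> (\<forall>x\<in>U \<inter> closure X. F x = f x)"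
proof -
  define U where "U = V \<inter> refl 2 -` V \<inter> refl 3 -` V"
  have U: "open U" unfolding U_def by (intro open_Int openV open_vimage refl_cont)
  have pU: "p \<in> U" using p by (simp add: U_def refl_def)
  have UV: "x \<in> V" "refl 2 x \<in> V" "refl 3 x \<in> V" if "x \<in> U" for x using that by (auto simp: U_def)
  define F where "F x = (if \<rho> x \<le> 0 then f x else 3 * f (refl 2 x) - 2 * f (refl 3 x))" for x
  define G1 where "G1 c x = g (refl c x) + (- (s * c * (g (refl c x) $ k))) *\<^sub>R d\<rho> x" for c x
  define G where "G x = (if \<rho> x \<le> 0 then g x else 3 *\<^sub>R G1 2 x - 2 *\<^sub>R G1 3 x)" for x
  have cl: "refl 2 x \<in> closure X" "refl 3 x \<in> closure X" if "x \<in> U" "0 \<le> \<rho> x" for x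
    using in_closure_iff[of "refl 2 x"] in_closure_iff[of "refl 3 x"] UV[OF that(1)] that(2)
    by (simp_all add: \<rho>_refl)
  have inX: "refl 2 x \<in> X" "refl 3 x \<in> X" if "x \<in> U" "0 < \<rho> x" for x
    using in_X_iff[of "refl 2 x"] in_X_iff[of "refl 3 x"] UV[OF that(1)] that(2)
    by (simp_all add: \<rho>_refl)
  have cl0: "x \<in> closure X" if "x \<in> U" "\<rho> x \<le> 0" for x
    using in_closure_iff[of x] UV[OF that(1)] that(2) by simp
  have comp: "continuous_on {x \<in> U. 0 \<le> \<rho> x} (\<lambda>x. h (refl 2 x))"
    "continuous_on {x \<in> U. 0 \<le> \<rho> x} (\<lambda>x. h (refl 3 x))"
    if "continuous_on (closure X) h" for h :: "real^'n \<Rightarrow> 'b::real_normed_vector"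
    by (rule continuous_on_compose2[OF that refl_cont]; use cl in auto)+
  have cm: "continuous_on S d\<rho>" for S by (rule C1_field_continuous_on[OF C1_d\<rho>])
  have "C1_on U F"
  proof (rule C1_across_graph[OF U])
    show "continuous_on U F" unfolding F_def
    proof (rule continuous_on_cases_le)
      show "continuous_on {x \<in> U. \<rho> x \<le> 0} f"
        by (rule continuous_on_subset[OF fc]) (use cl0 in auto)
      show "continuous_on {x \<in> U. 0 \<le> \<rho> x} (\<lambda>x. 3 * f (refl 2 x) - 2 * f (refl 3 x))"
        by (intro continuous_intros comp fc)
    qed (auto simp: refl_def \<rho>_cont)
    show "continuous_on U G" unfolding G_def
    proof (rule continuous_on_cases_le)
      show "continuous_on {x \<in> U. \<rho> x \<le> 0} g"
        by (rule continuous_on_subset[OF gc]) (use cl0 in auto)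
      show "continuous_on {x \<in> U. 0 \<le> \<rho> x} (\<lambda>x. 3 *\<^sub>R G1 2 x - 2 *\<^sub>R G1 3 x)"
        unfolding G1_def by (intro continuous_intros comp gc cm)
      show "g x = 3 *\<^sub>R G1 2 x - 2 *\<^sub>R G1 3 x" if "\<rho> x = 0" for x
        using that by (simp add: G1_def refl_def vec_eq_iff algebra_simps)
    qed (auto simp: \<rho>_cont)
    fix x assume x: "x \<in> U" "\<rho> x \<noteq> 0"
    consider "\<rho> x < 0" | "\<rho> x > 0" using x(2) by linarith
    then show "(F has_derivative (\<lambda>h. G x \<bullet> h)) (at x)"
    proof cases
      case 1
      have o: "open (U \<inter> {x. \<rho> x < 0})" using U \<rho>_cont
        by (auto intro!: open_Int open_Collect_less continuous_intros)
      have "x \<in> X" using in_X_iff UV(1) x(1) 1 by blast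
      from d[OF this] have "(F has_derivative (\<lambda>h. g x \<bullet> h)) (at x)"
        by (rule has_derivative_transform_within_open[OF _ o]) (use x 1 in \<open>auto simp: F_def\<close>)
      then show ?thesis using 1 by (simp add: G_def)
    next
      case 2
      have o: "open (U \<inter> {x. 0 < \<rho> x})" using U \<rho>_cont
        by (auto intro!: open_Int open_Collect_less continuous_intros)
      have D: "((\<lambda>x. f (refl c x)) has_derivative (\<lambda>h. G1 c x \<bullet> h)) (at x)" if "refl c x \<in> X" for c
        using has_derivative_compose[OF refl_deriv[of c x] d[OF that]]
        by (simp add: G1_def inner_add_left inner_diff_left inner_diff_right inner_add_right inner_axis algebra_simps)
      have "((\<lambda>x. 3 * f (refl 2 x) - 2 * f (refl 3 x)) has_derivative
          (\<lambda>h. 3 * (G1 2 x \<bullet> h) - 2 * (G1 3 x \<bullet> h))) (at x)"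
        by (intro derivative_intros D inX[OF x(1) 2])
      then have "(F has_derivative (\<lambda>h. 3 * (G1 2 x \<bullet> h) - 2 * (G1 3 x \<bullet> h))) (at x)"
        by (rule has_derivative_transform_within_open[OF _ o]) (use x 2 in \<open>auto simp: F_def\<close>)
      then show ?thesis using 2 by (simp add: G_def inner_diff_left)
    qed
  qed
  moreover have "\<forall>x\<in>U \<inter> closure X. F x = f x"
    using in_closure_iff UV(1) by (auto simp: F_def)
  ultimately show ?thesis using U pU by blast
qed

end

section \<open>The unit normal in a chart\<close>

context boundary_chart
begin

lemma d\<rho>_inner: "d\<rho> x \<bullet> d\<rho> x = 1 + (norm (grad \<gamma> x))\<^sup>2"
proof -
  have "d\<rho> x \<bullet> d\<rho> x = (s * s) * ((axis k 1 - grad \<gamma> x) \<bullet> (axis k 1 - grad \<gamma> x))"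
    unfolding d\<rho>_def inner_scaleR_left inner_scaleR_right by (rule mult.assoc[symmetric])
  then show ?thesis
    by (simp add: inner_diff_left inner_diff_right inner_axis inner_axis' power2_norm_eq_inner)
qed

lemma norm_d\<rho>: "norm (d\<rho> x) = sqrt (1 + (norm (grad \<gamma> x))\<^sup>2)"
  by (simp add: norm_eq_sqrt_inner d\<rho>_inner)

lemma norm_d\<rho>_pos: "norm (d\<rho> x) > 0"
  unfolding norm_d\<rho> by (simp add: add_pos_nonneg)

definition \<nu> :: "real^'n \<Rightarrow> real^'n" where "\<nu> x = inverse (norm (d\<rho> x)) *\<^sub>R d\<rho> x"

lemma d\<rho>_\<nu>: "d\<rho> x = norm (d\<rho> x) *\<^sub>R \<nu> x" using norm_d\<rho>_pos[of x] by (simp add: \<nu>_def)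

lemma \<nu>_\<nu>: "\<nu> x \<bullet> \<nu> x = 1"
  using norm_d\<rho>_pos[of x] by (simp add: \<nu>_def dot_square_norm power2_eq_square)

lemma C1_norm_d\<rho>: "C1_on S (\<lambda>x. norm (d\<rho> x))"
  unfolding norm_eq_sqrt_inner
  by (rule C1_on_sqrt[OF C1_field_inner[OF C1_d\<rho> C1_d\<rho>]]) (simp add: d\<rho>_inner add_pos_nonneg)

lemma C1_\<nu>: "C1_field S \<nu>"
  unfolding \<nu>_def[abs_def]
  by (intro C1_field_scaleR C1_on_inverse C1_norm_d\<rho> C1_d\<rho>) (use norm_d\<rho>_pos in force)

text \<open>Differentiating \<open>\<rho> = 0\<close> along a curve in the boundary gives one inclusion. For the other, a line
orthogonal to the normal is projected to the graph along the \<open>k\<close>-axis, which does not change its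
velocity at \<open>x\<close>.\<close>

lemma tangent_space_eq:
  assumes x: "x \<in> V" "\<rho> x = 0"
  shows "tangent_space (frontier X) x = {Y. \<nu> x \<bullet> Y = 0}"
proof -
  have "\<nu> x \<bullet> Y = 0 \<longleftrightarrow> d\<rho> x \<bullet> Y = 0" for Y using norm_d\<rho>_pos[of x] by (simp add: \<nu>_def)
  moreover have "d\<rho> x \<bullet> Y = 0" if Y: "Y \<in> tangent_space (frontier X) x" for Y
  proof -
    obtain c e where c: "e > 0" "\<And>t. \<bar>t\<bar> < e \<Longrightarrow> c t \<in> frontier X" "c 0 = x"
      "(c has_vector_derivative Y) (at (0::real))"
      using Y unfolding tangent_space_def by blast
    have "isCont c 0" using c(4) has_vector_derivative_continuous by blast
    then have "\<forall>\<^sub>F t in at 0. c t \<in> V"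
      using topological_tendstoD[of c x "at 0" V] openV x(1) c(3) by (simp add: isCont_def)
    then obtain d where d: "d > 0" "\<And>t. t \<noteq> 0 \<Longrightarrow> dist t 0 < d \<Longrightarrow> c t \<in> V"
      unfolding eventually_at by auto
    have z: "\<rho> (c t) = 0" if "\<bar>t\<bar> < min e d" for t
      using in_frontier_iff[of "c t"] c(2)[of t] d(2)[of t] x c(3) that by (cases "t = 0") auto
    have "((\<lambda>t. \<rho> (c t)) has_derivative (\<lambda>t. d\<rho> x \<bullet> (t *\<^sub>R Y))) (at 0)"
      using has_derivative_compose[OF c(4)[unfolded has_vector_derivative_def]] \<rho>_deriv c(3) by blast
    then have "((\<lambda>t. 0) has_derivative (\<lambda>t. d\<rho> x \<bullet> (t *\<^sub>R Y))) (at (0::real))"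
      by (rule has_derivative_transform_within_open[of _ _ _ _ "ball 0 (min e d)"]) (use z c d in auto)
    then have "(\<lambda>t. d\<rho> x \<bullet> (t *\<^sub>R Y)) = (\<lambda>t. 0)"
      by (rule has_derivative_unique) simp
    then show ?thesis by (auto dest: fun_cong[of _ _ 1])
  qed
  moreover have "Y \<in> tangent_space (frontier X) x" if Y: "d\<rho> x \<bullet> Y = 0" for Y
  proof -
    \<comment> \<open>The line through \<open>x\<close> in direction \<open>Y\<close>, pushed back to the graph along the \<open>k\<close>-axis.\<close>
    define c where "c t = (x + t *\<^sub>R Y) + (- s * \<rho> (x + t *\<^sub>R Y)) *\<^sub>R axis k 1" for t
    have \<rho>c: "\<rho> (c t) = 0" for t
    proof -
      have "\<rho> (c t) = \<rho> (x + t *\<^sub>R Y) + s * (- s * \<rho> (x + t *\<^sub>R Y))" 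
        unfolding c_def by (rule \<rho>_shift)
      also have "\<dots> = \<rho> (x + t *\<^sub>R Y) - (s * s) * \<rho> (x + t *\<^sub>R Y)" by (simp only: algebra_simps)
      finally show ?thesis by simp
    qed
    have c0: "c 0 = x" using x by (simp add: c_def)
    have l: "((\<lambda>t. x + t *\<^sub>R Y) has_derivative (\<lambda>t. t *\<^sub>R Y)) (at 0)"
      by (auto intro!: derivative_eq_intros)
    have "((\<lambda>t. \<rho> (x + t *\<^sub>R Y)) has_derivative (\<lambda>t. d\<rho> (x + 0 *\<^sub>R Y) \<bullet> (t *\<^sub>R Y))) (at 0)"
      by (rule has_derivative_compose[OF l \<rho>_deriv])
    then have "((\<lambda>t. \<rho> (x + t *\<^sub>R Y)) has_derivative (\<lambda>t. 0)) (at 0)" using Y by simp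
    then have "(c has_derivative (\<lambda>t. t *\<^sub>R Y + (- s * 0) *\<^sub>R axis k 1)) (at 0)"
      unfolding c_def[abs_def] by (intro derivative_intros l has_derivative_scaleR_left)
    then have dc: "(c has_vector_derivative Y) (at 0)" by (simp add: has_vector_derivative_def)
    have "isCont c 0" using dc has_vector_derivative_continuous by blast
    then have "\<forall>\<^sub>F t in at 0. c t \<in> V"
      using topological_tendstoD[of c x "at 0" V] openV x(1) c0 by (simp add: isCont_def)
    then obtain d where d: "d > 0" "\<And>t. t \<noteq> 0 \<Longrightarrow> dist t 0 < d \<Longrightarrow> c t \<in> V"
      unfolding eventually_at by auto
    have "c t \<in> frontier X" if "\<bar>t\<bar> < d" for t
      using in_frontier_iff[of "c t"] \<rho>c[of t] d(2)[of t] that x c0 by (cases "t = 0") auto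
    then show ?thesis unfolding tangent_space_def using d(1) c0 dc by blast
  qed
  ultimately show ?thesis by auto
qed

lemma \<rho>_along_\<nu>:
  assumes "\<rho> x = 0"
  shows "\<exists>d>0. \<forall>t. 0 < t \<and> t < d \<longrightarrow> \<rho> (x + t *\<^sub>R \<nu> x) > 0 \<and> \<rho> (x - t *\<^sub>R \<nu> x) < 0"
proof -
  have "d\<rho> x \<bullet> \<nu> x = norm (d\<rho> x) * (\<nu> x \<bullet> \<nu> x)" by (subst d\<rho>_\<nu>) simp
  then have mn: "d\<rho> x \<bullet> \<nu> x > 0" using \<nu>_\<nu>[of x] norm_d\<rho>_pos[of x] by simp
  have "((\<lambda>t. \<rho> (x + t *\<^sub>R \<nu> x)) has_real_derivative d\<rho> (x + 0 *\<^sub>R \<nu> x) \<bullet> \<nu> x) (at 0)"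
    by (rule has_real_derivative_line[OF \<rho>_deriv])
  then have D: "((\<lambda>t. \<rho> (x + t *\<^sub>R \<nu> x)) has_real_derivative d\<rho> x \<bullet> \<nu> x) (at 0)" by simp
  obtain d1 where d1: "d1 > 0" "\<forall>h>0. h < d1 \<longrightarrow> \<rho> (x + 0 *\<^sub>R \<nu> x) < \<rho> (x + (0 + h) *\<^sub>R \<nu> x)"
    using DERIV_pos_inc_right[OF D mn] by blast
  obtain d2 where d2: "d2 > 0" "\<forall>h>0. h < d2 \<longrightarrow> \<rho> (x + (0 - h) *\<^sub>R \<nu> x) < \<rho> (x + 0 *\<^sub>R \<nu> x)"
    using DERIV_pos_inc_left[OF D mn] by blast
  show ?thesis
    by (rule exI[of _ "min d1 d2"]) (use d1 d2 assms in auto)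
qed

lemma along_\<nu>_in_V:
  assumes "x \<in> V" "open U" "x \<in> U"
  shows "\<exists>d>0. \<forall>t. \<bar>t\<bar> < d \<longrightarrow> x + t *\<^sub>R \<nu> x \<in> V \<inter> U"
proof -
  have "open (V \<inter> U)" using openV assms by auto
  then obtain e where e: "e > 0" "ball x e \<subseteq> V \<inter> U" using assms open_contains_ball by blast
  have "norm (\<nu> x) = 1" using \<nu>_\<nu>[of x] by (simp add: norm_eq_1)
  then have "x + t *\<^sub>R \<nu> x \<in> ball x e" if "\<bar>t\<bar> < e" for t using that by (simp add: dist_norm)
  then show ?thesis using e by blast
qed

lemma inward_ray:
  assumes x: "x \<in> V" "\<rho> x = 0" and U: "open U" "x \<in> U"
  shows "\<exists>d>0. \<forall>t. 0 < t \<and> t < d \<longrightarrow> x - t *\<^sub>R \<nu> x \<in> X \<inter> U"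
proof -
  obtain d1 where d1: "d1 > 0" "\<forall>t. 0 < t \<and> t < d1 \<longrightarrow> \<rho> (x - t *\<^sub>R \<nu> x) < 0"
    using \<rho>_along_\<nu>[OF x(2)] by blast
  obtain d2 where d2: "d2 > 0" "\<forall>t. \<bar>t\<bar> < d2 \<longrightarrow> x + t *\<^sub>R \<nu> x \<in> V \<inter> U"
    using along_\<nu>_in_V[OF x(1) U] by blast
  have "x - t *\<^sub>R \<nu> x \<in> X \<inter> U" if "0 < t" "t < min d1 d2" for t
    using d1(2) d2(2)[rule_format, of "- t"] that in_X_iff[of "x - t *\<^sub>R \<nu> x"] by auto
  then show ?thesis using d1 d2 by (intro exI[of _ "min d1 d2"]) auto
qed

text \<open>Orthogonality to the tangent space leaves two unit vectors, and the ray in direction \<open>- \<nu> x\<close> enters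
the domain.\<close>

lemma outward_normal_eq:
  assumes x: "x \<in> V" "\<rho> x = 0"
  shows "outward_normal X x = \<nu> x"
  unfolding outward_normal_def
proof (rule the_equality)
  obtain d1 where d1: "d1 > 0" "\<forall>t. 0 < t \<and> t < d1 \<longrightarrow> \<rho> (x + t *\<^sub>R \<nu> x) > 0"
    using \<rho>_along_\<nu>[OF x(2)] by blast
  obtain d2 where d2: "d2 > 0" "\<forall>t. \<bar>t\<bar> < d2 \<longrightarrow> x + t *\<^sub>R \<nu> x \<in> V"
    using along_\<nu>_in_V[OF x(1) open_UNIV] by auto
  have "x + t *\<^sub>R \<nu> x \<notin> closure X" if "0 < t" "t < min d1 d2" for t
    using d1(2) d2(2) that in_closure_iff[of "x + t *\<^sub>R \<nu> x"] by force
  then have "\<forall>\<^sub>F t in at_right 0. x + t *\<^sub>R \<nu> x \<notin> closure X"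
    unfolding eventually_at_right_field using d1 d2 by (intro exI[of _ "min d1 d2"]) auto
  then show "norm (\<nu> x) = 1 \<and> (\<forall>Y\<in>tangent_space (frontier X) x. \<nu> x \<bullet> Y = 0) \<and>
      (\<forall>\<^sub>F t in at_right 0. x + t *\<^sub>R \<nu> x \<notin> closure X)"
    using \<nu>_\<nu>[of x] by (simp add: tangent_space_eq[OF x] norm_eq_1)
next
  fix a assume a: "norm a = 1 \<and> (\<forall>Y\<in>tangent_space (frontier X) x. a \<bullet> Y = 0) \<and>
      (\<forall>\<^sub>F t in at_right 0. x + t *\<^sub>R a \<notin> closure X)"
  define Y where "Y = a - (\<nu> x \<bullet> a) *\<^sub>R \<nu> x"
  have "\<nu> x \<bullet> Y = 0" by (simp add: Y_def inner_diff_right \<nu>_\<nu>)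
  then have "a \<bullet> Y = 0" using a by (simp add: tangent_space_eq[OF x])
  then have "Y \<bullet> Y = 0" using \<open>\<nu> x \<bullet> Y = 0\<close> by (simp add: Y_def inner_diff_left)
  then have an: "a = (\<nu> x \<bullet> a) *\<^sub>R \<nu> x" by (simp add: Y_def)
  have "norm (\<nu> x) = 1" using \<nu>_\<nu>[of x] by (simp add: norm_eq_1)
  then have "\<bar>\<nu> x \<bullet> a\<bar> = 1" using a arg_cong[OF an, of norm] by simp
  then consider "\<nu> x \<bullet> a = 1" | "\<nu> x \<bullet> a = -1" by linarith
  then show "a = \<nu> x"
  proof cases
    case 1 then show ?thesis using an by simp
  next
    case 2
    then have eq: "a = - \<nu> x" using an by simp
    obtain d where d: "d > 0" "\<forall>t. 0 < t \<and> t < d \<longrightarrow> x - t *\<^sub>R \<nu> x \<in> X \<inter> UNIV"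
      using inward_ray[OF x open_UNIV] by auto
    then have "\<forall>\<^sub>F t in at_right 0. x + t *\<^sub>R a \<in> closure X"
      unfolding eventually_at_right_field eq using closure_subset[of X]
      by (intro exI[of _ d]) auto
    then have "\<forall>\<^sub>F t in at_right (0::real). False" 
      using a[THEN conjunct2, THEN conjunct2] by eventually_elim blast
    then show ?thesis by simp
  qed
qed

end

section \<open>Extension across the boundary\<close>

lemma smooth_domain_chart:
  assumes "smooth_domain X" "p \<in> frontier X"
  obtains V k \<gamma> s where "boundary_chart X V k \<gamma> s" "p \<in> V"
proof -
  obtain V k \<gamma> s where "s \<in> {-1, 1::real}" "open V" "p \<in> V" "graph_function k \<gamma>"
    "X \<inter> V = {x \<in> V. s * x $ k < s * \<gamma> x}"
    using assms unfolding smooth_domain_def by blast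
  then have "boundary_chart X V k \<gamma> s"
    using assms(1) by (intro boundary_chart.intro) (simp_all add: smooth_domain_def)
  then show thesis using that \<open>p \<in> V\<close> by blast
qed

lemma C_closure_1E:
  fixes X :: "(real^'n::finite) set"
  assumes "f \<in> C_closure 1 X"
  obtains g where "continuous_on (closure X) f" "continuous_on (closure X) g"
    "\<And>x. x \<in> X \<Longrightarrow> (f has_derivative (\<lambda>h. g x \<bullet> h)) (at x)"
proof -
  have d: "f differentiable (at x)" if "x \<in> X" for x
    using assms that by (simp add: C_closure_def)
  have "\<forall>i. \<exists>g. continuous_on (closure X) g \<and> (\<forall>x\<in>X. g x = frechet_derivative f (at x) (axis i 1))"
    using assms by (simp add: C_closure_def extends_to_closure_def)
  then obtain g where g: "\<And>i. continuous_on (closure X) (g i)"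
    "\<And>i x. x \<in> X \<Longrightarrow> g i x = frechet_derivative f (at x) (axis i 1)" by metis
  show thesis
  proof (rule that[of "\<lambda>x. \<chi> i. g i x"])
    show "(f has_derivative (\<lambda>h. (\<chi> i. g i x) \<bullet> h)) (at x)" if "x \<in> X" for x
    proof -
      have "(\<chi> i. g i x) = grad f x" using g(2)[OF that] by (simp add: grad_def)
      then show ?thesis using has_derivative_grad[OF d[OF that]] by simp
    qed
  qed (use assms g(1) in \<open>auto simp: C_closure_def intro: continuous_on_vec_lambda\<close>)
qed

text \<open>Interior points need no extension, boundary points are covered by charts, and the local extensions
are glued.\<close>

lemma C1_extension:
  fixes X :: "(real^'n::finite) set"
  assumes X: "smooth_domain X" "bounded X" and f: "f \<in> C_closure 1 X"
  obtains F where "C1c F" "\<And>x. x \<in> closure X \<Longrightarrow> F x = f x"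
proof -
  obtain g where fc: "continuous_on (closure X) f" and gc: "continuous_on (closure X) g"
    and d: "\<And>x. x \<in> X \<Longrightarrow> (f has_derivative (\<lambda>h. g x \<bullet> h)) (at x)"
    using C_closure_1E[OF f] by blast
  have oX: "open X" using X(1) by (simp add: smooth_domain_def)
  have "\<exists>F. C1c F \<and> (\<forall>x\<in>closure X. F x = f x)"
  proof (rule C1c_of_local)
    show "compact (closure X)" using X(2) by (simp add: compact_closure)
    fix p assume p: "p \<in> closure X"
    show "\<exists>U g. open U \<and> p \<in> U \<and> C1_on U g \<and> (\<forall>x\<in>U \<inter> closure X. g x = f x)"
    proof (cases "p \<in> X")
      case True
      have "C1_on X f" using d continuous_on_subset[OF gc closure_subset] by (rule C1_onI)
      then show ?thesis using True oX by blast
    next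
      case False
      then have "p \<in> frontier X" using p oX by (simp add: frontier_def interior_open)
      then obtain V k \<gamma> s where c: "boundary_chart X V k \<gamma> s" "p \<in> V"
        using smooth_domain_chart[OF X(1)] by blast
      interpret boundary_chart X V k \<gamma> s by (rule c(1))
      have "\<rho> p = 0" using in_frontier_iff[OF c(2)] \<open>p \<in> frontier X\<close> by simp
      from C1_extension_local[OF c(2) this fc gc d] show ?thesis by blast
    qed
  qed
  then show thesis using that by blast
qed

section \<open>Differential calculus along the boundary\<close>

text \<open>The trace of a linear map, defined on bare functions because derivatives are given in this form.\<close>

definition lin_trace :: "('a::euclidean_space \<Rightarrow> 'a) \<Rightarrow> real" where
  "lin_trace D = (\<Sum>e\<in>Basis. D e \<bullet> e)"

text \<open>The trace of the compression of \<open>D\<close> to the hyperplane orthogonal to \<open>\<nu>\<close>.\<close>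

lemma trace_tangential:
  fixes D :: "'a::euclidean_space \<Rightarrow> 'a"
  assumes D: "linear D" and \<nu>: "\<nu> \<bullet> \<nu> = 1"
  shows "(\<Sum>e\<in>Basis. D (e - (e \<bullet> \<nu>) *\<^sub>R \<nu>) \<bullet> (e - (e \<bullet> \<nu>) *\<^sub>R \<nu>)) = lin_trace D - D \<nu> \<bullet> \<nu>"
proof -
  interpret linear D by (rule D)
  have rep: "(\<Sum>e\<in>Basis. (e \<bullet> \<nu>) *\<^sub>R e) = \<nu>"
    using euclidean_representation[of \<nu>] by (simp add: inner_commute)
  have s1: "(\<Sum>e\<in>Basis. (e \<bullet> \<nu>) * (D e \<bullet> \<nu>)) = D \<nu> \<bullet> \<nu>"
  proof -
    have "D (\<Sum>e\<in>Basis. (e \<bullet> \<nu>) *\<^sub>R e) \<bullet> \<nu> = (\<Sum>e\<in>Basis. (e \<bullet> \<nu>) * (D e \<bullet> \<nu>))"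
      by (simp add: sum scaleR inner_sum_left)
    then show ?thesis by (simp add: rep)
  qed
  have s2: "(\<Sum>e\<in>Basis. (e \<bullet> \<nu>) * (z \<bullet> e)) = z \<bullet> \<nu>" for z
  proof -
    have "z \<bullet> (\<Sum>e\<in>Basis. (e \<bullet> \<nu>) *\<^sub>R e) = (\<Sum>e\<in>Basis. (e \<bullet> \<nu>) * (z \<bullet> e))"
      by (simp add: inner_sum_right)
    then show ?thesis by (simp add: rep)
  qed
  have s3: "(\<Sum>e\<in>Basis. (e \<bullet> \<nu>) * (e \<bullet> \<nu>)) = 1" using s2[of \<nu>] \<nu> by (simp add: inner_commute)
  have "D (e - (e \<bullet> \<nu>) *\<^sub>R \<nu>) \<bullet> (e - (e \<bullet> \<nu>) *\<^sub>R \<nu>)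
      = D e \<bullet> e - (e \<bullet> \<nu>) * (D e \<bullet> \<nu>) - (e \<bullet> \<nu>) * (D \<nu> \<bullet> e) + (e \<bullet> \<nu>) * (e \<bullet> \<nu>) * (D \<nu> \<bullet> \<nu>)" for e
    by (simp add: diff scaleR inner_diff_left inner_diff_right algebra_simps)
  then have "(\<Sum>e\<in>Basis. D (e - (e \<bullet> \<nu>) *\<^sub>R \<nu>) \<bullet> (e - (e \<bullet> \<nu>) *\<^sub>R \<nu>))
      = lin_trace D - (\<Sum>e\<in>Basis. (e \<bullet> \<nu>) * (D e \<bullet> \<nu>)) - (\<Sum>e\<in>Basis. (e \<bullet> \<nu>) * (D \<nu> \<bullet> e))
        + (\<Sum>e\<in>Basis. (e \<bullet> \<nu>) * (e \<bullet> \<nu>)) * (D \<nu> \<bullet> \<nu>)"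
    by (simp add: lin_trace_def sum_subtractf sum.distrib sum_distrib_right)
  also have "\<dots> = lin_trace D - D \<nu> \<bullet> \<nu>" unfolding s1 s2 s3 by simp
  finally show ?thesis .
qed

definition C1c_field :: "(real^'n::finite \<Rightarrow> real^'n) \<Rightarrow> bool" where
  "C1c_field Z \<longleftrightarrow> (\<forall>i. C1c (\<lambda>x. Z x $ i))"

lemma C1c_field_C1: "C1c_field Z \<Longrightarrow> C1_field S Z"
  unfolding C1c_field_def C1_field_def using C1c_C1_on by blast

lemma C1c_field_has_derivative: "C1c_field Z \<Longrightarrow> (Z has_derivative dfield Z x) (at x)"
  using C1_field_has_derivative[OF C1c_field_C1[of Z UNIV]] by simp

lemma C1c_field_inner: "C1c_field Y \<Longrightarrow> C1c_field Z \<Longrightarrow> C1c (\<lambda>x. Y x \<bullet> Z x)"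
  unfolding inner_vec_def C1c_field_def by (auto intro!: C1c_sum C1c_mult)

lemma C1c_field_scaleR: "C1c f \<Longrightarrow> C1c_field Z \<Longrightarrow> C1c_field (\<lambda>x. f x *\<^sub>R Z x)"
  unfolding C1c_field_def by (auto intro!: C1c_mult)

lemma C1c_field_diff: "C1c_field Y \<Longrightarrow> C1c_field Z \<Longrightarrow> C1c_field (\<lambda>x. Y x - Z x)"
  unfolding C1c_field_def by (auto intro!: C1c_diff)

lemma C1c_has_derivative: "C1c f \<Longrightarrow> (f has_derivative (\<lambda>h. grad f x \<bullet> h)) (at x)"
  using C1_on_has_derivative[OF C1c_C1_on[of f UNIV]] by simp

text \<open>A bounded smooth domain together with a \<open>C\<^sup>1\<close> field \<open>N\<close> on the whole space that extends the outward
normal. Only the tangential derivatives of \<open>N\<close> along the boundary have a geometric meaning; the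
expressions below are arranged so that its normal derivative cancels.\<close>

locale normal_extension =
  fixes X :: "(real^'n::finite) set" and N :: "real^'n \<Rightarrow> real^'n"
  assumes smooth: "smooth_domain X" and bdd: "bounded X" and N: "C1c_field N"
    and N_eq: "x \<in> frontier X \<Longrightarrow> outward_normal X x = N x"

lemma normal_extension_exists:
  assumes X: "smooth_domain X" "bounded X"
  obtains N where "normal_extension X N"
proof -
  have "\<exists>F. C1c F \<and> (\<forall>x\<in>frontier X. F x = outward_normal X x $ i)" for i
  proof (rule C1c_of_local)
    show "compact (frontier X)" using X(2) by (simp add: compact_frontier_bounded)
    fix p assume p: "p \<in> frontier X"
    then obtain V k \<gamma> s where c: "boundary_chart X V k \<gamma> s" "p \<in> V"
      using smooth_domain_chart[OF X(1)] by blast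
    interpret boundary_chart X V k \<gamma> s by (rule c(1))
    have "\<forall>x\<in>V \<inter> frontier X. \<nu> x $ i = outward_normal X x $ i"
      using outward_normal_eq in_frontier_iff by auto
    moreover have "C1_on V (\<lambda>x. \<nu> x $ i)" using C1_\<nu> by (simp add: C1_field_def)
    ultimately show "\<exists>U g. open U \<and> p \<in> U \<and> C1_on U g \<and> (\<forall>x\<in>U \<inter> frontier X. g x = outward_normal X x $ i)"
      using openV c(2) by blast
  qed
  then obtain F where F: "\<And>i. C1c (F i)" "\<And>i x. x \<in> frontier X \<Longrightarrow> F i x = outward_normal X x $ i" by metis
  have "normal_extension X (\<lambda>x. \<chi> i. F i x)"
    by unfold_locales (use X F in \<open>auto simp: C1c_field_def vec_eq_iff\<close>)
  then show thesis using that by blast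
qed

lemma at_within_frontier_Int:
  assumes "open U" "x \<in> U" shows "at x within M \<inter> U = at x within M"
  by (rule at_within_nhd[of x U]) (use assms in auto)

context normal_extension
begin

abbreviation M where "M \<equiv> frontier X"

definition P :: "real^'n \<Rightarrow> real^'n \<Rightarrow> real^'n" where "P x h = h - (h \<bullet> N x) *\<^sub>R N x"

lemma chartE:
  assumes "p \<in> M"
  obtains V k \<gamma> s where "boundary_chart X V k \<gamma> s" "p \<in> V"
  using smooth_domain_chart[OF smooth assms] by blast

lemma N_unit: assumes "x \<in> M" shows "N x \<bullet> N x = 1"
proof -
  obtain V k \<gamma> s where c: "boundary_chart X V k \<gamma> s" "x \<in> V" using chartE[OF assms] by blast
  interpret boundary_chart X V k \<gamma> s by (rule c(1))
  show ?thesis using outward_normal_eq[of x] in_frontier_iff[of x] c(2) assms N_eq[OF assms] \<nu>_\<nu> by simp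
qed

lemma tangent_space_normal: assumes "x \<in> M" shows "tangent_space M x = {Y. N x \<bullet> Y = 0}"
proof -
  obtain V k \<gamma> s where c: "boundary_chart X V k \<gamma> s" "x \<in> V" using chartE[OF assms] by blast
  interpret boundary_chart X V k \<gamma> s by (rule c(1))
  show ?thesis
    using outward_normal_eq[of x] in_frontier_iff[of x] c(2) assms N_eq[OF assms] tangent_space_eq[of x] by simp
qed

lemma tangential_part_eq: "x \<in> M \<Longrightarrow> tangential_part X x = P x"
  by (simp add: tangential_part_def P_def N_eq fun_eq_iff)

lemma P_N: "x \<in> M \<Longrightarrow> P x (N x) = 0" by (simp add: P_def N_unit)

lemma N_P: "x \<in> M \<Longrightarrow> N x \<bullet> P x h = 0"
  by (simp add: P_def inner_diff_right N_unit) (simp add: inner_commute)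

lemma P_tangent: "h \<bullet> N x = 0 \<Longrightarrow> P x h = h" by (simp add: P_def)

lemma P_P: "x \<in> M \<Longrightarrow> P x (P x h) = P x h"
  by (rule P_tangent) (simp add: N_P inner_commute)

lemma P_inner: "P x h \<bullet> k = h \<bullet> P x k"
  by (simp add: P_def inner_diff_left inner_diff_right inner_commute)

lemma P_split: "h = P x h + (h \<bullet> N x) *\<^sub>R N x" by (simp add: P_def)

text \<open>If \<open>F\<close> extends to a function that is differentiable in the ambient space, the derivative along the
boundary is the ambient derivative composed with the tangential projection \<open>P\<close>. Curves in the boundary
give uniqueness on tangent vectors.\<close>

lemma bdry_deriv_eq:
  fixes F G :: "real^'n \<Rightarrow> 'b::real_normed_vector"
  assumes x: "x \<in> M" and G: "(G has_derivative G') (at x)"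
    and U: "open U" "x \<in> U" "\<And>y. y \<in> M \<inter> U \<Longrightarrow> F y = G y"
  shows "bdry_deriv X F x = (\<lambda>h. G' (P x h))"
proof -
  obtain V k \<gamma> s where c: "boundary_chart X V k \<gamma> s" "x \<in> V" using chartE[OF x] by blast
  interpret boundary_chart X V k \<gamma> s by (rule c(1))
  have \<rho>x: "\<rho> x = 0" using in_frontier_iff c(2) x by blast
  have nx: "\<nu> x = N x" using outward_normal_eq[OF c(2) \<rho>x] N_eq[OF x] by simp
  interpret G': linear G' by (rule has_derivative_linear[OF G])
  \<comment> \<open>Subtracting a multiple of the defining function changes \<open>G\<close> off \<open>M\<close> only and
    removes its normal derivative.\<close>
  define G2 where "G2 y = G y - (inverse (norm (d\<rho> x)) * \<rho> y) *\<^sub>R G' (N x)" for y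
  have "(G2 has_derivative (\<lambda>h. G' h - (inverse (norm (d\<rho> x)) * (d\<rho> x \<bullet> h)) *\<^sub>R G' (N x))) (at x)"
    unfolding G2_def[abs_def]
    by (intro derivative_intros G has_derivative_scaleR_left \<rho>_deriv)
  moreover have "G' h - (inverse (norm (d\<rho> x)) * (d\<rho> x \<bullet> h)) *\<^sub>R G' (N x) = G' (P x h)" for h
  proof -
    have "inverse (norm (d\<rho> x)) * (d\<rho> x \<bullet> h) = \<nu> x \<bullet> h" by (simp add: \<nu>_def)
    then show ?thesis by (simp add: nx P_def G'.diff G'.scaleR inner_commute)
  qed
  ultimately have "(G2 has_derivative (\<lambda>h. G' (P x h))) (at x)" by simp
  then have "(G2 has_derivative (\<lambda>h. G' (P x h))) (at x within M \<inter> (U \<inter> V))"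
    by (rule has_derivative_at_withinI)
  then have "(F has_derivative (\<lambda>h. G' (P x h))) (at x within M \<inter> (U \<inter> V))"
    by (rule has_derivative_transform[rotated 2])
       (use U c(2) x in_frontier_iff in \<open>auto simp: G2_def\<close>)
  then have F1: "(F has_derivative (\<lambda>h. G' (P x h))) (at x within M)"
    
    using at_within_frontier_Int[OF open_Int[OF U(1) openV], of x M] U(2) c(2) by simp
  show ?thesis unfolding bdry_deriv_def
  proof (rule the_equality)
    show "(F has_derivative (\<lambda>h. G' (P x h))) (at x within M) \<and> G' (P x (outward_normal X x)) = 0"
      using F1 by (simp add: N_eq[OF x] P_N[OF x] G'.zero)
  next
    fix F' assume F': "(F has_derivative F') (at x within M) \<and> F' (outward_normal X x) = 0"
    then interpret F': linear F' using has_derivative_linear by blast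
    have tan: "F' Y = G' (P x Y)" if Y: "N x \<bullet> Y = 0" for Y
    proof -
      have "Y \<in> tangent_space M x" using tangent_space_normal[OF x] Y by simp
      then obtain c e where c: "e > 0" "\<And>t. \<bar>t\<bar> < e \<Longrightarrow> c t \<in> M" "c 0 = x"
        "(c has_vector_derivative Y) (at (0::real))"
        unfolding tangent_space_def by blast
      have img: "c ` ball 0 e \<subseteq> M" using c(2) by auto
      have dc: "(c has_derivative (\<lambda>t. t *\<^sub>R Y)) (at 0 within ball 0 e)"
        using c(4) unfolding has_vector_derivative_def by (rule has_derivative_at_withinI)
      have ch: "((\<lambda>t. F (c t)) has_derivative (\<lambda>t. D (t *\<^sub>R Y))) (at 0)"
        if "(F has_derivative D) (at x within M)" for D
      proof -
        have "(F has_derivative D) (at (c 0) within c ` ball 0 e)"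
          using has_derivative_subset[OF that img] c(3) by simp
        from has_derivative_in_compose[OF dc this] show ?thesis
          using at_within_open[of "0::real" "ball 0 e"] c(1) by simp
      qed
      have "(\<lambda>t. F' (t *\<^sub>R Y)) = (\<lambda>t. G' (P x (t *\<^sub>R Y)))"
        by (rule has_derivative_unique[OF ch ch]) (use F' F1 in auto)
      from fun_cong[OF this, of 1] show ?thesis by simp
    qed
    show "F' = (\<lambda>h. G' (P x h))"
    proof
      fix h
      have "F' h = F' (P x h) + (h \<bullet> N x) *\<^sub>R F' (N x)"
        by (metis P_split F'.add F'.scaleR)
      then show "F' h = G' (P x h)"
        using tan[OF N_P[OF x]] F' by (simp add: N_eq[OF x] P_P[OF x])
    qed
  qed
qed

lemma normal_deriv_eq:
  assumes x: "x \<in> M" and F: "(F has_derivative F') (at x)"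
    and v: "\<And>y. y \<in> closure X \<Longrightarrow> v y = F y"
  shows "normal_deriv X v x = F' (N x)"
proof -
  obtain V k \<gamma> s where c: "boundary_chart X V k \<gamma> s" "x \<in> V" using chartE[OF x] by blast
  interpret boundary_chart X V k \<gamma> s by (rule c(1))
  have \<rho>x: "\<rho> x = 0" using in_frontier_iff c(2) x by blast
  have nx: "\<nu> x = N x" using outward_normal_eq[OF c(2) \<rho>x] N_eq[OF x] by simp
  obtain d where d: "d > 0" "\<forall>t. 0 < t \<and> t < d \<longrightarrow> x - t *\<^sub>R N x \<in> X"
    using inward_ray[OF c(2) \<rho>x open_UNIV] nx by auto
  have "(F has_derivative F') (at (x + 0 *\<^sub>R N x))" using F by simp
  from has_real_derivative_line[OF this]
  have "((\<lambda>t. F (x + t *\<^sub>R N x)) has_vector_derivative F' (N x)) (at 0 within {..0})"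
    by (simp add: has_real_derivative_iff_has_vector_derivative has_vector_derivative_at_within)
  then have "((\<lambda>t. v (x + t *\<^sub>R N x)) has_vector_derivative F' (N x)) (at 0 within {..0})"
  proof (rule has_vector_derivative_transform_within[OF _ d(1)])
    fix t :: real assume t: "t \<in> {..0}" "dist t 0 < d"
    have "x + t *\<^sub>R N x \<in> closure X"
    proof (cases "t = 0")
      case True then show ?thesis using x by (simp add: frontier_def)
    next
      case False
      then have "x - (- t) *\<^sub>R N x \<in> X" using d(2)[rule_format, of "- t"] t by auto
      then show ?thesis using closure_subset by auto
    qed
    then show "F (x + t *\<^sub>R N x) = v (x + t *\<^sub>R N x)" using v by simp
  qed auto
  then show ?thesis unfolding normal_deriv_def N_eq[OF x]
  proof (rule vector_derivative_within[rotated])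
    have "{..0} - {0} = {..<0::real}" by auto
    then show "at 0 within {..0::real} \<noteq> bot" by (simp add: trivial_limit_within islimpt_in_closure)
  qed
qed

lemma bdry_grad_eq:
  assumes x: "x \<in> M" and G: "(G has_derivative (\<lambda>h. g \<bullet> h)) (at x)"
    and U: "open U" "x \<in> U" "\<And>y. y \<in> M \<inter> U \<Longrightarrow> F y = G y"
  shows "bdry_grad X F x = P x g"
  unfolding bdry_grad_def bdry_deriv_eq[OF x G U, simplified]
  by (simp add: P_inner[symmetric] euclidean_representation)

lemma tangential_trace_eq:
  assumes x: "x \<in> M" and D: "linear D" and b: "\<And>Y Z. b Y Z = D (P x Y) \<bullet> P x Z"
  shows "tangential_trace X x b = lin_trace D - D (N x) \<bullet> N x"
  unfolding tangential_trace_def tangential_part_eq[OF x] b P_P[OF x]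
  using trace_tangential[OF D N_unit[OF x]] by (simp add: P_def)

lemma bdry_laplacian_eq:
  assumes x: "x \<in> M" and U: "open U" "x \<in> U" and W: "C1_field U W"
    and eq: "\<And>y. y \<in> M \<inter> U \<Longrightarrow> bdry_grad X v y = W y"
  shows "bdry_laplacian X v x = lin_trace (dfield W x) - dfield W x (N x) \<bullet> N x"
proof -
  have d: "(W has_derivative dfield W x) (at x)" using C1_field_has_derivative[OF W U(2)] .
  have d2: "bdry_deriv X (bdry_grad X v) x = (\<lambda>h. dfield W x (P x h))"
    by (rule bdry_deriv_eq[OF x d U]) (rule eq)
  show ?thesis unfolding bdry_laplacian_def
  proof (rule tangential_trace_eq[OF x has_derivative_linear[OF d]])
    show "bdry_hess X v x Y Z = dfield W x (P x Y) \<bullet> P x Z" for Y Z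
      unfolding bdry_hess_def d2 tangential_part_eq[OF x] by (rule P_inner)
  qed
qed

lemma N_has_derivative: "(N has_derivative dfield N x) (at x)"
  by (rule C1c_field_has_derivative[OF N])

lemma dN_linear: "linear (dfield N x)"
  by (rule has_derivative_linear[OF N_has_derivative])

lemma second_fundamental_form_eq:
  "x \<in> M \<Longrightarrow> second_fundamental_form X x Y Z = dfield N x (P x Y) \<bullet> Z"
  unfolding second_fundamental_form_def
  using bdry_deriv_eq[OF _ N_has_derivative open_UNIV] N_eq by simp

text \<open>Differentiate \<open>N \<bullet> N = 1\<close> along the boundary.\<close>

lemma dN_tangent:
  assumes x: "x \<in> M" shows "dfield N x (P x h) \<bullet> N x = 0"
proof -
  have "((\<lambda>y. N y \<bullet> N y) has_derivative (\<lambda>h. N x \<bullet> dfield N x h + dfield N x h \<bullet> N x)) (at x)"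
    by (rule has_derivative_inner[OF N_has_derivative N_has_derivative])
  then have "bdry_deriv X (\<lambda>y. 1) x = (\<lambda>h. N x \<bullet> dfield N x (P x h) + dfield N x (P x h) \<bullet> N x)"
    by (rule bdry_deriv_eq[OF x _ open_UNIV]) (simp_all add: N_unit)
  moreover have "bdry_deriv X (\<lambda>y. 1::real) x = (\<lambda>h. 0)"
    by (rule bdry_deriv_eq[OF x _ open_UNIV, of "\<lambda>y. 1::real" "\<lambda>h. 0"]) auto
  ultimately have "(\<lambda>h. N x \<bullet> dfield N x (P x h) + dfield N x (P x h) \<bullet> N x) = (\<lambda>h. 0)" by simp
  from fun_cong[OF this, of h] have "N x \<bullet> dfield N x (P x h) + dfield N x (P x h) \<bullet> N x = 0" .
  then show ?thesis by (simp add: inner_commute)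
qed

lemma mean_curvature_eq:
  assumes x: "x \<in> M"
  shows "mean_curvature X x = lin_trace (dfield N x) - dfield N x (N x) \<bullet> N x"
  unfolding mean_curvature_def
proof (rule tangential_trace_eq[OF x dN_linear])
  fix Y Z
  have "dfield N x (P x Y) \<bullet> Z = dfield N x (P x Y) \<bullet> P x Z"
    using dN_tangent[OF x, of Y] by (simp add: P_def[of x Z] inner_diff_right)
  then show "second_fundamental_form X x Y Z = dfield N x (P x Y) \<bullet> P x Z"
    by (simp add: second_fundamental_form_eq[OF x])
qed

text \<open>In a chart the normal is \<open>d\<rho>\<close> divided by its norm. On tangent vectors the derivative of the
normalizing factor drops out, and what remains is the Hessian of \<open>\<rho>\<close>.\<close>

lemma second_fundamental_form_symmetric:
  assumes x: "x \<in> M" and Y: "N x \<bullet> Y = 0" and Z: "N x \<bullet> Z = 0"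
  shows "dfield N x Y \<bullet> Z = dfield N x Z \<bullet> Y"
proof -
  obtain V k \<gamma> s where c: "boundary_chart X V k \<gamma> s" "x \<in> V" using chartE[OF x] by blast
  interpret boundary_chart X V k \<gamma> s by (rule c(1))
  have \<rho>x: "\<rho> x = 0" using in_frontier_iff c(2) x by blast
  have nx: "\<nu> x = N x" using outward_normal_eq[OF c(2) \<rho>x] N_eq[OF x] by simp
  have dn: "(\<nu> has_derivative dfield \<nu> x) (at x)"
    using C1_field_has_derivative[OF C1_\<nu>[of UNIV]] by simp
  have nN: "\<nu> y = N y" if "y \<in> M \<inter> V" for y
    using outward_normal_eq[of y] N_eq[of y] in_frontier_iff[of y] that by auto
  have "bdry_deriv X N x = (\<lambda>h. dfield \<nu> x (P x h))"
    by (rule bdry_deriv_eq[OF x dn openV c(2)]) (simp add: nN)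
  moreover have "bdry_deriv X N x = (\<lambda>h. dfield N x (P x h))"
    by (rule bdry_deriv_eq[OF x N_has_derivative open_UNIV]) auto
  ultimately have dnN: "dfield \<nu> x h = dfield N x h" if "N x \<bullet> h = 0" for h
    using P_tangent[of h x] that by (metis inner_commute)
  have dm: "(d\<rho> has_derivative dfield d\<rho> x) (at x)"
    using C1_field_has_derivative[OF C1_d\<rho>[of UNIV]] by simp
  have "((\<lambda>y. norm (d\<rho> y) *\<^sub>R \<nu> y) has_derivative
      (\<lambda>h. norm (d\<rho> x) *\<^sub>R dfield \<nu> x h + (grad (\<lambda>y. norm (d\<rho> y)) x \<bullet> h) *\<^sub>R \<nu> x)) (at x)"
    by (rule has_derivative_scaleR[OF C1_on_has_derivative[OF C1_norm_d\<rho>[of UNIV]] dn]) simp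
  then have eq: "dfield d\<rho> x = (\<lambda>h. norm (d\<rho> x) *\<^sub>R dfield \<nu> x h + (grad (\<lambda>y. norm (d\<rho> y)) x \<bullet> h) *\<^sub>R \<nu> x)"
    using dm unfolding d\<rho>_\<nu>[symmetric] by (rule has_derivative_unique[rotated])
  have sm: "dfield d\<rho> x h \<bullet> l = norm (d\<rho> x) * (dfield N x h \<bullet> l)" if "N x \<bullet> h = 0" "N x \<bullet> l = 0" for h l
    using that dnN[OF that(1)] by (simp add: eq inner_add_left nx)
  have "dfield d\<rho> x Y \<bullet> Z = dfield d\<rho> x Z \<bullet> Y"
    by (rule second_derivative_symmetric[OF open_UNIV _ C1_\<rho> C1_d\<rho>]) (auto intro: grad_eqI \<rho>_deriv)
  then show ?thesis using sm[OF Y Z] sm[OF Z Y] norm_d\<rho>_pos[of x] by simp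
qed

end

section \<open>Extended gradients and the boundary operator\<close>

lemma Ck_up_to_boundary_Suc:
  "Ck_up_to_boundary (Suc k) X f \<Longrightarrow> Ck_up_to_boundary k X f"
  by (induction k arbitrary: f) auto

lemma C_closure_2_subset_1: "C_closure 2 X \<subseteq> C_closure 1 X"
  using Ck_up_to_boundary_Suc[of "Suc 0" X] by (auto simp: C_closure_def numeral_2_eq_2)

lemma Ck_up_to_boundary_cong:
  assumes X: "open X" and eq: "\<And>x. x \<in> X \<Longrightarrow> f x = g x" and f: "Ck_up_to_boundary (Suc 0) X f"
  shows "Ck_up_to_boundary (Suc 0) X g"
proof -
  have d: "(g has_derivative frechet_derivative f (at x)) (at x)" if "x \<in> X" for x
    by (rule has_derivative_transform_within_open[OF _ X that eq])
       (use f that frechet_derivative_works in auto)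
  then have fr: "frechet_derivative g (at x) = frechet_derivative f (at x)" if "x \<in> X" for x
    using frechet_derivative_at[OF d[OF that]] by simp
  have "extends_to_closure X g" using f eq by (simp add: extends_to_closure_def)
  moreover have "extends_to_closure X (\<lambda>x. frechet_derivative g (at x) h)" for h
    using f fr by (simp add: extends_to_closure_def)
  ultimately show ?thesis using d by (auto simp: differentiable_def)
qed

text \<open>\<open>V\<close> and \<open>Z\<close> are \<open>C\<^sup>1\<close> extensions of \<open>v\<close> and of its gradient. They are chosen separately, so \<open>Z\<close> is
the gradient of \<open>V\<close> on the closed domain only, and \<open>V\<close> need not be \<open>C\<^sup>2\<close>.\<close>

definition jet_extension ::
  "(real^'n::finite) set \<Rightarrow> (real^'n \<Rightarrow> real) \<Rightarrow> (real^'n \<Rightarrow> real) \<Rightarrow> (real^'n \<Rightarrow> real^'n) \<Rightarrow> bool" where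
  "jet_extension X v V Z \<longleftrightarrow>
     C1c V \<and> C1c_field Z \<and> (\<forall>x\<in>closure X. V x = v x) \<and> (\<forall>x\<in>closure X. grad V x = Z x)"

text \<open>The partial derivatives of \<open>v\<close> on \<open>X\<close> are themselves \<open>C\<^sup>1\<close> up to the boundary after continuous
extension, so the extension theorem applies to each of them. The identity \<open>grad V = Z\<close> passes from
\<open>X\<close> to its closure by continuity.\<close>

lemma jet_extension_exists:
  assumes X: "smooth_domain X" "bounded X" and v: "v \<in> C_closure 2 X"
  obtains V Z where "jet_extension X v V Z"
proof -
  have oX: "open X" using X(1) by (simp add: smooth_domain_def)
  obtain V where V: "C1c V" "\<And>x. x \<in> closure X \<Longrightarrow> V x = v x"
    using C1_extension[OF X] v C_closure_2_subset_1 by blast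
  have dv: "(v has_derivative (\<lambda>h. grad V x \<bullet> h)) (at x)" if "x \<in> X" for x
    by (rule has_derivative_transform_within_open[OF C1c_has_derivative[OF V(1)] oX that])
       (use V(2) closure_subset in auto)
  have "\<exists>F. C1c F \<and> (\<forall>x\<in>X. F x = grad V x $ i)" for i
  proof -
    have u: "Ck_up_to_boundary (Suc 0) X (\<lambda>x. frechet_derivative v (at x) (axis i 1))"
      using v by (simp add: C_closure_def numeral_2_eq_2)
    then obtain g where g: "continuous_on (closure X) g"
      "\<And>x. x \<in> X \<Longrightarrow> g x = frechet_derivative v (at x) (axis i 1)"
      by (auto simp: extends_to_closure_def)
    have "Ck_up_to_boundary (Suc 0) X g"
      by (rule Ck_up_to_boundary_cong[OF oX _ u]) (simp add: g(2))
    then have "g \<in> C_closure 1 X" using g(1) by (simp add: C_closure_def)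
    then obtain F where F: "C1c F" "\<And>x. x \<in> closure X \<Longrightarrow> F x = g x" using C1_extension[OF X] by blast
    have "F x = grad V x $ i" if "x \<in> X" for x
      using F(2)[of x] g(2)[OF that] closure_subset that frechet_derivative_at[OF dv[OF that], symmetric]
      by (auto simp: inner_axis)
    then show ?thesis using F(1) by blast
  qed
  then obtain F where F: "\<And>i. C1c (F i)" "\<And>i x. x \<in> X \<Longrightarrow> F i x = grad V x $ i" by metis
  define Z where "Z x = (\<chi> i. F i x)" for x
  have Z: "C1c_field Z" using F(1) by (simp add: C1c_field_def Z_def)
  have "closed {x. grad V x = Z x}"
    by (intro closed_Collect_eq C1_on_grad C1c_C1_on[OF V(1)] C1_field_continuous_on C1c_field_C1 Z)
  moreover have "X \<subseteq> {x. grad V x = Z x}" by (auto simp: Z_def F(2) vec_eq_iff)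
  ultimately have "closure X \<subseteq> {x. grad V x = Z x}" by (rule closure_minimal[rotated])
  then have "jet_extension X v V Z" using V Z by (auto simp: jet_extension_def)
  then show thesis by (rule that)
qed

lemma jet_extension_lin:
  assumes "jet_extension X v V Z" "jet_extension X w W Y"
  shows "jet_extension X (\<lambda>x. a * v x + b * w x) (\<lambda>x. a * V x + b * W x) (\<lambda>x. a *\<^sub>R Z x + b *\<^sub>R Y x)"
proof -
  have V: "C1c V" "C1c W" "C1c_field Z" "C1c_field Y" using assms by (auto simp: jet_extension_def)
  have "grad (\<lambda>x. a * V x + b * W x) x = a *\<^sub>R grad V x + b *\<^sub>R grad W x" for x
  proof (rule grad_eqI)
    have "((\<lambda>x. a * V x + b * W x) has_derivative (\<lambda>h. a * (grad V x \<bullet> h) + b * (grad W x \<bullet> h))) (at x)"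
      by (intro derivative_intros C1c_has_derivative V)
    then show "((\<lambda>x. a * V x + b * W x) has_derivative (\<lambda>h. (a *\<^sub>R grad V x + b *\<^sub>R grad W x) \<bullet> h)) (at x)"
      by (simp add: inner_add_left)
  qed
  then show ?thesis using assms V
    by (auto simp: jet_extension_def C1c_field_def intro!: C1c_add C1c_cmult)
qed

lemma continuous_on_lin_trace_dfield:
  "C1_field S W \<Longrightarrow> continuous_on S (\<lambda>x. lin_trace (dfield W x))"
  unfolding lin_trace_def by (intro continuous_intros C1_field_continuous_dfield) auto

lemma (in boundary_chart) C1_refl: "C1_field S (refl c)"
proof -
  have *: "C1_on S (\<lambda>x. - (s * c * \<rho> x))"
    using C1_on_cmult[OF C1_\<rho>[of S], of "- (s * c)"] by simp
  have "C1_on S (\<lambda>x. x $ i + - (s * c * \<rho> x) * axis k 1 $ i)" for i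
    by (intro C1_on_add C1_on_component C1_on_mult[OF * C1_on_const])
  then show ?thesis by (simp add: C1_field_def refl_def)
qed

context normal_extension
begin

lemma openX: "open X" using smooth by (simp add: smooth_domain_def)

lemma compact_M: "compact M" using bdd by (simp add: compact_frontier_bounded)

lemma M_closure: "x \<in> M \<Longrightarrow> x \<in> closure X" by (simp add: frontier_def)

lemma C1_N: "C1_field S N" by (rule C1c_field_C1[OF N])

text \<open>The local extension required of the restriction to \<open>M\<close> is \<open>V\<close> composed with the projection to the
graph along the \<open>k\<close>-axis. By the chain rule its derivatives only involve values of \<open>grad V\<close> on \<open>M\<close>;
there \<open>grad V = Z\<close> is \<open>C\<^sup>1\<close>, so the composition is \<open>C\<^sup>2\<close> although \<open>V\<close> need not be.\<close>

lemma jet_extension_C_submanifold: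
  assumes "jet_extension X v V Z" shows "v \<in> C_submanifold 2 M"
  unfolding C_submanifold_def
proof (intro CollectI ballI)
  fix p assume p: "p \<in> M"
  have V: "C1c V" "C1c_field Z" "\<And>x. x \<in> closure X \<Longrightarrow> V x = v x" "\<And>x. x \<in> closure X \<Longrightarrow> grad V x = Z x"
    using assms by (auto simp: jet_extension_def)
  obtain V' k \<gamma> s where c: "boundary_chart X V' k \<gamma> s" "p \<in> V'" using chartE[OF p] by blast
  interpret boundary_chart X V' k \<gamma> s by (rule c(1))
  \<comment> \<open>\<open>refl 1\<close> is the projection to the graph along the \<open>k\<close>-axis.\<close>
  define U where "U = V' \<inter> refl 1 -` V'"
  have U: "open U" unfolding U_def by (intro open_Int openV open_vimage refl_cont)
  have fix1: "refl 1 x = x" if "x \<in> V' \<inter> M" for x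
    using that in_frontier_iff[of x] by (auto simp: refl_def)
  have RM: "refl 1 x \<in> M" if "x \<in> U" for x
    using that in_frontier_iff[of "refl 1 x"] by (auto simp: U_def \<rho>_refl)
  define \<phi> where "\<phi> x = V (refl 1 x)" for x
  define D where "D x h = Z (refl 1 x) \<bullet> h - (s * (d\<rho> x \<bullet> h)) * (Z (refl 1 x) $ k)" for x h
  have d\<phi>: "(\<phi> has_derivative D x) (at x)" if "x \<in> U" for x
    using has_derivative_compose[OF refl_deriv[of 1 x] C1c_has_derivative[OF V(1)]]
      V(4)[OF M_closure[OF RM[OF that]]]
    by (simp add: \<phi>_def[abs_def] D_def[abs_def] inner_diff_right inner_axis)
  have CZ: "C1_field U (\<lambda>x. Z (refl 1 x))"
    using C1_on_compose[OF _ C1_refl[of U 1], of UNIV] C1c_field_C1[OF V(2), of UNIV]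
    by (auto simp: C1_field_def)
  have CD: "C1_on U (\<lambda>x. D x h)" for h
  proof -
    have "C1_field U (\<lambda>x. h)" by (auto simp: C1_field_def intro: C1_on_const)
    moreover have "C1_on U (\<lambda>x. Z (refl 1 x) $ k)" using CZ by (simp add: C1_field_def)
    ultimately show ?thesis unfolding D_def
      by (intro C1_on_intros C1_field_inner CZ C1_d\<rho>)
  qed
  have "Ck_on (Suc 0) U (\<lambda>x. frechet_derivative \<phi> (at x) h)" for h
    unfolding Ck_on_1
    by (rule C1_on_cong[OF CD U]) (simp add: frechet_derivative_at[OF d\<phi>, symmetric])
  then have "Ck_on 2 U \<phi>"
    unfolding numeral_2_eq_2 Ck_on_Suc[of "Suc 0"] using d\<phi> differentiable_def by blast
  moreover have "\<forall>x\<in>U \<inter> M. v x = \<phi> x"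
    using fix1 V(3) M_closure by (auto simp: U_def \<phi>_def)
  moreover have "p \<in> U" using c(2) fix1[of p] p by (simp add: U_def)
  ultimately show "\<exists>V g. open V \<and> p \<in> V \<and> Ck_on 2 V g \<and> (\<forall>x\<in>V \<inter> M. v x = g x)"
    using U by blast
qed

text \<open>The tangential part of a field. For an extended gradient it extends the boundary gradient.\<close>

definition tang :: "(real^'n \<Rightarrow> real^'n) \<Rightarrow> real^'n \<Rightarrow> real^'n" where
  "tang Z x = Z x - (Z x \<bullet> N x) *\<^sub>R N x"

lemma tang_P: "tang Z x = P x (Z x)" by (simp add: tang_def P_def)

lemma C1_tang: "C1_field S Z \<Longrightarrow> C1_field S (tang Z)"
  unfolding tang_def[abs_def] by (intro C1_field_diff C1_field_scaleR C1_field_inner C1_N)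

lemma C1c_tang: "C1c_field Z \<Longrightarrow> C1c_field (tang Z)"
  unfolding tang_def[abs_def] by (intro C1c_field_diff C1c_field_scaleR C1c_field_inner N)

text \<open>The divergence along the boundary, which only involves derivatives in tangential directions. For a
tangential field it is the divergence of the induced metric; for \<open>N\<close> it is the mean curvature.\<close>

definition sdiv :: "(real^'n \<Rightarrow> real^'n) \<Rightarrow> real^'n \<Rightarrow> real" where
  "sdiv Z x = lin_trace (dfield Z x) - dfield Z x (N x) \<bullet> N x"

lemma continuous_on_sdiv: "C1_field S Z \<Longrightarrow> continuous_on S (sdiv Z)"
  unfolding sdiv_def[abs_def]
  by (intro continuous_intros continuous_on_lin_trace_dfield C1_field_continuous_dfield
      C1_field_continuous_on C1_N)

lemma bdry_grad_local:
  assumes "x \<in> M" "open U" "x \<in> U" "C1_on U G" "\<And>y. y \<in> U \<inter> M \<Longrightarrow> v y = G y"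
  shows "bdry_grad X v x = tang (grad G) x"
  unfolding tang_P
  by (rule bdry_grad_eq[OF assms(1) C1_on_has_derivative[OF assms(4) assms(3)] assms(2,3)]) (use assms(5) in auto)

lemma B2_local:
  assumes U: "open U" "x \<in> U" and x: "x \<in> M"
    and Z: "C1_field U Z" "\<And>y. y \<in> U \<inter> M \<Longrightarrow> bdry_grad X v y = Z y"
    and Y: "C1_field U Y" "\<And>y. y \<in> U \<inter> M \<Longrightarrow> bdry_grad X w y = Y y"
    and V: "C1c V" "\<And>y. y \<in> closure X \<Longrightarrow> V y = v y"
    and W: "C1c W" "\<And>y. y \<in> closure X \<Longrightarrow> W y = w y"
  shows "B2 X v w x = 1/2 * ((grad V x \<bullet> N x) * sdiv Y x + (grad W x \<bullet> N x) * sdiv Z x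
    + dfield N x (P x (Z x)) \<bullet> Y x + sdiv N x * (grad V x \<bullet> N x) * (grad W x \<bullet> N x))"
proof -
  have "normal_deriv X v x = grad V x \<bullet> N x"
    using normal_deriv_eq[OF x C1c_has_derivative[OF V(1)]] V(2) by simp
  moreover have "normal_deriv X w x = grad W x \<bullet> N x"
    using normal_deriv_eq[OF x C1c_has_derivative[OF W(1)]] W(2) by simp
  moreover have "bdry_laplacian X v x = sdiv Z x"
    using bdry_laplacian_eq[OF x U Z(1), of v] Z(2) by (simp add: sdiv_def)
  moreover have "bdry_laplacian X w x = sdiv Y x"
    using bdry_laplacian_eq[OF x U Y(1), of w] Y(2) by (simp add: sdiv_def)
  ultimately show ?thesis
    using Z(2)[of x] Y(2)[of x] U x
    by (simp add: B2_def second_fundamental_form_eq[OF x] mean_curvature_eq[OF x] sdiv_def)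
qed

lemma C_submanifold_2E:
  assumes v: "v \<in> C_submanifold 2 M" and p: "p \<in> M"
  obtains U Z where "open U" "p \<in> U" "C1_field U Z" "\<And>y. y \<in> U \<inter> M \<Longrightarrow> bdry_grad X v y = Z y"
proof -
  obtain U g where U: "open U" "p \<in> U" "Ck_on (Suc (Suc 0)) U g" "\<And>x. x \<in> U \<inter> M \<Longrightarrow> v x = g x"
    using v p unfolding C_submanifold_def numeral_2_eq_2 by blast
  have "C1_on U (\<lambda>x. grad g x $ i)" for i
    using U(3) unfolding Ck_on_Suc[of "Suc 0"] Ck_on_1 grad_def by simp
  then have Cg: "C1_field U (grad g)" by (simp add: C1_field_def)
  have "C1_on U g"
  proof (rule C1_onI)
    show "(g has_derivative (\<lambda>h. grad g x \<bullet> h)) (at x)" if "x \<in> U" for x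
      using U(3) that by (intro has_derivative_grad) simp
  qed (rule C1_field_continuous_on[OF Cg])
  then have "bdry_grad X v y = tang (grad g) y" if "y \<in> U \<inter> M" for y
    using that bdry_grad_local[of y U g v] U by auto
  then show thesis using that U(1,2) C1_tang[OF Cg] by blast
qed

lemma continuous_on_B2:
  assumes v: "v \<in> C_closure 1 X \<inter> C_submanifold 2 M" and w: "w \<in> C_closure 1 X \<inter> C_submanifold 2 M"
  shows "continuous_on M (B2 X v w)"
  unfolding continuous_on_eq_continuous_within
proof
  fix p assume p: "p \<in> M"
  obtain V where V: "C1c V" "\<And>y. y \<in> closure X \<Longrightarrow> V y = v y"
    using C1_extension[OF smooth bdd] v by blast
  obtain W where W: "C1c W" "\<And>y. y \<in> closure X \<Longrightarrow> W y = w y"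
    using C1_extension[OF smooth bdd] w by blast
  obtain U1 Z where Z: "open U1" "p \<in> U1" "C1_field U1 Z" "\<And>y. y \<in> U1 \<inter> M \<Longrightarrow> bdry_grad X v y = Z y"
    using C_submanifold_2E[OF _ p, of v] v by blast
  obtain U2 Y where Y: "open U2" "p \<in> U2" "C1_field U2 Y" "\<And>y. y \<in> U2 \<inter> M \<Longrightarrow> bdry_grad X w y = Y y"
    using C_submanifold_2E[OF _ p, of w] w by blast
  define U where "U = U1 \<inter> U2"
  have U: "open U" "p \<in> U" using Z(1,2) Y(1,2) by (auto simp: U_def)
  have ZU: "C1_field U Z" "C1_field U Y"
    using C1_field_subset[OF Z(3)] C1_field_subset[OF Y(3)] by (auto simp: U_def)
  define E where "E x = 1/2 * ((grad V x \<bullet> N x) * sdiv Y x + (grad W x \<bullet> N x) * sdiv Z x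
    + dfield N x (P x (Z x)) \<bullet> Y x + sdiv N x * (grad V x \<bullet> N x) * (grad W x \<bullet> N x))" for x
  have cN: "continuous_on U N" by (rule C1_field_continuous_on[OF C1_N])
  have cZ: "continuous_on U Z" "continuous_on U Y" using ZU C1_field_continuous_on by auto
  have "continuous_on U E" unfolding E_def P_def
    by (intro continuous_intros continuous_on_sdiv ZU C1_N C1_field_continuous_dfield cN cZ
        C1_on_grad C1c_C1_on V(1) W(1))
  then have "continuous_on (M \<inter> U) E" by (rule continuous_on_subset) auto
  moreover have "E x = B2 X v w x" if "x \<in> M \<inter> U" for x
    unfolding E_def
    by (rule B2_local[OF U(1) _ _ ZU(1) _ ZU(2) _ V W, symmetric]) (use that Z Y U_def in auto)
  ultimately have "continuous_on (M \<inter> U) (B2 X v w)" by (rule continuous_on_eq)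
  then have "continuous (at p within M \<inter> U) (B2 X v w)"
    using p U by (simp add: continuous_on_eq_continuous_within)
  then show "continuous (at p within M) (B2 X v w)"
    using at_within_frontier_Int[OF U] by simp
qed

lemma B2_jet:
  assumes v: "jet_extension X v V Z" and w: "jet_extension X w W Y" and x: "x \<in> M"
  shows "2 * B2 X v w x = (Z x \<bullet> N x) * sdiv (tang Y) x + (Y x \<bullet> N x) * sdiv (tang Z) x
    + dfield N x (tang Z x) \<bullet> tang Y x + sdiv N x * (Z x \<bullet> N x) * (Y x \<bullet> N x)"
proof -
  have V: "C1c V" "C1c_field Z" "\<And>x. x \<in> closure X \<Longrightarrow> V x = v x" "\<And>x. x \<in> closure X \<Longrightarrow> grad V x = Z x"
    using v by (auto simp: jet_extension_def)
  have W: "C1c W" "C1c_field Y" "\<And>x. x \<in> closure X \<Longrightarrow> W x = w x" "\<And>x. x \<in> closure X \<Longrightarrow> grad W x = Y x"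
    using w by (auto simp: jet_extension_def)
  have g: "bdry_grad X v y = tang Z y" if "y \<in> M" for y
    using bdry_grad_local[OF that open_UNIV UNIV_I C1c_C1_on[OF V(1)]] V(3,4) M_closure that
    by (simp add: tang_def)
  have g': "bdry_grad X w y = tang Y y" if "y \<in> M" for y
    using bdry_grad_local[OF that open_UNIV UNIV_I C1c_C1_on[OF W(1)]] W(3,4) M_closure that
    by (simp add: tang_def)
  have "B2 X v w x = 1/2 * ((grad V x \<bullet> N x) * sdiv (tang Y) x + (grad W x \<bullet> N x) * sdiv (tang Z) x
    + dfield N x (P x (tang Z x)) \<bullet> tang Y x + sdiv N x * (grad V x \<bullet> N x) * (grad W x \<bullet> N x))"
    by (rule B2_local[OF open_UNIV UNIV_I x C1_tang[OF C1c_field_C1[OF V(2)]] _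
          C1_tang[OF C1c_field_C1[OF W(2)]] _ V(1,3) W(1,3)]) (use g g' in auto)
  then show ?thesis
    using V(4)[OF M_closure[OF x]] W(4)[OF M_closure[OF x]] P_P[OF x] by (simp add: tang_P)
qed

lemma lin_trace_rank_one:
  assumes "linear l" shows "lin_trace (\<lambda>h. l h *\<^sub>R a) = (l a :: real)"
proof -
  interpret linear l by (rule assms)
  have "l a = l (\<Sum>e\<in>Basis. (a \<bullet> e) *\<^sub>R e)" by (simp add: euclidean_representation)
  also have "\<dots> = (\<Sum>e\<in>Basis. (a \<bullet> e) * l e)" by (simp add: sum scaleR)
  finally show ?thesis by (simp add: lin_trace_def mult.commute)
qed

lemma sdiv_scaleR:
  assumes f: "C1c f" and F: "C1c_field F" and t: "F x \<bullet> N x = 0"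
  shows "sdiv (\<lambda>x. f x *\<^sub>R F x) x = f x * sdiv F x + grad f x \<bullet> F x"
proof -
  have d: "dfield (\<lambda>x. f x *\<^sub>R F x) x = (\<lambda>h. f x *\<^sub>R dfield F x h + (grad f x \<bullet> h) *\<^sub>R F x)"
    by (rule dfield_eqI[OF has_derivative_scaleR[OF C1c_has_derivative[OF f] C1c_field_has_derivative[OF F]]
        C1c_field_C1[OF C1c_field_scaleR[OF f F]]]) (rule UNIV_I)
  have "lin_trace (\<lambda>h. (grad f x \<bullet> h) *\<^sub>R F x) = grad f x \<bullet> F x"
    by (rule lin_trace_rank_one) (simp add: bounded_linear.linear bounded_linear_inner_right)
  then have "lin_trace (dfield (\<lambda>x. f x *\<^sub>R F x) x) = f x * lin_trace (dfield F x) + grad f x \<bullet> F x"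
    by (simp add: lin_trace_def d inner_add_left sum.distrib sum_distrib_left)
  then show ?thesis by (simp add: sdiv_def d inner_add_left t algebra_simps)
qed

text \<open>Applied to a gradient, this is the traced Gauss formula: the boundary Laplacian is the tangential
trace of the Hessian minus the mean curvature times the normal derivative.\<close>

lemma sdiv_tang:
  assumes Z: "C1c_field Z" and x: "x \<in> M"
  shows "sdiv (tang Z) x = sdiv Z x - (Z x \<bullet> N x) * sdiv N x"
proof -
  note dZ = C1c_field_has_derivative[OF Z, of x]
  define l where "l h = Z x \<bullet> dfield N x h + dfield Z x h \<bullet> N x" for h
  have dl: "((\<lambda>x. Z x \<bullet> N x) has_derivative l) (at x)"
    unfolding l_def[abs_def] by (rule has_derivative_inner[OF dZ N_has_derivative])
  have "(tang Z has_derivative (\<lambda>h. dfield Z x h - ((Z x \<bullet> N x) *\<^sub>R dfield N x h + l h *\<^sub>R N x))) (at x)"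
    unfolding tang_def[abs_def] by (intro has_derivative_diff dZ has_derivative_scaleR dl N_has_derivative)
  then have d: "dfield (tang Z) x = (\<lambda>h. dfield Z x h - ((Z x \<bullet> N x) *\<^sub>R dfield N x h + l h *\<^sub>R N x))"
    using dfield_eqI[OF _ C1c_field_C1[OF C1c_tang[OF Z], of UNIV]] by blast
  have "lin_trace (\<lambda>h. l h *\<^sub>R N x) = l (N x)"
    by (rule lin_trace_rank_one) (rule has_derivative_linear[OF dl])
  then have "lin_trace (dfield (tang Z) x) = lin_trace (dfield Z x) - ((Z x \<bullet> N x) * lin_trace (dfield N x) + l (N x))"
    by (simp add: lin_trace_def d inner_diff_left inner_add_left sum.distrib sum_subtractf sum_distrib_left)
  moreover have "dfield (tang Z) x (N x) \<bullet> N x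
      = dfield Z x (N x) \<bullet> N x - ((Z x \<bullet> N x) * (dfield N x (N x) \<bullet> N x) + l (N x))"
    by (simp add: d inner_diff_left inner_add_left N_unit[OF x])
  ultimately show ?thesis by (simp add: sdiv_def algebra_simps)
qed

lemma tang_N: "x \<in> M \<Longrightarrow> tang Z x \<bullet> N x = 0" by (simp add: tang_P N_P inner_commute[of _ "N x"])

lemma grad_inner_N:
  assumes Z: "C1c_field Z"
  shows "grad (\<lambda>x. Z x \<bullet> N x) x \<bullet> h = Z x \<bullet> dfield N x h + dfield Z x h \<bullet> N x"
proof -
  have "((\<lambda>x. Z x \<bullet> N x) has_derivative (\<lambda>h. Z x \<bullet> dfield N x h + dfield Z x h \<bullet> N x)) (at x)"
    by (rule has_derivative_inner[OF C1c_field_has_derivative[OF Z] N_has_derivative])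
  from has_derivative_unique[OF C1c_has_derivative[OF C1c_field_inner[OF Z N]] this]
  show ?thesis by (rule fun_cong)
qed

text \<open>The boundary Laplacian of \<open>v\<close> is replaced by the tangential trace of \<open>DZ\<close>, and the second fundamental
form by the tangential derivative of \<open>v\<^sub>n = Z \<bullet> N\<close>, which equals \<open>DN Z' \<bullet> Y' + DZ Y' \<bullet> N\<close> in the direction
of the boundary gradient \<open>Y'\<close>. The mean curvature terms cancel. The factor \<open>U\<close> is then moved under
the divergence.\<close>

lemma B2_divergence_form:
  assumes v: "jet_extension X v V Z" and w: "jet_extension X w W Y" and U: "C1c U" and x: "x \<in> M"
  shows "2 * (U x * B2 X v w x) =
     U x * ((Y x \<bullet> N x) * lin_trace (dfield Z x) - dfield Z x (Y x) \<bullet> N x)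
     + sdiv (\<lambda>y. (U y * (Z y \<bullet> N y)) *\<^sub>R tang Y y) x - (Z x \<bullet> N x) * (grad U x \<bullet> tang Y x)"
proof -
  have Z: "C1c_field Z" and Y: "C1c_field Y" using v w by (auto simp: jet_extension_def)
  have ZN: "C1c (\<lambda>y. Z y \<bullet> N y)" by (rule C1c_field_inner[OF Z N])
  let ?q = "grad (\<lambda>x. Z x \<bullet> N x) x \<bullet> tang Y x"
  have g: "grad (\<lambda>y. U y * (Z y \<bullet> N y)) x = U x *\<^sub>R grad (\<lambda>y. Z y \<bullet> N y) x + (Z x \<bullet> N x) *\<^sub>R grad U x"
  proof (rule grad_eqI)
    from has_derivative_mult[OF C1c_has_derivative[OF U] C1c_has_derivative[OF ZN]]
    show "((\<lambda>y. U y * (Z y \<bullet> N y)) has_derivative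
        (\<lambda>h. (U x *\<^sub>R grad (\<lambda>y. Z y \<bullet> N y) x + (Z x \<bullet> N x) *\<^sub>R grad U x) \<bullet> h)) (at x)"
      by (simp add: inner_add_left mult.commute)
  qed
  have e1: "sdiv (\<lambda>y. (U y * (Z y \<bullet> N y)) *\<^sub>R tang Y y) x
      = U x * (Z x \<bullet> N x) * sdiv (tang Y) x + U x * ?q + (Z x \<bullet> N x) * (grad U x \<bullet> tang Y x)"
    using sdiv_scaleR[OF C1c_mult[OF U ZN] C1c_tang[OF Y] tang_N[OF x]]
    by (simp add: g inner_add_left)
  have e2: "?q = dfield N x (tang Z x) \<bullet> tang Y x + dfield Z x (tang Y x) \<bullet> N x"
  proof -
    have YP: "P x (tang Y x) = tang Y x" by (simp add: tang_P P_P[OF x])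
    have "Z x \<bullet> dfield N x (tang Y x) = tang Z x \<bullet> dfield N x (tang Y x)"
      using dN_tangent[OF x, of "tang Y x"] unfolding YP tang_def[of Z]
      by (simp add: inner_diff_left inner_diff_right inner_commute)
    also have "\<dots> = dfield N x (tang Z x) \<bullet> tang Y x"
      using second_fundamental_form_symmetric[OF x, of "tang Y x" "tang Z x"] tang_N[OF x]
      by (simp add: inner_commute)
    finally show ?thesis by (simp add: grad_inner_N[OF Z])
  qed
  have e3: "dfield Z x (Y x) = dfield Z x (tang Y x) + (Y x \<bullet> N x) *\<^sub>R dfield Z x (N x)"
  proof -
    interpret linear "dfield Z x" by (rule has_derivative_linear[OF C1c_field_has_derivative[OF Z]])
    show ?thesis by (simp add: tang_def diff scaleR)
  qed
  show ?thesis
    unfolding e1 e2 e3 mult.left_commute[of 2] B2_jet[OF v w x] sdiv_tang[OF Z x] sdiv_def[of Z]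
    by (simp add: inner_add_left algebra_simps)
qed

lemma B2_symmetric:
  assumes v: "jet_extension X v V Z" and w: "jet_extension X w W Y" and x: "x \<in> M"
  shows "B2 X v w x = B2 X w v x"
proof -
  have "dfield N x (tang Z x) \<bullet> tang Y x = dfield N x (tang Y x) \<bullet> tang Z x"
    by (rule second_fundamental_form_symmetric[OF x]) (simp_all add: inner_commute[of "N x"] tang_N[OF x])
  then show ?thesis using B2_jet[OF v w x] B2_jet[OF w v x] by (simp add: algebra_simps)
qed

end

section \<open>Fubini along a coordinate axis\<close>

lemma measurable_vec_lambda [measurable (raw)]:
  assumes "\<And>i. (\<lambda>x. f x i) \<in> borel_measurable M"
  shows "(\<lambda>x. (\<chi> i. f x i) :: real^'n::finite) \<in> borel_measurable M"
proof (subst borel_measurable_euclidean_space, intro ballI)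
  fix b :: "real^'n" assume "b \<in> Basis"
  then obtain i where "b = axis i 1" by (auto simp: Basis_vec_def)
  then show "(\<lambda>x. (\<chi> i. f x i) \<bullet> b) \<in> borel_measurable M" using assms by (simp add: inner_axis)
qed

lemma prod_Basis_vec: "(\<Prod>b\<in>(Basis :: (real^'n::finite) set). f b) = (\<Prod>i\<in>UNIV. f (axis i 1))"
proof -
  have B: "(Basis :: (real^'n) set) = (\<lambda>i. axis i 1) ` UNIV" by (auto simp: Basis_vec_def)
  show ?thesis unfolding B by (subst prod.reindex) (auto simp: inj_on_def axis_eq_axis)
qed

lemma sum_Basis_vec: "(\<Sum>b\<in>(Basis :: (real^'n::finite) set). f b) = (\<Sum>i\<in>UNIV. f (axis i 1))"
proof -
  have B: "(Basis :: (real^'n) set) = (\<lambda>i. axis i 1) ` UNIV" by (auto simp: Basis_vec_def)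
  show ?thesis unfolding B by (subst sum.reindex) (auto simp: inj_on_def axis_eq_axis)
qed

text \<open>Lebesgue measure in coordinates indexed by the type \<open>'n\<close> instead of the canonical basis.\<close>

lemma lborel_vec:
  "(lborel :: (real^'n::finite) measure) = distr (Pi\<^sub>M UNIV (\<lambda>_. lborel)) borel (\<lambda>f. \<chi> i. f i)"
proof (rule lborel_eqI)
  interpret product_sigma_finite "\<lambda>_::'n. lborel :: real measure" ..
  fix l u :: "real^'n" assume le: "\<And>b. b \<in> Basis \<Longrightarrow> l \<bullet> b \<le> u \<bullet> b"
  have lu: "l $ i \<le> u $ i" for i
    using le[of "axis i 1"] by (simp add: inner_axis axis_in_Basis_iff)
  have "(\<lambda>f. \<chi> i. f i) -` box l u \<inter> space (Pi\<^sub>M UNIV (\<lambda>_::'n. lborel :: real measure))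
      = Pi\<^sub>E UNIV (\<lambda>i. {l $ i <..< u $ i})"
    by (auto simp: mem_box_cart space_PiM PiE_UNIV_domain Pi_iff)
  then have "emeasure (distr (Pi\<^sub>M UNIV (\<lambda>_. lborel)) borel (\<lambda>f. \<chi> i. f i)) (box l u)
      = emeasure (Pi\<^sub>M UNIV (\<lambda>_::'n. lborel)) (Pi\<^sub>E UNIV (\<lambda>i. {l $ i <..< u $ i}))"
    by (subst emeasure_distr) auto
  also have "\<dots> = (\<Prod>i\<in>UNIV. ennreal (u $ i - l $ i))"
    by (subst emeasure_PiM) (auto simp: lu)
  also have "\<dots> = ennreal (\<Prod>b\<in>Basis. (u - l) \<bullet> b)"
    by (simp add: prod_Basis_vec inner_axis lu prod_ennreal)
  finally show "emeasure (distr (Pi\<^sub>M UNIV (\<lambda>_. lborel)) borel (\<lambda>f. \<chi> i. f i)) (box l u)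
      = ennreal (\<Prod>b\<in>Basis. (u - l) \<bullet> b)" .
qed simp

definition hyperplane_embedding :: "'n::finite \<Rightarrow> ('n \<Rightarrow> real) \<Rightarrow> real^'n" where
  "hyperplane_embedding k y = (\<chi> i. if i = k then 0 else y i)"

lemma hyperplane_embedding_measurable [measurable]:
  "hyperplane_embedding k \<in> Pi\<^sub>M (UNIV - {k}) (\<lambda>_. lborel) \<rightarrow>\<^sub>M borel"
  unfolding hyperplane_embedding_def
proof (rule measurable_vec_lambda)
  fix i
  show "(\<lambda>y. if i = k then 0 else y i) \<in> borel_measurable (Pi\<^sub>M (UNIV - {k}) (\<lambda>_. lborel :: real measure))"
    by (cases "i = k") (auto intro: measurable_component_singleton[of i "UNIV - {k}" "\<lambda>_. lborel", simplified])
qed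

lemma hyperplane_lborel_eq:
  "hyperplane_lborel k = distr (Pi\<^sub>M (UNIV - {k}) (\<lambda>_. lborel)) borel (hyperplane_embedding k)"
  unfolding hyperplane_lborel_def hyperplane_embedding_def[abs_def] ..

lemma sets_hyperplane_lborel [simp, measurable_cong]: "sets (hyperplane_lborel k) = sets borel"
  by (simp add: hyperplane_lborel_def)

lemma space_hyperplane_lborel [simp]: "space (hyperplane_lborel k) = UNIV"
  by (simp add: hyperplane_lborel_def)

text \<open>The measure lives on the whole space but is carried by the hyperplane, so integrands matter only for
\<open>y $ k = 0\<close>.\<close>

lemma AE_hyperplane_lborel: "AE y in hyperplane_lborel k. y $ k = 0"
  unfolding hyperplane_lborel_eq
  by (subst AE_distr_iff) (auto simp: hyperplane_embedding_def)

lemma integral_hyperplane_cong: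
  fixes f g :: "real^'n::finite \<Rightarrow> real"
  assumes "f \<in> borel_measurable borel" "g \<in> borel_measurable borel"
    and eq: "\<And>y. y $ k = 0 \<Longrightarrow> f y = g y"
  shows "(\<integral>y. f y \<partial>hyperplane_lborel k) = (\<integral>y. g y \<partial>hyperplane_lborel k)"
  using AE_hyperplane_lborel[of k] assms(1,2) by (intro integral_cong_AE) (auto elim!: AE_mp simp: eq)

lemma measurable_line_integral:
  fixes f :: "real^'n::finite \<Rightarrow> real"
  assumes [measurable]: "f \<in> borel_measurable borel"
  shows "(\<lambda>y. \<integral>t. f (y + t *\<^sub>R a) \<partial>lborel) \<in> borel_measurable borel"
  by measurable

lemma integral_split_coordinate:
  fixes f :: "real^'n::finite \<Rightarrow> real"
  assumes f: "integrable lborel f"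
  shows "(\<integral>x. f x \<partial>lborel) = (\<integral>y. (\<integral>t. f (y + t *\<^sub>R axis k 1) \<partial>lborel) \<partial>hyperplane_lborel k)"
proof -
  interpret product_sigma_finite "\<lambda>_::'n. lborel :: real measure" ..
  have [measurable]: "f \<in> borel_measurable borel" using borel_measurable_integrable[OF f] by simp
  have ins: "insert k (UNIV - {k}) = (UNIV :: 'n set)" by auto
  have "(\<integral>x. f x \<partial>lborel) = (\<integral>g. f (\<chi> i. g i) \<partial>Pi\<^sub>M UNIV (\<lambda>_. lborel))"
    by (subst lborel_vec) (simp add: integral_distr)
  also have "\<dots> = (\<integral>x. (\<integral>t. f (\<chi> i. (x(k := t)) i) \<partial>lborel) \<partial>Pi\<^sub>M (UNIV - {k}) (\<lambda>_. lborel))"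
  proof -
    have "integrable (distr (Pi\<^sub>M UNIV (\<lambda>_::'n. lborel)) borel (\<lambda>f. \<chi> i. f i)) f"
      using f by (subst (asm) lborel_vec)
    then have "integrable (Pi\<^sub>M (insert k (UNIV - {k})) (\<lambda>_. lborel)) (\<lambda>g. f (\<chi> i. g i))"
      unfolding ins by (subst (asm) integrable_distr_eq) auto
    from product_integral_insert[OF _ _ this] show ?thesis by (simp add: ins)
  qed
  also have "\<dots> = (\<integral>x. (\<integral>t. f (hyperplane_embedding k x + t *\<^sub>R axis k 1) \<partial>lborel) \<partial>Pi\<^sub>M (UNIV - {k}) (\<lambda>_. lborel))"
  proof -
    have "(\<chi> i. (x(k := t)) i) = hyperplane_embedding k x + t *\<^sub>R axis k 1" for x t
      by (auto simp: vec_eq_iff hyperplane_embedding_def axis_def)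
    then show ?thesis by simp
  qed
  also have "\<dots> = (\<integral>y. (\<integral>t. f (y + t *\<^sub>R axis k 1) \<partial>lborel) \<partial>hyperplane_lborel k)"
    unfolding hyperplane_lborel_eq by (subst integral_distr) (auto intro: measurable_line_integral)
  finally show ?thesis .
qed

text \<open>On each line parallel to the \<open>k\<close>-axis the shear is a translation.\<close>

lemma integral_shear:
  fixes f :: "real^'n::finite \<Rightarrow> real"
  assumes f: "integrable lborel f" and fs: "integrable lborel (\<lambda>x. f (x + \<gamma> x *\<^sub>R axis k 1))"
    and \<gamma>: "\<And>x t. \<gamma> (x + t *\<^sub>R axis k 1) = \<gamma> x"
  shows "(\<integral>x. f (x + \<gamma> x *\<^sub>R axis k 1) \<partial>lborel) = (\<integral>x. f x \<partial>lborel)"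
proof -
  have "(\<integral>t. f (y + t *\<^sub>R axis k 1 + \<gamma> (y + t *\<^sub>R axis k 1) *\<^sub>R axis k 1) \<partial>lborel)
      = (\<integral>t. f (y + t *\<^sub>R axis k 1) \<partial>lborel)" for y
    using lborel_integral_real_affine[of 1 "\<lambda>t. f (y + t *\<^sub>R axis k 1)" "\<gamma> y"]
    by (simp add: \<gamma> algebra_simps)
  then show ?thesis
    unfolding integral_split_coordinate[OF f, of k] integral_split_coordinate[OF fs, of k] by simp
qed

lemma integrable_compact_support:
  fixes g :: "real^'n::finite \<Rightarrow> real"
  assumes "continuous_on UNIV g" "\<And>x. R < norm x \<Longrightarrow> g x = 0"
  shows "integrable lborel g"
proof -
  have "integrable lborel (\<lambda>x. indicator (cball 0 R) x *\<^sub>R g x)"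
    using borel_integrable_compact[of "cball 0 R" g] continuous_on_subset[OF assms(1)]
    by (simp add: integrable_restrict_UNIV[symmetric])
  moreover have "(\<lambda>x. indicator (cball 0 R) x *\<^sub>R g x) = g"
    using assms(2) by (auto simp: indicator_def fun_eq_iff)
  ultimately show ?thesis by metis
qed

lemma integral_line_derivative:
  fixes g g' :: "real \<Rightarrow> real"
  assumes d: "\<And>t. (g has_real_derivative g' t) (at t)" and c: "continuous_on UNIV g'"
    and R: "\<And>t. R < \<bar>t\<bar> \<Longrightarrow> g t = 0" "\<And>t. R < \<bar>t\<bar> \<Longrightarrow> g' t = 0"
  shows "(\<integral>t. indicator {..<0} t * g' t \<partial>lborel) = g 0"
    and "(\<integral>t. indicator {0<..} t * g' t \<partial>lborel) = - g 0"
    and "(\<integral>t. g' t \<partial>lborel) = 0"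
proof -
  define r where "r = \<bar>R\<bar> + 1"
  have r: "r > 0" "R < r" by (auto simp: r_def)
  have ftc: "(\<integral>t. g' t * indicator {a..b} t \<partial>lborel) = g b - g a" if "a \<le> b" for a b
    by (rule integral_FTC_Icc_real[OF that d]) (use c in \<open>auto simp: continuous_on_eq_continuous_at\<close>)
  have [measurable]: "g' \<in> borel_measurable borel" using c by (rule borel_measurable_continuous_onI)
  have ne: "AE t in lborel. t \<noteq> (0::real)" by (rule AE_lborel_singleton)
  have far: "g' t = 0" if "\<not> \<bar>t\<bar> \<le> r" for t using R(2)[of t] that r by auto
  have ae: "AE t in lborel. indicator {..<0} t * g' t = g' t * indicator {-r..0} t"
    "AE t in lborel. indicator {0<..} t * g' t = g' t * indicator {0..r} t"
    using ne by (eventually_elim, use far in \<open>force simp: indicator_def\<close>)+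
  have "(\<integral>t. indicator {..<0} t * g' t \<partial>lborel) = (\<integral>t. g' t * indicator {-r..0} t \<partial>lborel)"
    by (rule integral_cong_AE) (use ae in auto)
  then show "(\<integral>t. indicator {..<0} t * g' t \<partial>lborel) = g 0"
    using ftc[of "-r" 0] r R(1)[of "-r"] by simp
  have "(\<integral>t. indicator {0<..} t * g' t \<partial>lborel) = (\<integral>t. g' t * indicator {0..r} t \<partial>lborel)"
    by (rule integral_cong_AE) (use ae in auto)
  then show "(\<integral>t. indicator {0<..} t * g' t \<partial>lborel) = - g 0"
    using ftc[of 0 r] r R(1)[of r] by simp
  have "(\<integral>t. g' t \<partial>lborel) = (\<integral>t. g' t * indicator {-r..r} t \<partial>lborel)"
    by (rule Bochner_Integration.integral_cong) (auto intro!: R(2) simp: indicator_def r_def)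
  then show "(\<integral>t. g' t \<partial>lborel) = 0"
    using ftc[of "-r" r] r R(1)[of r] R(1)[of "-r"] by simp
qed

lemma borel_measurable_grad:
  "C1_on UNIV f \<Longrightarrow> (\<lambda>x. grad f x $ i) \<in> borel_measurable borel"
  using C1_on_grad by (intro borel_measurable_continuous_onI continuous_intros)

lemma C1c_measurable: "C1c f \<Longrightarrow> f \<in> borel_measurable borel"
  using C1_on_continuous_on C1c_C1_on by (intro borel_measurable_continuous_onI) blast

lemma C1c_grad_integrable:
  assumes "C1c f" shows "integrable lborel (\<lambda>x. grad f x $ i)"
proof -
  obtain R where R: "\<And>x. R < norm x \<Longrightarrow> f x = 0" using assms by (auto simp: C1c_def)
  show ?thesis
    by (rule integrable_compact_support[of _ R])
       (use C1_on_grad[OF C1c_C1_on[OF assms]] grad_outside_support[of R f] R in \<open>auto intro: continuous_intros\<close>)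
qed

lemma integrable_indicator_mult:
  fixes f :: "real^'n::finite \<Rightarrow> real"
  assumes "integrable lborel f" "A \<in> sets borel" shows "integrable lborel (\<lambda>x. indicator A x * f x)"
  using integrable_mult_indicator[of A lborel f] assms by simp

lemma line_integral_grad:
  fixes \<psi> :: "real^'n::finite \<Rightarrow> real"
  assumes \<psi>: "C1c \<psi>"
  shows "(\<integral>t. indicator {..<0} t * grad \<psi> (y + t *\<^sub>R axis j 1) $ j \<partial>lborel) = \<psi> y" (is ?A)
    and "(\<integral>t. indicator {0<..} t * grad \<psi> (y + t *\<^sub>R axis j 1) $ j \<partial>lborel) = - \<psi> y" (is ?B)
    and "(\<integral>t. grad \<psi> (y + t *\<^sub>R axis j 1) $ j \<partial>lborel) = 0" (is ?C)
proof -
  obtain R where R: "\<And>x. R < norm x \<Longrightarrow> \<psi> x = 0" using \<psi> by (auto simp: C1c_def)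
  have C: "C1_on UNIV \<psi>" using C1c_C1_on[OF \<psi>] .
  have d: "((\<lambda>t. \<psi> (y + t *\<^sub>R axis j 1)) has_real_derivative grad \<psi> (y + t *\<^sub>R axis j 1) $ j) (at t)" for t
    using has_real_derivative_line[OF C1c_has_derivative[OF \<psi>, of "y + t *\<^sub>R axis j 1"]]
    by (simp add: inner_axis)
  have c: "continuous_on UNIV (\<lambda>t. grad \<psi> (y + t *\<^sub>R axis j 1) $ j)"
    by (intro continuous_intros continuous_on_compose2[OF C1_on_grad[OF C]]) auto
  have far: "R < norm (y + t *\<^sub>R axis j 1)" if "R + norm y < \<bar>t\<bar>" for t
  proof -
    have "norm (t *\<^sub>R axis j (1::real)) \<le> norm (y + t *\<^sub>R axis j 1) + norm y"
      using norm_triangle_ineq4[of "y + t *\<^sub>R axis j 1" y] by simp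
    then show ?thesis using that by simp
  qed
  have r: "\<psi> (y + t *\<^sub>R axis j 1) = 0" "grad \<psi> (y + t *\<^sub>R axis j 1) $ j = 0"
    if "R + norm y < \<bar>t\<bar>" for t
    using R[OF far[OF that]] grad_outside_support[OF R far[OF that]] by auto
  show ?A ?B ?C
    using integral_line_derivative[OF d c r] by simp_all
qed

lemma integral_grad_eq_0:
  fixes \<psi> :: "real^'n::finite \<Rightarrow> real"
  assumes \<psi>: "C1c \<psi>"
  shows "(\<integral>x. grad \<psi> x $ i \<partial>lborel) = 0"
  using integral_split_coordinate[OF C1c_grad_integrable[OF \<psi>, of i], of i] line_integral_grad(3)[OF \<psi>]
  by simp

text \<open>Fubini in the \<open>i\<close>-th direction. Lines parallel to the boundary hyperplane contribute nothing, lines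
transversal to it end there.\<close>

lemma half_space_divergence:
  fixes \<psi> :: "real^'n::finite \<Rightarrow> real"
  assumes \<psi>: "C1c \<psi>" and s: "s \<in> {-1, 1::real}"
  shows "(\<integral>x. indicator {x. s * x $ k < 0} x * grad \<psi> x $ i \<partial>lborel)
       = (if i = k then s * (\<integral>y. \<psi> y \<partial>hyperplane_lborel k) else 0)"
proof -
  have C: "C1_on UNIV \<psi>" using C1c_C1_on[OF \<psi>] .
  have "open {x :: real^'n. s * x $ k < 0}" by (intro open_Collect_less continuous_intros)
  then have S[measurable]: "{x :: real^'n. s * x $ k < 0} \<in> sets borel" by simp
  note [measurable] = borel_measurable_grad[OF C] C1c_measurable[OF \<psi>]
  note int = integrable_indicator_mult[OF C1c_grad_integrable[OF \<psi>] S, of i]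
  note line = line_integral_grad[OF \<psi>]
  show ?thesis
  proof (cases "i = k")
    case True
    have "(\<integral>x. indicator {x. s * x $ k < 0} x * grad \<psi> x $ i \<partial>lborel)
      = (\<integral>y. (\<integral>t. indicator {x. s * x $ k < 0} (y + t *\<^sub>R axis k 1) * grad \<psi> (y + t *\<^sub>R axis k 1) $ i \<partial>lborel)
          \<partial>hyperplane_lborel k)"
      by (rule integral_split_coordinate[OF int])
    also have "\<dots> = (\<integral>y. s * \<psi> y \<partial>hyperplane_lborel k)"
    proof (rule integral_hyperplane_cong)
      show "(\<lambda>y. \<integral>t. indicator {x. s * x $ k < 0} (y + t *\<^sub>R axis k 1) * grad \<psi> (y + t *\<^sub>R axis k 1) $ i \<partial>lborel)
          \<in> borel_measurable borel"
        by (rule measurable_line_integral) measurable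
      fix y :: "real^'n" assume y: "y $ k = 0"
      consider "s = 1" | "s = -1" using s by auto
      then show "(\<integral>t. indicator {x. s * x $ k < 0} (y + t *\<^sub>R axis k 1) * grad \<psi> (y + t *\<^sub>R axis k 1) $ i \<partial>lborel)
          = s * \<psi> y"
      proof cases
        case 1
        have "indicator {x. s * x $ k < 0} (y + t *\<^sub>R axis k 1) = (indicator {..<0} t :: real)" for t
          using y 1 by (simp add: indicator_def)
        then show ?thesis using line(1)[of y k] True 1 by simp
      next
        case 2
        have "indicator {x. s * x $ k < 0} (y + t *\<^sub>R axis k 1) = (indicator {0<..} t :: real)" for t
          using y 2 by (simp add: indicator_def)
        then show ?thesis using line(2)[of y k] True 2 by simp
      qed
    qed measurable
    finally show ?thesis using True by simp
  next
    case False
    have "(\<integral>x. indicator {x. s * x $ k < 0} x * grad \<psi> x $ i \<partial>lborel)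
      = (\<integral>y. (\<integral>t. indicator {x. s * x $ k < 0} (y + t *\<^sub>R axis i 1) * grad \<psi> (y + t *\<^sub>R axis i 1) $ i \<partial>lborel)
          \<partial>hyperplane_lborel i)"
      by (rule integral_split_coordinate[OF int])
    moreover have "indicator {x. s * x $ k < 0} (y + t *\<^sub>R axis i 1) = (indicator {x. s * x $ k < 0} y :: real)" for y t
      using False by (simp add: indicator_def axis_def)
    ultimately show ?thesis using line(3)[of _ i] False by simp
  qed
qed

section \<open>The divergence theorem and the surface measure in a chart\<close>

lemma grad_eq_0_outside_compact:
  assumes "compact C" "\<And>x. x \<notin> C \<Longrightarrow> f x = 0" "x \<notin> C"
  shows "grad f x = 0"
proof (rule grad_eqI)
  have o: "open (- C)" using assms(1) by (simp add: compact_imp_closed open_Compl)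
  have "((\<lambda>x. 0) has_derivative (\<lambda>h. 0)) (at x)" by simp
  then show "(f has_derivative (\<lambda>h. 0 \<bullet> h)) (at x)"
    using has_derivative_transform_within_open[OF _ o, of "\<lambda>x. 0" "\<lambda>h. 0" x UNIV f] assms by auto
qed

context boundary_chart
begin

lemma grad_\<gamma>_shift: "grad \<gamma> (x + t *\<^sub>R axis k 1) = grad \<gamma> x"
proof -
  have l: "((\<lambda>y. y + t *\<^sub>R axis k 1) has_derivative (\<lambda>h. h)) (at x)"
    by (auto intro!: derivative_eq_intros)
  have "((\<lambda>y. \<gamma> (y + t *\<^sub>R axis k 1)) has_derivative (\<lambda>h. grad \<gamma> (x + t *\<^sub>R axis k 1) \<bullet> h)) (at x)"
    by (rule has_derivative_compose[OF l C1_on_has_derivative[OF C1_\<gamma>[of UNIV]]]) simp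
  then have "(\<gamma> has_derivative (\<lambda>h. grad \<gamma> (x + t *\<^sub>R axis k 1) \<bullet> h)) (at x)" by simp
  from grad_eqI[OF this] show ?thesis by simp
qed

lemma d\<rho>_shear: "d\<rho> (shear x) = d\<rho> x"
  by (simp add: d\<rho>_def shear_def grad_\<gamma>_shift)

lemma shear_measurable [measurable]: "shear \<in> borel_measurable borel"
  by (intro borel_measurable_continuous_onI C1_field_continuous_on C1_shear)

lemma d\<rho>_measurable [measurable]: "d\<rho> \<in> borel_measurable borel"
  by (intro borel_measurable_continuous_onI C1_field_continuous_on C1_d\<rho>)

lemma C1c_shear:
  assumes "C1c \<phi>" shows "C1c (\<lambda>x. \<phi> (shear x))"
  unfolding C1c_def
proof
  show "C1_on UNIV (\<lambda>x. \<phi> (shear x))"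
    by (rule C1_on_compose[OF C1c_C1_on[OF assms, of UNIV] C1_shear]) simp
  obtain R where R: "\<And>x. R < norm x \<Longrightarrow> \<phi> x = 0" using assms by (auto simp: C1c_def)
  have "bounded (unshear ` cball 0 R)"
    by (intro compact_imp_bounded compact_continuous_image C1_field_continuous_on C1_unshear) simp
  then obtain R' where R': "\<And>y. y \<in> unshear ` cball 0 R \<Longrightarrow> norm y \<le> R'" using bounded_iff by metis
  have "\<phi> (shear x) = 0" if "R' < norm x" for x
  proof (rule R, rule ccontr)
    assume "\<not> R < norm (shear x)"
    then have "unshear (shear x) \<in> unshear ` cball 0 R" by (intro imageI) simp
    then show False using R'[of x] that by simp
  qed
  then show "\<exists>R. \<forall>x. R < norm x \<longrightarrow> \<phi> (shear x) = 0" by blast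
qed

lemma grad_shear:
  assumes "C1c \<phi>"
  shows "grad (\<lambda>x. \<phi> (shear x)) x = grad \<phi> (shear x) + (grad \<phi> (shear x) $ k) *\<^sub>R grad \<gamma> x"
proof (rule grad_eqI)
  show "((\<lambda>x. \<phi> (shear x)) has_derivative
      (\<lambda>h. (grad \<phi> (shear x) + (grad \<phi> (shear x) $ k) *\<^sub>R grad \<gamma> x) \<bullet> h)) (at x)"
    using has_derivative_compose[OF shear_deriv C1c_has_derivative[OF assms]]
    by (simp add: inner_add_left inner_add_right inner_axis mult.commute)
qed

text \<open>With \<open>\<psi> = \<phi> \<circ> shear\<close> one has \<open>(\<partial>\<^sub>i \<phi>) \<circ> shear = \<partial>\<^sub>i \<psi> - \<partial>\<^sub>i \<gamma> \<partial>\<^sub>k \<psi>\<close>. Since \<open>\<partial>\<^sub>i \<gamma>\<close> does not depend on the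
\<open>k\<close>-th coordinate, the last term is \<open>\<partial>\<^sub>k (\<psi> \<partial>\<^sub>i \<gamma>)\<close>, and the half space case applies to both terms.\<close>

lemma divergence_in_chart:
  assumes \<phi>: "C1c \<phi>" and C: "compact C" "C \<subseteq> V" "\<And>x. x \<notin> C \<Longrightarrow> \<phi> x = 0"
  shows "(\<integral>x. indicator X x * grad \<phi> x $ i \<partial>lborel) = (\<integral>y. \<phi> (shear y) * d\<rho> y $ i \<partial>hyperplane_lborel k)"
proof -
  define \<psi> where "\<psi> x = \<phi> (shear x)" for x
  have \<psi>: "C1c \<psi>" unfolding \<psi>_def[abs_def] by (rule C1c_shear[OF \<phi>])
  define g where "g x = grad \<gamma> x $ i" for x
  have Cg: "C1_on UNIV g" using C1_grad_\<gamma>[of UNIV] unfolding C1_field_def g_def[abs_def] by blast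
  have gs: "g (x + t *\<^sub>R axis k 1) = g x" for x t by (simp add: g_def grad_\<gamma>_shift)
  have g\<psi>: "C1c (\<lambda>x. \<psi> x * g x)" by (rule C1c_mult_left[OF \<psi> Cg])
  have dgk: "grad g x $ k = 0" for x
  proof -
    have "((\<lambda>t. g (x + t *\<^sub>R axis k 1)) has_real_derivative grad g (x + 0 *\<^sub>R axis k 1) \<bullet> axis k 1) (at 0)"
      by (rule has_real_derivative_line[OF C1_on_has_derivative[OF Cg]]) simp
    moreover have "((\<lambda>t. g (x + t *\<^sub>R axis k 1)) has_real_derivative 0) (at 0)" by (simp add: gs)
    ultimately have "grad g (x + 0 *\<^sub>R axis k 1) \<bullet> axis k 1 = 0" by (rule DERIV_unique)
    then show ?thesis by (simp add: inner_axis)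
  qed
  have dg\<psi>: "grad (\<lambda>x. \<psi> x * g x) x $ k = g x * grad \<psi> x $ k" for x
  proof -
    have "((\<lambda>x. \<psi> x * g x) has_derivative (\<lambda>h. (\<psi> x *\<^sub>R grad g x + g x *\<^sub>R grad \<psi> x) \<bullet> h)) (at x)"
      using has_derivative_mult[OF C1c_has_derivative[OF \<psi>] C1_on_has_derivative[OF Cg UNIV_I], of x]
      by (simp add: inner_add_left mult.commute)
    from grad_eqI[OF this] show ?thesis by (simp add: dgk)
  qed
  have d\<phi>: "grad \<phi> (shear x) $ i = grad \<psi> x $ i - grad (\<lambda>x. \<psi> x * g x) x $ k" for x
  proof -
    have "grad \<psi> x = grad \<phi> (shear x) + (grad \<phi> (shear x) $ k) *\<^sub>R grad \<gamma> x"
      unfolding \<psi>_def[abs_def] by (rule grad_shear[OF \<phi>])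
    then show ?thesis by (simp add: dg\<psi> g_def[of x])
  qed
  have open_half: "open {x :: real^'n. s * x $ k < 0}" by (intro open_Collect_less continuous_intros)
  then have H: "{x :: real^'n. s * x $ k < 0} \<in> sets borel" by simp
  have X: "X \<in> sets borel" using openX by simp
  define f where "f x = indicator X x * grad \<phi> x $ i" for x
  have f: "integrable lborel f" unfolding f_def by (rule integrable_indicator_mult[OF C1c_grad_integrable[OF \<phi>] X])
  have fs: "f (shear x) = indicator {x. s * x $ k < 0} x * grad \<psi> x $ i
      - indicator {x. s * x $ k < 0} x * grad (\<lambda>x. \<psi> x * g x) x $ k" for x
  proof -
    have "f (shear x) = indicator {x. s * x $ k < 0} x * grad \<phi> (shear x) $ i"
    proof (cases "shear x \<in> C")
      case True
      then have "shear x \<in> V" using C(2) by blast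
      then show ?thesis using in_X_iff[of "shear x"] by (simp add: f_def \<rho>_shear indicator_def)
    next
      case False
      then show ?thesis using grad_eq_0_outside_compact[OF C(1,3) False] by (simp add: f_def)
    qed
    then show ?thesis by (simp add: d\<phi> right_diff_distrib)
  qed
  have i1: "integrable lborel (\<lambda>x. indicator {x. s * x $ k < 0} x * grad \<psi> x $ i)"
    by (rule integrable_indicator_mult[OF C1c_grad_integrable[OF \<psi>] H])
  have i2: "integrable lborel (\<lambda>x. indicator {x. s * x $ k < 0} x * grad (\<lambda>x. \<psi> x * g x) x $ k)"
    by (rule integrable_indicator_mult[OF C1c_grad_integrable[OF g\<psi>] H])
  have "(\<integral>x. f x \<partial>lborel) = (\<integral>x. f (x + \<gamma> x *\<^sub>R axis k 1) \<partial>lborel)"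
    by (rule integral_shear[symmetric, OF f]) (use i1 i2 in \<open>auto simp: shear_def[symmetric] fs\<close>)
  also have "\<dots> = (\<integral>x. indicator {x. s * x $ k < 0} x * grad \<psi> x $ i \<partial>lborel)
      - (\<integral>x. indicator {x. s * x $ k < 0} x * grad (\<lambda>x. \<psi> x * g x) x $ k \<partial>lborel)"
    unfolding shear_def[symmetric] fs by (rule Bochner_Integration.integral_diff[OF i1 i2])
  also have "\<dots> = (if i = k then s * (\<integral>y. \<psi> y \<partial>hyperplane_lborel k) else 0)
      - s * (\<integral>y. \<psi> y * g y \<partial>hyperplane_lborel k)"
    using half_space_divergence[OF \<psi> s, of k i] half_space_divergence[OF g\<psi> s, of k k] by simp
  also have "\<dots> = (\<integral>y. \<psi> y * d\<rho> y $ i \<partial>hyperplane_lborel k)"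
  proof (cases "i = k")
    case True
    then have "g y = 0" for y by (simp add: g_def)
    then show ?thesis using True by (simp add: d\<rho>_def mult.commute[of _ s])
  next
    case False
    have "\<psi> y * d\<rho> y $ i = - s * (\<psi> y * g y)" for y using False by (simp add: d\<rho>_def g_def axis_def)
    then show ?thesis using False by simp
  qed
  finally show ?thesis by (simp add: f_def \<psi>_def)
qed

lemma graph_map_eq: "graph_map k \<gamma> y = y + (- (s * \<rho> y)) *\<^sub>R axis k 1"
  by (auto simp: graph_map_def vec_eq_iff axis_def \<rho>_def mult.assoc[symmetric])

lemma graph_map_shear: "y $ k = 0 \<Longrightarrow> graph_map k \<gamma> y = shear y"
  by (auto simp: graph_map_def shear_def vec_eq_iff axis_def)

lemma graph_map_measurable [measurable]: "graph_map k \<gamma> \<in> borel_measurable borel"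
  unfolding graph_map_eq[abs_def]
  by (intro borel_measurable_continuous_onI continuous_intros \<rho>_cont)

lemma graph_map_in: "graph_map k \<gamma> y \<in> V \<Longrightarrow> graph_map k \<gamma> y \<in> frontier X"
proof -
  have "\<rho> (graph_map k \<gamma> y) = \<rho> y - (s * s) * \<rho> y" unfolding graph_map_eq \<rho>_shift by (simp add: algebra_simps)
  then show "graph_map k \<gamma> y \<in> V \<Longrightarrow> graph_map k \<gamma> y \<in> frontier X" by (simp add: in_frontier_iff)
qed

text \<open>On the chart the surface measure agrees with the image of a weighted hyperplane measure under the
graph map. Its density \<open>norm (d\<rho> y)\<close> is what turns \<open>\<nu>\<close> into the vector \<open>d\<rho>\<close> in
\<open>divergence_in_chart\<close>.\<close>

lemma surface_integral_in_chart:
  fixes f :: "real^'n \<Rightarrow> real"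
  assumes \<mu>: "induced_volume_measure (frontier X) \<mu>" and f[measurable]: "f \<in> borel_measurable borel"
    and z: "\<And>x. x \<notin> V \<Longrightarrow> f x = 0"
  shows "(\<integral>x. indicator (frontier X) x * f x \<partial>\<mu>) = (\<integral>y. f (shear y) * norm (d\<rho> y) \<partial>hyperplane_lborel k)"
proof -
  let ?A = "frontier X \<inter> V"
  define D where "D = distr (density (hyperplane_lborel k) (\<lambda>y. ennreal (norm (d\<rho> y)))) borel (graph_map k \<gamma>)"
  have [measurable]: "frontier X \<in> sets borel" "V \<in> sets borel" using openV by auto
  have sets\<mu>: "sets \<mu> = sets borel" using \<mu> by (simp add: induced_volume_measure_def)
  have space\<mu>: "space \<mu> = UNIV" using sets_eq_imp_space_eq[OF sets\<mu>] by simp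
  have [measurable]: "graph_map k \<gamma> \<in> density (hyperplane_lborel k) (\<lambda>y. ennreal (norm (d\<rho> y))) \<rightarrow>\<^sub>M borel"
    by (simp add: measurable_def) (use graph_map_measurable in \<open>auto simp: measurable_def\<close>)
  have em: "emeasure \<mu> B = emeasure D B" if B: "B \<in> sets borel" "B \<subseteq> ?A" for B
  proof -
    have "emeasure \<mu> B = (\<integral>\<^sup>+ y. indicator B (graph_map k \<gamma> y) * ennreal (norm (d\<rho> y)) \<partial>hyperplane_lborel k)"
      using \<mu> graph openV frontier_chart B unfolding induced_volume_measure_def norm_d\<rho> by blast
    also have "\<dots> = emeasure D B"
    proof -
      have [measurable]: "graph_map k \<gamma> -` B \<in> sets borel"
        using measurable_sets[OF graph_map_measurable B(1)] by simp
      show ?thesis using B(1)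
        by (simp add: D_def emeasure_distr emeasure_density indicator_def vimage_def mult.commute
            cong: nn_integral_cong)
    qed
    finally show ?thesis .
  qed
  have A: "?A \<in> sets borel" by measurable
  have "restrict_space \<mu> ?A = restrict_space D ?A"
  proof (rule measure_eqI)
    show "sets (restrict_space \<mu> ?A) = sets (restrict_space D ?A)"
      by (simp add: sets_restrict_space sets\<mu> D_def)
    fix B assume "B \<in> sets (restrict_space \<mu> ?A)"
    then have B: "B \<in> sets borel" "B \<subseteq> ?A"
      using A by (auto simp: sets_restrict_space_iff sets\<mu> space\<mu>)
    then show "emeasure (restrict_space \<mu> ?A) B = emeasure (restrict_space D ?A) B"
      using A em[OF B] by (subst (1 2) emeasure_restrict_space) (auto simp: sets\<mu> space\<mu> D_def)
  qed
  then have "(\<integral>x. indicator ?A x *\<^sub>R f x \<partial>\<mu>) = (\<integral>x. indicator ?A x *\<^sub>R f x \<partial>D)"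
    using integral_restrict_space[of ?A \<mu> f] integral_restrict_space[of ?A D f] A
    by (simp add: sets\<mu> space\<mu> D_def)
  also have "\<dots> = (\<integral>y. indicator ?A (graph_map k \<gamma> y) *\<^sub>R f (graph_map k \<gamma> y)
      \<partial>density (hyperplane_lborel k) (\<lambda>y. ennreal (norm (d\<rho> y))))"
    unfolding D_def by (rule integral_distr) measurable
  also have "\<dots> = (\<integral>y. norm (d\<rho> y) *\<^sub>R (indicator ?A (graph_map k \<gamma> y) *\<^sub>R f (graph_map k \<gamma> y)) \<partial>hyperplane_lborel k)"
    by (rule integral_density) auto
  also have "\<dots> = (\<integral>y. f (shear y) * norm (d\<rho> y) \<partial>hyperplane_lborel k)"
  proof (rule integral_hyperplane_cong)
    fix y :: "real^'n" assume "y $ k = 0"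
    then have "graph_map k \<gamma> y = shear y" by (rule graph_map_shear)
    then show "norm (d\<rho> y) *\<^sub>R (indicator ?A (graph_map k \<gamma> y) *\<^sub>R f (graph_map k \<gamma> y)) = f (shear y) * norm (d\<rho> y)"
      using graph_map_in[of y] z[of "shear y"] by (auto simp: indicator_def)
  qed measurable
  also have "(\<integral>x. indicator ?A x *\<^sub>R f x \<partial>\<mu>) = (\<integral>x. indicator (frontier X) x * f x \<partial>\<mu>)"
    by (rule Bochner_Integration.integral_cong) (auto simp: indicator_def z)
  finally show ?thesis .
qed

text \<open>Near \<open>p\<close> the graph lies over a bounded part of the hyperplane, on which the density is bounded.\<close>

lemma finite_measure_near:
  assumes \<mu>: "induced_volume_measure (frontier X) \<mu>" and p: "p \<in> V"
  shows "\<exists>U. open U \<and> p \<in> U \<and> emeasure \<mu> (frontier X \<inter> U) < \<infinity>"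
proof -
  obtain r where r: "r > 0" "ball p r \<subseteq> V" using openV p open_contains_ball by blast
  let ?B = "frontier X \<inter> ball p r"
  define R where "R = norm p + r"
  have R: "R > 0" unfolding R_def using r(1) by (simp add: add_nonneg_pos)
  define Q where "Q = {y :: real^'n. \<forall>i. \<bar>y $ i\<bar> \<le> R}"
  have Qc: "compact Q"
  proof -
    have "Q = cbox (\<chi> i. - R) (\<chi> i. R)" by (auto simp: Q_def mem_box_cart abs_le_iff minus_le_iff)
    then show ?thesis by simp
  qed
  have Q[measurable]: "Q \<in> sets borel" using Qc by (simp add: compact_imp_closed)
  have "compact ((\<lambda>y. norm (d\<rho> y)) ` Q)"
    by (intro compact_continuous_image Qc continuous_intros C1_field_continuous_on C1_d\<rho>)
  then obtain c where "\<forall>z\<in>(\<lambda>y. norm (d\<rho> y)) ` Q. norm z \<le> c" using compact_imp_bounded bounded_iff by blast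
  then have c: "norm (d\<rho> y) \<le> c" if "y \<in> Q" for y using that by auto
  have "?B \<in> sets borel" by auto
  moreover have "?B \<subseteq> frontier X \<inter> V" using r(2) by auto
  ultimately have "emeasure \<mu> ?B = (\<integral>\<^sup>+ y. indicator ?B (graph_map k \<gamma> y) * ennreal (norm (d\<rho> y)) \<partial>hyperplane_lborel k)"
    using \<mu> graph openV frontier_chart unfolding induced_volume_measure_def norm_d\<rho> by blast
  also have "\<dots> \<le> (\<integral>\<^sup>+ y. ennreal c * indicator Q y \<partial>hyperplane_lborel k)"
  proof (rule nn_integral_mono_AE, use AE_hyperplane_lborel[of k] in eventually_elim)
    fix y :: "real^'n" assume y: "y $ k = 0"
    show "indicator ?B (graph_map k \<gamma> y) * ennreal (norm (d\<rho> y)) \<le> ennreal c * indicator Q y"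
    proof (cases "graph_map k \<gamma> y \<in> ?B")
      case True
      have "norm (graph_map k \<gamma> y) \<le> R"
        using True norm_triangle_ineq2[of "graph_map k \<gamma> y" p]
        by (simp add: R_def dist_norm norm_minus_commute)
      then have b: "\<bar>graph_map k \<gamma> y $ i\<bar> \<le> R" for i
        using component_le_norm_cart[of "graph_map k \<gamma> y" i] by linarith
      have "\<bar>y $ i\<bar> \<le> R" for i
        using b[of i] y R by (cases "i = k") (auto simp: graph_map_def)
      then have "y \<in> Q" by (simp add: Q_def)
      then show ?thesis using c[of y] by (simp add: indicator_def ennreal_leI)
    qed simp
  qed
  also have "\<dots> = ennreal c * emeasure (hyperplane_lborel k) Q" by (rule nn_integral_cmult_indicator) simp
  also have "\<dots> < \<infinity>"
  proof -
    interpret product_sigma_finite "\<lambda>_::'n. lborel :: real measure" ..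
    have "emeasure (hyperplane_lborel k) Q
        = emeasure (Pi\<^sub>M (UNIV - {k}) (\<lambda>_. lborel)) (hyperplane_embedding k -` Q \<inter> space (Pi\<^sub>M (UNIV - {k}) (\<lambda>_. lborel)))"
      unfolding hyperplane_lborel_eq by (rule emeasure_distr) auto
    also have "\<dots> \<le> emeasure (Pi\<^sub>M (UNIV - {k}) (\<lambda>_. lborel)) (Pi\<^sub>E (UNIV - {k}) (\<lambda>i. {- R..R}))"
    proof (rule emeasure_mono)
      show "hyperplane_embedding k -` Q \<inter> space (Pi\<^sub>M (UNIV - {k}) (\<lambda>_. lborel)) \<subseteq> Pi\<^sub>E (UNIV - {k}) (\<lambda>i. {- R..R})"
      proof
        fix y assume y: "y \<in> hyperplane_embedding k -` Q \<inter> space (Pi\<^sub>M (UNIV - {k}) (\<lambda>_. lborel :: real measure))"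
        have "\<bar>y i\<bar> \<le> R" if "i \<noteq> k" for i
        proof -
          have "\<bar>hyperplane_embedding k y $ i\<bar> \<le> R" using y unfolding Q_def by blast
          then show ?thesis using that by (simp add: hyperplane_embedding_def)
        qed
        then show "y \<in> Pi\<^sub>E (UNIV - {k}) (\<lambda>i. {- R..R})"
          using y by (auto simp: space_PiM PiE_iff abs_le_iff minus_le_iff)
      qed
    qed (auto intro: sets_PiM_I_finite)
    also have "\<dots> = (\<Prod>i\<in>UNIV - {k}. ennreal (2 * R))"
      by (subst emeasure_PiM) (use R in auto)
    also have "\<dots> < \<infinity>" by (simp add: ennreal_power power_less_top_ennreal)
    finally show ?thesis by (simp add: ennreal_mult_less_top)
  qed
  finally show ?thesis using r(1) by (intro exI[of _ "ball p r"]) auto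
qed

end

section \<open>The theorems of Gauss and Stokes\<close>

lemma C1c_lipschitz:
  assumes "C1c g" obtains B where "B > 0" "\<And>x y. \<bar>g x - g y\<bar> \<le> B * norm (x - y)"
proof -
  obtain B where B: "B > 0" "\<And>x. norm (grad g x) \<le> B" using C1c_grad_bounded[OF assms] by blast
  have "norm (g x - g y) \<le> B * norm (x - y)" for x y
  proof (rule differentiable_bound[OF convex_UNIV])
    show "(g has_derivative (\<lambda>h. grad g x \<bullet> h)) (at x within UNIV)" for x
      using C1c_has_derivative[OF assms] by simp
    show "onorm (\<lambda>h. grad g x \<bullet> h) \<le> B" for x
      using B by (intro onorm_le) (metis Cauchy_Schwarz_ineq2 mult_right_mono norm_ge_zero order_trans real_norm_def)
  qed auto
  then show thesis using that B(1) by simp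
qed

text \<open>Differentiation under the integral sign. The difference quotients are dominated by \<open>\<bar>f\<bar>\<close> times the
Lipschitz constant of \<open>g\<close>.\<close>

lemma translate_integral_derivative:
  fixes f g :: "real^'n::finite \<Rightarrow> real"
  assumes f: "integrable \<mu> f" and s[measurable_cong]: "sets \<mu> = sets borel" and g: "C1c g"
  shows "((\<lambda>t. \<integral>x. f x * g (x + c + t *\<^sub>R e) \<partial>\<mu>) has_real_derivative
    (\<integral>x. f x * (grad g (x + c + t *\<^sub>R e) \<bullet> e) \<partial>\<mu>)) (at t)"
proof -
  obtain L where L: "L > 0" "\<And>x y. \<bar>g x - g y\<bar> \<le> L * norm (x - y)" using C1c_lipschitz[OF g] by blast
  obtain B where B: "B > 0" "\<And>x. \<bar>g x\<bar> \<le> B" using C1c_bounded[OF g] by blast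
  have [measurable]: "f \<in> borel_measurable \<mu>" using f by (rule borel_measurable_integrable)
  have [measurable]: "g \<in> borel_measurable borel" by (rule C1c_measurable[OF g])
  have [measurable]: "(\<lambda>x. grad g x) \<in> borel_measurable borel"
    by (rule borel_measurable_continuous_onI[OF C1_on_grad[OF C1c_C1_on[OF g]]])
  have int: "integrable \<mu> (\<lambda>x. f x * g (x + c + t *\<^sub>R e))" for t
    by (rule Bochner_Integration.integrable_bound[OF integrable_mult_right[OF f, of B]])
       (use B in \<open>auto simp: abs_mult mult.commute[of B] intro!: mult_mono\<close>)
  show ?thesis unfolding DERIV_def tendsto_at_iff_sequentially comp_def
  proof (intro allI impI)
    fix h :: "nat \<Rightarrow> real" assume h: "\<forall>i. h i \<in> UNIV - {0}" "h \<longlonglongrightarrow> 0"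
    let ?q = "\<lambda>i x. f x * ((g (x + c + (t + h i) *\<^sub>R e) - g (x + c + t *\<^sub>R e)) / h i)"
    have lim: "(\<lambda>i. \<integral>x. ?q i x \<partial>\<mu>) \<longlonglongrightarrow> (\<integral>x. f x * (grad g (x + c + t *\<^sub>R e) \<bullet> e) \<partial>\<mu>)"
    proof (rule integral_dominated_convergence[where w = "\<lambda>x. \<bar>f x\<bar> * (L * norm e)"])
      show "AE x in \<mu>. (\<lambda>i. ?q i x) \<longlonglongrightarrow> f x * (grad g (x + c + t *\<^sub>R e) \<bullet> e)"
      proof (intro AE_I2 tendsto_intros)
        fix x
        have "((\<lambda>t. g (x + c + t *\<^sub>R e)) has_real_derivative grad g (x + c + t *\<^sub>R e) \<bullet> e) (at t)"
          by (rule has_real_derivative_line[OF C1c_has_derivative[OF g]])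
        then show "(\<lambda>i. (g (x + c + (t + h i) *\<^sub>R e) - g (x + c + t *\<^sub>R e)) / h i)
            \<longlonglongrightarrow> grad g (x + c + t *\<^sub>R e) \<bullet> e"
          using h unfolding DERIV_def tendsto_at_iff_sequentially comp_def by blast
      qed
      show "AE x in \<mu>. norm (?q i x) \<le> \<bar>f x\<bar> * (L * norm e)" for i
      proof (rule AE_I2)
        fix x
        have h0: "\<bar>h i\<bar> > 0" using h(1) by auto
        have "x + c + (t + h i) *\<^sub>R e - (x + c + t *\<^sub>R e) = h i *\<^sub>R e" by (simp add: algebra_simps)
        then have "\<bar>g (x + c + (t + h i) *\<^sub>R e) - g (x + c + t *\<^sub>R e)\<bar> \<le> L * (\<bar>h i\<bar> * norm e)"
          using L(2)[of "x + c + (t + h i) *\<^sub>R e" "x + c + t *\<^sub>R e"] by simp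
        then have "\<bar>g (x + c + (t + h i) *\<^sub>R e) - g (x + c + t *\<^sub>R e)\<bar> / \<bar>h i\<bar> \<le> L * norm e"
          using h0 by (simp add: field_simps)
        then show "norm (?q i x) \<le> \<bar>f x\<bar> * (L * norm e)"
          by (simp only: real_norm_def abs_mult abs_divide) (rule mult_left_mono, auto)
      qed
      show "integrable \<mu> (\<lambda>x. \<bar>f x\<bar> * (L * norm e))" by (intro integrable_mult_left integrable_abs f)
    qed measurable
    have q: "(\<integral>x. ?q i x \<partial>\<mu>) = ((\<integral>x. f x * g (x + c + (t + h i) *\<^sub>R e) \<partial>\<mu>)
        - (\<integral>x. f x * g (x + c + t *\<^sub>R e) \<partial>\<mu>)) / h i" for i
    proof -
      have "(\<integral>x. ?q i x \<partial>\<mu>) = (\<integral>x. (f x * g (x + c + (t + h i) *\<^sub>R e) - f x * g (x + c + t *\<^sub>R e)) / h i \<partial>\<mu>)"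
        by (rule Bochner_Integration.integral_cong) (auto simp: right_diff_distrib diff_divide_distrib)
      then show ?thesis by (simp add: Bochner_Integration.integral_diff[OF int int])
    qed
    show "(\<lambda>i. ((\<integral>x. f x * g (x + c + (t + h i) *\<^sub>R e) \<partial>\<mu>)
        - (\<integral>x. f x * g (x + c + t *\<^sub>R e) \<partial>\<mu>)) / h i) \<longlonglongrightarrow> (\<integral>x. f x * (grad g (x + c + t *\<^sub>R e) \<bullet> e) \<partial>\<mu>)"
      unfolding q[symmetric] by (rule lim)
  qed
qed

lemma translate_integral_continuous:
  fixes f h :: "real^'n::finite \<Rightarrow> real"
  assumes f: "integrable \<mu> f" and s[measurable_cong]: "sets \<mu> = sets borel"
    and h: "continuous_on UNIV h" and B: "\<And>x. \<bar>h x\<bar> \<le> B"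
  shows "isCont (\<lambda>z. \<integral>x. f x * h (x + fst z *\<^sub>R a + snd z *\<^sub>R b) \<partial>\<mu>) (z :: real \<times> real)"
  unfolding continuous_at_sequentially comp_def
proof (intro allI impI)
  fix y :: "nat \<Rightarrow> real \<times> real" assume y: "y \<longlonglongrightarrow> z"
  have [measurable]: "f \<in> borel_measurable \<mu>" using f by (rule borel_measurable_integrable)
  have [measurable]: "h \<in> borel_measurable borel" by (rule borel_measurable_continuous_onI[OF h])
  have "isCont h x" for x using h by (simp add: continuous_on_eq_continuous_at)
  then have c: "(\<lambda>i. h (x + fst (y i) *\<^sub>R a + snd (y i) *\<^sub>R b)) \<longlonglongrightarrow> h (x + fst z *\<^sub>R a + snd z *\<^sub>R b)" for x
    by (rule isCont_tendsto_compose) (intro tendsto_intros y)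
  show "(\<lambda>i. \<integral>x. f x * h (x + fst (y i) *\<^sub>R a + snd (y i) *\<^sub>R b) \<partial>\<mu>) \<longlonglongrightarrow>
      (\<integral>x. f x * h (x + fst z *\<^sub>R a + snd z *\<^sub>R b) \<partial>\<mu>)"
  proof (rule integral_dominated_convergence[where w = "\<lambda>x. \<bar>f x\<bar> * B"])
    show "AE x in \<mu>. (\<lambda>i. f x * h (x + fst (y i) *\<^sub>R a + snd (y i) *\<^sub>R b)) \<longlonglongrightarrow>
        f x * h (x + fst z *\<^sub>R a + snd z *\<^sub>R b)"
      by (intro AE_I2 tendsto_intros c)
    show "AE x in \<mu>. norm (f x * h (x + fst (y i) *\<^sub>R a + snd (y i) *\<^sub>R b)) \<le> \<bar>f x\<bar> * B" for i
      by (intro AE_I2) (simp add: abs_mult B mult_left_mono)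
    show "integrable \<mu> (\<lambda>x. \<bar>f x\<bar> * B)" by (intro integrable_mult_left integrable_abs f)
  qed measurable
qed

lemma C1c_translate:
  assumes "C1c f" shows "C1c (\<lambda>x. f (x + c))" and "grad (\<lambda>x. f (x + c)) x = grad f (x + c)"
proof -
  have "C1_field UNIV (\<lambda>x. x + c)" by (auto simp: C1_field_def intro!: C1_on_intros)
  then have "C1_on UNIV (\<lambda>x. f (x + c))" by (rule C1_on_compose[OF C1c_C1_on[OF assms, of UNIV]]) simp
  moreover obtain R where R: "\<And>x. R < norm x \<Longrightarrow> f x = 0" using assms by (auto simp: C1c_def)
  have "f (x + c) = 0" if "R + norm c < norm x" for x
    using norm_triangle_ineq4[of "x + c" c] that by (intro R) simp
  ultimately show "C1c (\<lambda>x. f (x + c))" unfolding C1c_def by blast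
  have "((\<lambda>x. x + c) has_derivative (\<lambda>h. h)) (at x)" by (auto intro!: derivative_eq_intros)
  from has_derivative_compose[OF this C1c_has_derivative[OF assms]]
  show "grad (\<lambda>x. f (x + c)) x = grad f (x + c)" by (rule grad_eqI)
qed

lemma grad_mult:
  assumes "C1c f" "C1c g"
  shows "grad (\<lambda>x. f x * g x) x = f x *\<^sub>R grad g x + g x *\<^sub>R grad f x"
proof (rule grad_eqI)
  show "((\<lambda>x. f x * g x) has_derivative (\<lambda>h. (f x *\<^sub>R grad g x + g x *\<^sub>R grad f x) \<bullet> h)) (at x)"
    using has_derivative_mult[OF C1c_has_derivative[OF assms(1)] C1c_has_derivative[OF assms(2)], of x]
    by (simp add: inner_add_left mult.commute)
qed

locale boundary_measure = normal_extension X N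
  for X :: "(real^'n::finite) set" and N :: "real^'n \<Rightarrow> real^'n" +
  fixes \<mu> :: "(real^'n) measure"
  assumes \<mu>: "induced_volume_measure (frontier X) \<mu>"
begin

definition vol :: "(real^'n \<Rightarrow> real) \<Rightarrow> real" where
  "vol f = (\<integral>x. indicator X x * f x \<partial>lborel)"

definition surf :: "(real^'n \<Rightarrow> real) \<Rightarrow> real" where
  "surf f = (\<integral>x. indicator M x * f x \<partial>\<mu>)"

lemma sets_\<mu> [simp, measurable_cong]: "sets \<mu> = sets borel"
  using \<mu> by (simp add: induced_volume_measure_def)

lemma space_\<mu> [simp]: "space \<mu> = UNIV"
  using sets_eq_imp_space_eq[OF sets_\<mu>] by simp

lemma M_borel [measurable]: "M \<in> sets borel" by simp

lemma finite_M: "emeasure \<mu> M < \<infinity>"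
proof -
  have "\<forall>p\<in>M. \<exists>U. open U \<and> p \<in> U \<and> emeasure \<mu> (M \<inter> U) < \<infinity>"
  proof
    fix p assume "p \<in> M"
    then obtain V k \<gamma> s where c: "boundary_chart X V k \<gamma> s" "p \<in> V" using chartE by blast
    interpret boundary_chart X V k \<gamma> s by (rule c(1))
    show "\<exists>U. open U \<and> p \<in> U \<and> emeasure \<mu> (M \<inter> U) < \<infinity>" by (rule finite_measure_near[OF \<mu> c(2)])
  qed
  then obtain U where U: "\<And>p. p \<in> M \<Longrightarrow> open (U p)" "\<And>p. p \<in> M \<Longrightarrow> p \<in> U p"
    "\<And>p. p \<in> M \<Longrightarrow> emeasure \<mu> (M \<inter> U p) < \<infinity>" by metis
  have "M \<subseteq> (\<Union>p\<in>M. U p)" using U(2) by blast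
  then obtain A where A: "A \<subseteq> M" "finite A" "M \<subseteq> (\<Union>p\<in>A. U p)"
    using compactE_image[OF compact_M, of M U] U(1) by metis
  have sA: "M \<inter> U p \<in> sets \<mu>" if "p \<in> A" for p using U(1)[of p] A(1) that by auto
  have "emeasure \<mu> M \<le> emeasure \<mu> (\<Union>p\<in>A. M \<inter> U p)"
    using A sA by (intro emeasure_mono sets.finite_UN) auto
  also have "\<dots> \<le> (\<Sum>p\<in>A. emeasure \<mu> (M \<inter> U p))"
    using A(2) sA by (intro emeasure_subadditive_finite) auto
  also have "\<dots> < \<infinity>" using A U(3) by (auto simp: ennreal_sum_less_top subset_eq)
  finally show ?thesis .
qed

lemma integrable_surf:
  fixes h :: "real^'n \<Rightarrow> real"
  assumes "continuous_on M h" shows "integrable \<mu> (\<lambda>x. indicator M x * h x)"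
proof -
  have "compact (h ` M)" by (rule compact_continuous_image[OF assms compact_M])
  then obtain B where B: "\<And>x. x \<in> M \<Longrightarrow> norm (h x) \<le> B" using compact_imp_bounded bounded_iff by (metis imageI)
  have "(\<lambda>x. indicator M x *\<^sub>R h x) \<in> borel_measurable borel"
    by (rule borel_measurable_continuous_on_indicator[OF _ assms]) simp
  then have "(\<lambda>x. indicator M x * h x) \<in> borel_measurable \<mu>"
    by (simp add: measurable_cong_sets[OF sets_\<mu> refl])
  then show ?thesis
    by (rule integrableI_bounded_set[where A = M and B = B, rotated]) (use B finite_M in \<open>auto simp: indicator_def\<close>)
qed

lemma integrable_vol:
  fixes h :: "real^'n \<Rightarrow> real"
  assumes "continuous_on (closure X) h" shows "integrable lborel (\<lambda>x. indicator X x * h x)"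
proof -
  have "compact (closure X)" using bdd by (simp add: compact_closure)
  from borel_integrable_compact[OF this assms]
  have "integrable lborel (\<lambda>x. indicator X x *\<^sub>R (indicator (closure X) x *\<^sub>R h x))"
    by (rule integrable_mult_indicator[rotated]) (use openX in simp)
  moreover have "(\<lambda>x. indicator X x *\<^sub>R (indicator (closure X) x *\<^sub>R h x)) = (\<lambda>x. indicator X x * h x)"
    using closure_subset[of X] by (auto simp: indicator_def fun_eq_iff)
  ultimately show ?thesis by simp
qed

lemma vol_cong: "(\<And>x. x \<in> X \<Longrightarrow> f x = g x) \<Longrightarrow> vol f = vol g"
  unfolding vol_def by (rule Bochner_Integration.integral_cong) (auto simp: indicator_def)

lemma surf_cong: "(\<And>x. x \<in> M \<Longrightarrow> f x = g x) \<Longrightarrow> surf f = surf g"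
  unfolding surf_def by (rule Bochner_Integration.integral_cong) (auto simp: indicator_def)

lemma vol_diff: "continuous_on (closure X) f \<Longrightarrow> continuous_on (closure X) g \<Longrightarrow> vol (\<lambda>x. f x - g x) = vol f - vol g"
  unfolding vol_def right_diff_distrib by (intro Bochner_Integration.integral_diff integrable_vol)

lemma surf_diff: "continuous_on M f \<Longrightarrow> continuous_on M g \<Longrightarrow> surf (\<lambda>x. f x - g x) = surf f - surf g"
  unfolding surf_def right_diff_distrib by (intro Bochner_Integration.integral_diff integrable_surf)

lemma vol_add: "continuous_on (closure X) f \<Longrightarrow> continuous_on (closure X) g \<Longrightarrow> vol (\<lambda>x. f x + g x) = vol f + vol g"
  unfolding vol_def distrib_left by (intro Bochner_Integration.integral_add integrable_vol)

lemma surf_add: "continuous_on M f \<Longrightarrow> continuous_on M g \<Longrightarrow> surf (\<lambda>x. f x + g x) = surf f + surf g"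
  unfolding surf_def distrib_left by (intro Bochner_Integration.integral_add integrable_surf)

lemma vol_cmult: "vol (\<lambda>x. c * f x) = c * vol f"
  unfolding vol_def mult.left_commute[of _ c] by simp

lemma surf_cmult: "surf (\<lambda>x. c * f x) = c * surf f"
  unfolding surf_def mult.left_commute[of _ c] by simp

lemma vol_sum:
  "(\<And>i. i \<in> I \<Longrightarrow> continuous_on (closure X) (f i)) \<Longrightarrow> vol (\<lambda>x. \<Sum>i\<in>I. f i x) = (\<Sum>i\<in>I. vol (f i))"
  unfolding vol_def sum_distrib_left by (intro Bochner_Integration.integral_sum integrable_vol)

lemma surf_sum:
  "(\<And>i. i \<in> I \<Longrightarrow> continuous_on M (f i)) \<Longrightarrow> surf (\<lambda>x. \<Sum>i\<in>I. f i x) = (\<Sum>i\<in>I. surf (f i))"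
  unfolding surf_def sum_distrib_left by (intro Bochner_Integration.integral_sum integrable_surf)

lemma C1c_cont: "C1c f \<Longrightarrow> continuous_on S f"
  by (rule C1_on_continuous_on[OF C1c_C1_on])

lemma C1c_grad_cont: "C1c f \<Longrightarrow> continuous_on S (grad f)"
  by (rule C1_on_grad[OF C1c_C1_on])

lemma N_cont: "continuous_on S N" by (rule C1_field_continuous_on[OF C1_N])

lemma N_cont_component: "continuous_on S (\<lambda>x. N x $ i)" by (intro continuous_intros N_cont)

text \<open>In an interior point the neighbourhood can be \<open>X\<close> itself, where both sides vanish.\<close>

lemma divergence_near:
  assumes p: "p \<in> closure X"
  shows "\<exists>U. open U \<and> p \<in> U \<and> (\<forall>\<phi> C. C1c \<phi> \<longrightarrow> compact C \<longrightarrow> C \<subseteq> U \<longrightarrow> (\<forall>x. x \<notin> C \<longrightarrow> \<phi> x = 0) \<longrightarrow>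
     vol (\<lambda>x. grad \<phi> x $ i) = surf (\<lambda>x. \<phi> x * N x $ i))"
proof (cases "p \<in> X")
  case True
  have "vol (\<lambda>x. grad \<phi> x $ i) = surf (\<lambda>x. \<phi> x * N x $ i)"
    if \<phi>: "C1c \<phi>" and C: "compact C" "C \<subseteq> X" "\<forall>x. x \<notin> C \<longrightarrow> \<phi> x = 0" for \<phi> C
  proof -
    have "vol (\<lambda>x. grad \<phi> x $ i) = (\<integral>x. grad \<phi> x $ i \<partial>lborel)"
      unfolding vol_def
      by (rule Bochner_Integration.integral_cong)
         (use C(2) grad_eq_0_outside_compact[OF C(1) C(3)[rule_format]] in \<open>force simp: indicator_def\<close>)+
    moreover have "surf (\<lambda>x. \<phi> x * N x $ i) = surf (\<lambda>x. 0)"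
      by (rule surf_cong) (use C openX in \<open>auto simp: frontier_def interior_open\<close>)
    ultimately show ?thesis by (simp add: integral_grad_eq_0[OF \<phi>] surf_def)
  qed
  then show ?thesis using True openX by blast
next
  case False
  then have "p \<in> M" using p openX by (simp add: frontier_def interior_open)
  then obtain V k \<gamma> s where c: "boundary_chart X V k \<gamma> s" "p \<in> V" using chartE by blast
  interpret boundary_chart X V k \<gamma> s by (rule c(1))
  have "vol (\<lambda>x. grad \<phi> x $ i) = surf (\<lambda>x. \<phi> x * N x $ i)"
    if \<phi>: "C1c \<phi>" and C: "compact C" "C \<subseteq> V" "\<forall>x. x \<notin> C \<longrightarrow> \<phi> x = 0" for \<phi> C
  proof -
    have [measurable]: "\<phi> \<in> borel_measurable borel" by (rule C1c_measurable[OF \<phi>])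
    have [measurable]: "(\<lambda>x. N x $ i) \<in> borel_measurable borel"
      by (intro borel_measurable_continuous_onI N_cont_component)
    have [measurable]: "(\<lambda>y. d\<rho> y $ i) \<in> borel_measurable borel"
      by (intro borel_measurable_continuous_onI continuous_intros C1_field_continuous_on C1_d\<rho>)
    have [measurable]: "(\<lambda>y. N (shear y) $ i) \<in> borel_measurable borel"
      by (intro borel_measurable_continuous_onI continuous_on_compose2[OF N_cont_component]
          C1_field_continuous_on C1_shear) auto
    have "vol (\<lambda>x. grad \<phi> x $ i) = (\<integral>y. \<phi> (shear y) * d\<rho> y $ i \<partial>hyperplane_lborel k)"
      unfolding vol_def by (rule divergence_in_chart[OF \<phi> C(1,2)]) (use C(3) in blast)
    also have "\<dots> = (\<integral>y. (\<phi> (shear y) * N (shear y) $ i) * norm (d\<rho> y) \<partial>hyperplane_lborel k)"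
    proof (rule integral_hyperplane_cong)
      fix y :: "real^'n" assume y: "y $ k = 0"
      show "\<phi> (shear y) * d\<rho> y $ i = (\<phi> (shear y) * N (shear y) $ i) * norm (d\<rho> y)"
      proof (cases "shear y \<in> C")
        case True
        then have V: "shear y \<in> V" using C(2) by blast
        have \<rho>0: "\<rho> (shear y) = 0" by (simp add: \<rho>_shear y)
        then have "N (shear y) = \<nu> (shear y)"
          using outward_normal_eq[OF V \<rho>0] N_eq[of "shear y"] in_frontier_iff[OF V] by simp
        then have "d\<rho> y = norm (d\<rho> y) *\<^sub>R N (shear y)" using d\<rho>_\<nu>[of "shear y"] by (simp add: d\<rho>_shear)
        from arg_cong[OF this, of "\<lambda>v. v $ i"] have "d\<rho> y $ i = norm (d\<rho> y) * N (shear y) $ i"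
          unfolding vector_scaleR_component real_scaleR_def .
        then show ?thesis by simp
      qed (use C(3) in simp)
    qed measurable
    also have "\<dots> = surf (\<lambda>x. \<phi> x * N x $ i)"
      unfolding surf_def by (rule surface_integral_in_chart[OF \<mu>, symmetric]) (use C in auto)
    finally show ?thesis .
  qed
  then show ?thesis using openV c(2) by blast
qed

lemma divergence_theorem:
  assumes \<phi>: "C1c \<phi>"
  shows "vol (\<lambda>x. grad \<phi> x $ i) = surf (\<lambda>x. \<phi> x * N x $ i)"
proof -
  define div_on where "div_on U \<longleftrightarrow> (\<forall>\<phi> C. C1c \<phi> \<longrightarrow> compact C \<longrightarrow> C \<subseteq> U \<longrightarrow> (\<forall>x. x \<notin> C \<longrightarrow> \<phi> x = 0) \<longrightarrow>
     vol (\<lambda>x. grad \<phi> x $ i) = surf (\<lambda>x. \<phi> x * N x $ i))" for U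
  have "\<forall>p\<in>closure X. \<exists>U. open U \<and> p \<in> U \<and> div_on U"
    using divergence_near unfolding div_on_def by blast
  then obtain U where U: "\<And>p. p \<in> closure X \<Longrightarrow> open (U p) \<and> p \<in> U p"
    and loc: "\<And>p. p \<in> closure X \<Longrightarrow> div_on (U p)"
    by metis
  have K: "compact (closure X)" using bdd by (simp add: compact_closure)
  obtain A \<eta> where A: "finite A" "A \<subseteq> closure X" "\<And>p. p \<in> A \<Longrightarrow> C1c (\<eta> p)"
    "\<And>p. p \<in> A \<Longrightarrow> \<exists>C. compact C \<and> C \<subseteq> U p \<and> (\<forall>x. x \<notin> C \<longrightarrow> \<eta> p x = 0)"
    "\<And>x. x \<in> closure X \<Longrightarrow> (\<Sum>p\<in>A. \<eta> p x) = (1::real)"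
    using partition_of_unity[OF K U] by blast
  have \<eta>\<phi>: "C1c (\<lambda>x. \<eta> p x * \<phi> x)" if "p \<in> A" for p using A(3)[OF that] \<phi> by (rule C1c_mult)
  have eq: "(\<Sum>p\<in>A. \<eta> p x * \<phi> x) = \<phi> x" if "x \<in> closure X" for x
    using A(5)[OF that] by (simp add: sum_distrib_right[symmetric])
  have g: "grad \<phi> x = (\<Sum>p\<in>A. grad (\<lambda>x. \<eta> p x * \<phi> x) x)" if "x \<in> X" for x
  proof (rule grad_eqI)
    have "((\<lambda>x. \<Sum>p\<in>A. \<eta> p x * \<phi> x) has_derivative (\<lambda>h. \<Sum>p\<in>A. grad (\<lambda>x. \<eta> p x * \<phi> x) x \<bullet> h)) (at x)"
      by (intro has_derivative_sum C1c_has_derivative \<eta>\<phi>)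
    then have "(\<phi> has_derivative (\<lambda>h. \<Sum>p\<in>A. grad (\<lambda>x. \<eta> p x * \<phi> x) x \<bullet> h)) (at x)"
      by (rule has_derivative_transform_within_open[OF _ openX that]) (use eq closure_subset in auto)
    then show "(\<phi> has_derivative (\<lambda>h. (\<Sum>p\<in>A. grad (\<lambda>x. \<eta> p x * \<phi> x) x) \<bullet> h)) (at x)"
      by (simp add: inner_sum_left)
  qed
  have "vol (\<lambda>x. grad \<phi> x $ i) = vol (\<lambda>x. \<Sum>p\<in>A. grad (\<lambda>x. \<eta> p x * \<phi> x) x $ i)"
    by (rule vol_cong) (simp add: g)
  also have "\<dots> = (\<Sum>p\<in>A. vol (\<lambda>x. grad (\<lambda>x. \<eta> p x * \<phi> x) x $ i))"
    by (rule vol_sum) (intro continuous_intros C1c_grad_cont \<eta>\<phi>)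
  also have "\<dots> = (\<Sum>p\<in>A. surf (\<lambda>x. (\<eta> p x * \<phi> x) * N x $ i))"
  proof (rule sum.cong[OF refl])
    fix p assume p: "p \<in> A"
    obtain C where C: "compact C" "C \<subseteq> U p" "\<forall>x. x \<notin> C \<longrightarrow> \<eta> p x = 0" using A(4)[OF p] by blast
    have "p \<in> closure X" using p A(2) by (rule subsetD[rotated])
    from loc[OF this, unfolded div_on_def, rule_format, OF \<eta>\<phi>[OF p] C(1,2)]
    show "vol (\<lambda>x. grad (\<lambda>x. \<eta> p x * \<phi> x) x $ i) = surf (\<lambda>x. (\<eta> p x * \<phi> x) * N x $ i)"
      using C(3) by simp
  qed
  also have "\<dots> = surf (\<lambda>x. \<Sum>p\<in>A. (\<eta> p x * \<phi> x) * N x $ i)"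
    by (rule surf_sum[symmetric]) (intro continuous_intros N_cont_component C1c_cont \<eta>\<phi> \<phi> A(3))
  also have "\<dots> = surf (\<lambda>x. \<phi> x * N x $ i)"
    by (rule surf_cong) (use eq M_closure in \<open>simp add: sum_distrib_right[symmetric]\<close>)
  finally show ?thesis .
qed

text \<open>Let \<open>K(p,q) = \<integral>\<^sub>X b(x) a(x + p e\<^sub>i + q e\<^sub>j) dx\<close>. Its first derivatives are integrals of \<open>b\<close> times first
derivatives of a translate of \<open>a\<close>. The divergence theorem moves that derivative to \<open>b\<close> and to the
boundary, so that the translate of \<open>a\<close> appears undifferentiated and another derivative can be
taken. The claim is the equality of the two mixed derivatives of \<open>K\<close> at the origin. For \<open>C\<^sup>2\<close>
functions \<open>a\<close> it is Stokes' theorem for the form \<open>b da\<close>.\<close>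

lemma stokes_two_form:
  assumes a: "C1c a" and b: "C1c b"
  shows "vol (\<lambda>x. grad a x $ i * grad b x $ j - grad a x $ j * grad b x $ i)
       = surf (\<lambda>x. b x * (grad a x $ i * N x $ j - grad a x $ j * N x $ i))"
proof -
  let ?T = "\<lambda>p q x. x + p *\<^sub>R axis i 1 + q *\<^sub>R axis j (1::real)"
  note cb = C1c_cont[OF b] C1c_grad_cont[OF b]
  define wb where "wb x = indicator X x * b x" for x
  define wv where "wv l x = indicator X x * grad b x $ l" for l x
  define ws where "ws l x = indicator M x * (b x * N x $ l)" for l x
  have wb: "integrable lborel wb" unfolding wb_def by (intro integrable_vol cb)
  have wv: "integrable lborel (wv l)" for l unfolding wv_def by (intro integrable_vol continuous_intros cb)
  have ws: "integrable \<mu> (ws l)" for l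
    unfolding ws_def by (intro integrable_surf continuous_intros cb N_cont_component)
  define A where "A l p q = (\<integral>x. ws l x * a (?T p q x) \<partial>\<mu>) - (\<integral>x. wv l x * a (?T p q x) \<partial>lborel)" for l p q
  define D where "D l k p q = (\<integral>x. ws l x * (grad a (?T p q x) \<bullet> axis k 1) \<partial>\<mu>)
      - (\<integral>x. wv l x * (grad a (?T p q x) \<bullet> axis k 1) \<partial>lborel)" for l k p q
  have T': "?T p q x = x + p *\<^sub>R axis i 1 + q *\<^sub>R axis j 1" "?T p q x = x + q *\<^sub>R axis j 1 + p *\<^sub>R axis i 1"
    "?T p q x = x + (p *\<^sub>R axis i 1 + q *\<^sub>R axis j 1)" for p q x by (simp_all add: algebra_simps)
  \<comment> \<open>The divergence theorem for \<open>b\<close> times a translate of \<open>a\<close>.\<close>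
  have div: "(\<integral>x. wb x * (grad a (?T p q x) \<bullet> axis l 1) \<partial>lborel) = A l p q" for l p q
  proof -
    define a' where "a' x = a (x + (p *\<^sub>R axis i 1 + q *\<^sub>R axis j 1))" for x
    have a': "C1c a'" "grad a' x = grad a (?T p q x)" "a' x = a (?T p q x)" for x
      unfolding a'_def T'(3) using C1c_translate[OF a] by auto
    have "vol (\<lambda>x. grad (\<lambda>x. b x * a' x) x $ l) = surf (\<lambda>x. (b x * a' x) * N x $ l)"
      by (rule divergence_theorem[OF C1c_mult[OF b a'(1)]])
    moreover have "vol (\<lambda>x. grad (\<lambda>x. b x * a' x) x $ l) = vol (\<lambda>x. b x * grad a' x $ l) + vol (\<lambda>x. grad b x $ l * a' x)"
      unfolding grad_mult[OF b a'(1)] vector_add_component vector_scaleR_component real_scaleR_def mult.commute[of "a' _" "grad b _ $ l"]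
      by (intro vol_add continuous_intros C1c_cont C1c_grad_cont b a')
    ultimately have "vol (\<lambda>x. b x * grad a' x $ l) = surf (\<lambda>x. b x * a' x * N x $ l) - vol (\<lambda>x. grad b x $ l * a' x)" by simp
    then show ?thesis
      by (simp add: vol_def surf_def A_def wb_def wv_def ws_def a'(2,3) inner_axis mult.assoc mult.left_commute mult.commute)
  qed
  obtain B where B: "\<And>x. norm (grad a x) \<le> B" using C1c_grad_bounded[OF a] by blast
  have bnd: "\<bar>grad a x \<bullet> axis l 1\<bar> \<le> B" for x l
    using Cauchy_Schwarz_ineq2[of "grad a x" "axis l 1"] B[of x] by simp
  have ga: "continuous_on UNIV (\<lambda>x. grad a x \<bullet> axis l 1)" for l by (intro continuous_intros C1c_grad_cont a)
  have cont: "isCont (\<lambda>z. D l k (fst z) (snd z)) (0, 0)" for l k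
    unfolding D_def by (intro isCont_diff translate_integral_continuous[OF ws sets_\<mu> ga bnd]
      translate_integral_continuous[OF wv sets_lborel ga bnd])
  have "D i j 0 0 = D j i 0 0"
  proof (rule mixed_partials_eq[where \<delta> = 1 and K = "\<lambda>p q. \<integral>x. wb x * a (?T p q x) \<partial>lborel"
        and A = "A i" and B = "A j" and C = "D i j" and D = "D j i"])
    fix p q :: real
    show "((\<lambda>p. \<integral>x. wb x * a (?T p q x) \<partial>lborel) has_real_derivative A i p q) (at p)"
      unfolding div[symmetric] T'(2) by (rule translate_integral_derivative[OF wb sets_lborel a])
    show "((\<lambda>q. \<integral>x. wb x * a (?T p q x) \<partial>lborel) has_real_derivative A j p q) (at q)"
      unfolding div[symmetric] by (rule translate_integral_derivative[OF wb sets_lborel a])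
    show "((\<lambda>q. A i p q) has_real_derivative D i j p q) (at q)"
      unfolding A_def D_def by (intro DERIV_diff translate_integral_derivative ws wv sets_lborel sets_\<mu> a)
    show "((\<lambda>p. A j p q) has_real_derivative D j i p q) (at p)"
      unfolding A_def D_def T'(2) by (intro DERIV_diff translate_integral_derivative ws wv sets_lborel sets_\<mu> a)
  qed (use cont in auto)
  moreover have "D l k 0 0 = surf (\<lambda>x. b x * N x $ l * grad a x $ k) - vol (\<lambda>x. grad b x $ l * grad a x $ k)" for l k
    by (simp add: D_def surf_def vol_def ws_def wv_def inner_axis mult.assoc)
  ultimately have "surf (\<lambda>x. b x * N x $ i * grad a x $ j) - vol (\<lambda>x. grad b x $ i * grad a x $ j)
      = surf (\<lambda>x. b x * N x $ j * grad a x $ i) - vol (\<lambda>x. grad b x $ j * grad a x $ i)" by simp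
  moreover have "vol (\<lambda>x. grad b x $ j * grad a x $ i - grad b x $ i * grad a x $ j)
      = vol (\<lambda>x. grad b x $ j * grad a x $ i) - vol (\<lambda>x. grad b x $ i * grad a x $ j)"
    by (intro vol_diff continuous_intros C1c_grad_cont a b)
  moreover have "surf (\<lambda>x. b x * N x $ j * grad a x $ i - b x * N x $ i * grad a x $ j)
      = surf (\<lambda>x. b x * N x $ j * grad a x $ i) - surf (\<lambda>x. b x * N x $ i * grad a x $ j)"
    by (intro surf_diff continuous_intros C1c_grad_cont C1c_cont N_cont_component a b)
  ultimately have "vol (\<lambda>x. grad b x $ j * grad a x $ i - grad b x $ i * grad a x $ j)
      = surf (\<lambda>x. b x * N x $ j * grad a x $ i - b x * N x $ i * grad a x $ j)" by simp
  then show ?thesis by (simp add: algebra_simps)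
qed

end

section \<open>Symmetry of the form\<close>

lemma dfield_sum: "dfield Z x h $ i = (\<Sum>l\<in>UNIV. grad (\<lambda>y. Z y $ i) x $ l * h $ l)"
  by (simp add: dfield_def inner_vec_def)

lemma lin_trace_dfield: "lin_trace (dfield Z x) = (\<Sum>i\<in>UNIV. grad (\<lambda>y. Z y $ i) x $ i)"
  by (simp add: lin_trace_def sum_Basis_vec inner_axis dfield_def)

text \<open>How sums of minors become traces and matrix-vector products.\<close>

lemma sum_minors:
  fixes G :: "'n::finite \<Rightarrow> 'n \<Rightarrow> real" and y z :: "real^'n"
  shows "(\<Sum>i\<in>UNIV. \<Sum>j\<in>UNIV. y $ j * (G i i * z $ j - G i j * z $ i))
       = (y \<bullet> z) * (\<Sum>i\<in>UNIV. G i i) - (\<Sum>i\<in>UNIV. (\<Sum>j\<in>UNIV. G i j * y $ j) * z $ i)"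
proof -
  have "(\<Sum>i\<in>UNIV. \<Sum>j\<in>UNIV. y $ j * (G i i * z $ j - G i j * z $ i))
      = (\<Sum>i\<in>UNIV. \<Sum>j\<in>UNIV. y $ j * z $ j * G i i) - (\<Sum>i\<in>UNIV. \<Sum>j\<in>UNIV. G i j * y $ j * z $ i)"
    by (simp add: right_diff_distrib sum_subtractf mult_ac)
  then show ?thesis by (simp add: inner_vec_def sum_distrib_left sum_distrib_right)
qed

lemma hess_eq:
  assumes X: "open X" "x \<in> X" and v: "jet_extension X v V Z"
  shows "hess v x $ i $ j = grad (\<lambda>y. Z y $ i) x $ j"
proof -
  have V: "C1c V" "C1c_field Z" "\<And>x. x \<in> closure X \<Longrightarrow> V x = v x" "\<And>x. x \<in> closure X \<Longrightarrow> grad V x = Z x"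
    using v by (auto simp: jet_extension_def)
  have gv: "grad v y = Z y" if "y \<in> X" for y
  proof -
    have "(v has_derivative (\<lambda>h. grad V y \<bullet> h)) (at y)"
      by (rule has_derivative_transform_within_open[OF C1c_has_derivative[OF V(1)] X(1) that])
         (use V(3) closure_subset in auto)
    from grad_eqI[OF this] show ?thesis using V(4)[of y] closure_subset that by auto
  qed
  have "(grad v has_derivative dfield Z x) (at x)"
    by (rule has_derivative_transform_within_open[OF C1c_field_has_derivative[OF V(2)] X]) (simp add: gv)
  then have "frechet_derivative (grad v) (at x) = dfield Z x" by (rule frechet_derivative_at[symmetric])
  then show ?thesis by (simp add: hess_def jacobian_def matrix_def dfield_def inner_axis)
qed

lemma sigma2_sum:
  "2 * sigma2 A B = (\<Sum>i\<in>UNIV. \<Sum>j\<in>UNIV. A $ i $ i * B $ j $ j - A $ i $ j * B $ j $ i)"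
  by (simp add: sigma2_def trace_def matrix_matrix_mult_def sum_subtractf sum_product)

lemma sigma2_commute: "sigma2 A B = sigma2 B A"
  by (simp add: sigma2_def trace_mul_sym[of A B] mult.commute)

context boundary_measure
begin

lemma cutoff_exists: obtains b where "C1c b" "\<And>x. x \<in> closure X \<Longrightarrow> b x = 1" "\<And>x. x \<in> X \<Longrightarrow> grad b x = 0"
proof -
  have "\<exists>F. C1c F \<and> (\<forall>x\<in>closure X. F x = (\<lambda>_. 1) x)"
    by (rule C1c_of_local) (use bdd C1_on_const in \<open>auto simp: compact_closure\<close>)
  then obtain b where b: "C1c b" "\<And>x. x \<in> closure X \<Longrightarrow> b x = 1" by auto
  have "grad b x = 0" if "x \<in> X" for x
  proof (rule grad_eqI)
    have "((\<lambda>x. 1) has_derivative (\<lambda>h. 0 \<bullet> h)) (at x)" by simp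
    then show "(b has_derivative (\<lambda>h. 0 \<bullet> h)) (at x)"
      by (rule has_derivative_transform_within_open[OF _ openX that]) (use b(2) closure_subset in auto)
  qed
  then show thesis using that b by blast
qed

lemma sdiv_cont: "C1c_field Z \<Longrightarrow> continuous_on S (sdiv Z)"
  by (rule continuous_on_sdiv[OF C1c_field_C1])

text \<open>The divergence of a tangential field is the sum over \<open>i, j\<close> of the tangential derivatives
\<open>N\<^sub>i \<partial>\<^sub>j - N\<^sub>j \<partial>\<^sub>i\<close> of \<open>N\<^sub>i Z\<^sub>j\<close>. Each of them integrates to zero by Stokes' theorem with a function \<open>b\<close>
that is \<open>1\<close> on the closed domain.\<close>

lemma surf_sdiv_eq_0:
  assumes Z: "C1c_field Z" and t: "\<And>x. x \<in> M \<Longrightarrow> Z x \<bullet> N x = 0"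
  shows "surf (sdiv Z) = 0"
proof -
  obtain b where b: "C1c b" "\<And>x. x \<in> closure X \<Longrightarrow> b x = 1" "\<And>x. x \<in> X \<Longrightarrow> grad b x = 0"
    using cutoff_exists by blast
  define a where "a i j x = N x $ i * Z x $ j" for i j x
  have Zj: "C1c (\<lambda>x. Z x $ j)" and Ni: "C1c (\<lambda>x. N x $ j)" for j using Z N by (auto simp: C1c_field_def)
  have a: "C1c (a i j)" for i j unfolding a_def by (rule C1c_mult[OF Ni Zj])
  let ?J = "\<lambda>i j x. grad (a i j) x $ j * N x $ i - grad (a i j) x $ i * N x $ j"
  have z: "surf (?J i j) = 0" for i j
  proof -
    have "surf (?J i j)
        = surf (\<lambda>x. b x * (?J i j x))"
      by (rule surf_cong) (simp add: b(2) M_closure)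
    also have "\<dots> = vol (\<lambda>x. grad (a i j) x $ j * grad b x $ i - grad (a i j) x $ i * grad b x $ j)"
      by (rule stokes_two_form[OF a b(1), symmetric])
    also have "\<dots> = vol (\<lambda>x. 0)" by (rule vol_cong) (simp add: b(3))
    finally show ?thesis by (simp add: vol_def)
  qed
  have "sdiv Z x = (\<Sum>i\<in>UNIV. \<Sum>j\<in>UNIV. ?J i j x)"
    if x: "x \<in> M" for x
  proof -
    define G where "G i j = grad (\<lambda>y. Z y $ i) x $ j" for i j
    define H where "H i j = grad (\<lambda>y. N y $ i) x $ j" for i j
    have ga: "grad (a i j) x $ l = N x $ i * G j l + Z x $ j * H i l" for i j l
      using grad_mult[OF Ni[of i] Zj[of j], of x] by (simp add: a_def[abs_def] G_def H_def)
    have "(\<Sum>i\<in>UNIV. \<Sum>j\<in>UNIV. ?J i j x)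
        = (\<Sum>i\<in>UNIV. \<Sum>j\<in>UNIV. N x $ i * (G j j * N x $ i - G j i * N x $ j))
          - (\<Sum>i\<in>UNIV. \<Sum>j\<in>UNIV. Z x $ j * (H i i * N x $ j - H i j * N x $ i))"
      by (simp add: ga sum_subtractf[symmetric] algebra_simps)
    also have "(\<Sum>i\<in>UNIV. \<Sum>j\<in>UNIV. N x $ i * (G j j * N x $ i - G j i * N x $ j))
        = (\<Sum>j\<in>UNIV. \<Sum>i\<in>UNIV. N x $ i * (G j j * N x $ i - G j i * N x $ j))"
      by (rule sum.swap)
    also have "\<dots> = lin_trace (dfield Z x) - dfield Z x (N x) \<bullet> N x"
      unfolding sum_minors N_unit[OF x] lin_trace_dfield
      by (simp add: inner_vec_def[of "dfield Z x (N x)"] dfield_sum G_def)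
    also have "(\<Sum>i\<in>UNIV. \<Sum>j\<in>UNIV. Z x $ j * (H i i * N x $ j - H i j * N x $ i))
        = - (dfield N x (Z x) \<bullet> N x)"
      unfolding sum_minors t[OF x]
      by (simp add: inner_vec_def[of "dfield N x (Z x)"] dfield_sum H_def)
    also have "dfield N x (Z x) \<bullet> N x = 0"
      using dN_tangent[OF x, of "Z x"] P_tangent[OF t[OF x]] by simp
    finally show ?thesis by (simp add: sdiv_def)
  qed
  then have "surf (sdiv Z) = surf (\<lambda>x. \<Sum>i\<in>UNIV. \<Sum>j\<in>UNIV. ?J i j x)"
    by (rule surf_cong)
  also have "\<dots> = (\<Sum>i\<in>UNIV. \<Sum>j\<in>UNIV. surf (?J i j))"
    by (simp add: surf_sum continuous_intros C1c_grad_cont[OF a] N_cont_component)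
  finally show ?thesis by (simp add: z)
qed

lemma Q2_alt: "Q2 X \<mu> u v w = - vol (\<lambda>x. u x * sigma2 (hess v x) (hess w x)) + surf (\<lambda>x. u x * B2 X v w x)"
  by (simp add: Q2_def vol_def surf_def set_lebesgue_integral_def)

lemma jet_field: "jet_extension X v V Z \<Longrightarrow> C1c_field Z" by (simp add: jet_extension_def)

lemma jet_components: "jet_extension X v V Z \<Longrightarrow> C1c (\<lambda>x. Z x $ i)" by (simp add: jet_extension_def C1c_field_def)

lemma continuous_on_B2_jet:
  assumes v: "jet_extension X v V Z" and w: "jet_extension X w W Y"
  shows "continuous_on M (B2 X v w)"
proof -
  have Z: "C1c_field Z" "C1c_field Y" using v w by (auto simp: jet_extension_def)
  have "continuous_on M (\<lambda>x. 1/2 * ((Z x \<bullet> N x) * sdiv (tang Y) x + (Y x \<bullet> N x) * sdiv (tang Z) x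
    + dfield N x (tang Z x) \<bullet> tang Y x + sdiv N x * (Z x \<bullet> N x) * (Y x \<bullet> N x)))"
    by (intro continuous_intros sdiv_cont C1c_tang Z N N_cont C1_field_continuous_dfield C1_N
        C1_field_continuous_on C1c_field_C1)
  then show ?thesis
  proof (rule continuous_on_eq)
    fix x assume x: "x \<in> M"
    show "1/2 * ((Z x \<bullet> N x) * sdiv (tang Y) x + (Y x \<bullet> N x) * sdiv (tang Z) x
      + dfield N x (tang Z x) \<bullet> tang Y x + sdiv N x * (Z x \<bullet> N x) * (Y x \<bullet> N x)) = B2 X v w x"
      unfolding B2_jet[OF v w x, symmetric] by simp
  qed
qed

lemma integrable_interior:
  assumes u: "jet_extension X u U A" and v: "jet_extension X v V Z" and w: "jet_extension X w W Y"
  shows "integrable lborel (\<lambda>x. indicator X x * (u x * sigma2 (hess v x) (hess w x)))"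
proof -
  have "C1c U" and eq: "\<And>x. x \<in> closure X \<Longrightarrow> U x = u x" using u by (auto simp: jet_extension_def)
  let ?G = "\<lambda>Z i j x. grad (\<lambda>y. Z y $ i) x $ (j :: 'n)"
  let ?f = "\<lambda>x. U x * (1/2 * (\<Sum>i\<in>UNIV. \<Sum>j\<in>UNIV. ?G Z i i x * ?G Y j j x - ?G Z i j x * ?G Y j i x))"
  have "continuous_on (closure X) ?f" using \<open>C1c U\<close>
    by (intro continuous_intros C1c_cont C1c_grad_cont jet_components[OF v] jet_components[OF w])
  from integrable_vol[OF this] show ?thesis
  proof (rule back_subst[of "integrable lborel"], intro ext)
    fix x
    have "2 * sigma2 (hess v x) (hess w x)
        = (\<Sum>i\<in>UNIV. \<Sum>j\<in>UNIV. ?G Z i i x * ?G Y j j x - ?G Z i j x * ?G Y j i x)" if "x \<in> X"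
      unfolding sigma2_sum hess_eq[OF openX that v] hess_eq[OF openX that w] ..
    then show "indicator X x * ?f x = indicator X x * (u x * sigma2 (hess v x) (hess w x))"
      using eq[of x] closure_subset[of X] by (auto simp: indicator_def)
  qed
qed

lemma integrable_boundary:
  assumes u: "jet_extension X u U A" and v: "jet_extension X v V Z" and w: "jet_extension X w W Y"
  shows "integrable \<mu> (\<lambda>x. indicator M x * (u x * B2 X v w x))"
proof -
  have U: "C1c U" and eq: "\<And>x. x \<in> closure X \<Longrightarrow> U x = u x" using u by (auto simp: jet_extension_def)
  have "continuous_on M u" by (rule continuous_on_eq[OF C1c_cont[OF U]]) (simp add: eq M_closure)
  then show ?thesis
    by (intro integrable_surf continuous_intros continuous_on_B2_jet[OF v w])
qed

text \<open>On the right-hand side the gradients \<open>A\<close> of \<open>u\<close> and \<open>Y\<close> of \<open>w\<close> enter on an equal footing, although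
the definition of the form differentiates \<open>w\<close> twice and \<open>u\<close> not at all.\<close>

lemma Q2_formula:
  assumes u: "jet_extension X u U A" and v: "jet_extension X v V Z" and w: "jet_extension X w W Y"
  shows "2 * Q2 X \<mu> u v w
    = vol (\<lambda>x. (A x \<bullet> Y x) * lin_trace (dfield Z x) - dfield Z x (Y x) \<bullet> A x)
      - surf (\<lambda>x. (Z x \<bullet> N x) * (A x \<bullet> tang Y x))"
proof -
  have U: "C1c U" "C1c_field A" "\<And>x. x \<in> closure X \<Longrightarrow> U x = u x" "\<And>x. x \<in> closure X \<Longrightarrow> grad U x = A x"
    using u by (auto simp: jet_extension_def)
  note ZC = jet_field[OF v] and YC = jet_field[OF w]
  note Zi = jet_components[OF v] and Yi = jet_components[OF w]
  note cont = C1c_cont C1c_grad_cont N_cont N_cont_component U(1) Zi Yi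
    C1_field_continuous_on C1c_field_C1 U(2) ZC YC C1_field_continuous_dfield sdiv_cont C1c_tang
    continuous_on_lin_trace_dfield
  define G where "G i j x = grad (\<lambda>y. Z y $ i) x $ j" for i j x
  define K where "K i j x = grad (\<lambda>y. Y y $ i) x $ j" for i j x
  have UY: "C1c (\<lambda>x. U x * Y x $ j)" for j by (rule C1c_mult[OF U(1) Yi])
  have cG: "continuous_on S (G i j)" "continuous_on S (K i j)" for S i j
    unfolding G_def K_def by (intro continuous_intros C1c_grad_cont Zi Yi)+
  let ?R = "\<lambda>x. (A x \<bullet> Y x) * lin_trace (dfield Z x) - dfield Z x (Y x) \<bullet> A x"
  let ?S = "\<lambda>x. U x * ((Y x \<bullet> N x) * lin_trace (dfield Z x) - dfield Z x (Y x) \<bullet> N x)"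
  let ?J = "\<lambda>i j x. G i i x * grad (\<lambda>y. U y * Y y $ j) x $ j - G i j x * grad (\<lambda>y. U y * Y y $ j) x $ i"
  let ?B = "\<lambda>i j x. U x * Y x $ j * (G i i x * N x $ j - G i j x * N x $ i)"
  let ?E = "\<lambda>x. (Z x \<bullet> N x) * (A x \<bullet> tang Y x)"
  let ?s = "\<lambda>x. u x * sigma2 (hess v x) (hess w x)"
  let ?D = "sdiv (\<lambda>y. (U y * (Z y \<bullet> N y)) *\<^sub>R tang Y y)"
  \<comment> \<open>On \<open>X\<close> the Jacobian minors of \<open>Z $ i\<close> and \<open>U * Y $ j\<close> sum to twice the integrand of the
    form plus \<open>?R\<close>; Stokes turns them into \<open>?S\<close> on the boundary.\<close>
  have st: "vol (?J i j) = surf (?B i j)" for i j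
    unfolding G_def by (rule stokes_two_form[OF Zi UY])
  have gUY: "grad (\<lambda>y. U y * Y y $ j) x $ l = U x * K j l x + Y x $ j * grad U x $ l" for j l x
    by (simp add: grad_mult[OF U(1) Yi] K_def)
  have "vol (\<lambda>x. 2 * ?s x + ?R x) = vol (\<lambda>x. \<Sum>i\<in>UNIV. \<Sum>j\<in>UNIV. ?J i j x)"
  proof (rule vol_cong)
    fix x assume x: "x \<in> X"
    then have xc: "x \<in> closure X" using closure_subset by auto
    have "2 * sigma2 (hess v x) (hess w x) = (\<Sum>i\<in>UNIV. \<Sum>j\<in>UNIV. G i i x * K j j x - G i j x * K j i x)"
      unfolding sigma2_sum by (simp add: hess_eq[OF openX x v] hess_eq[OF openX x w] G_def K_def)
    moreover have "?R x = (\<Sum>i\<in>UNIV. \<Sum>j\<in>UNIV. Y x $ j * (G i i x * A x $ j - G i j x * A x $ i))"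
      unfolding sum_minors[where G = "\<lambda>i j. G i j x"]
      by (simp add: lin_trace_dfield dfield_sum inner_vec_def[of "dfield Z x (Y x)"] G_def
          inner_commute[of "A x" "Y x"])
    moreover have "?J i j x
        = u x * (G i i x * K j j x - G i j x * K j i x) + Y x $ j * (G i i x * A x $ j - G i j x * A x $ i)" for i j
      by (simp add: gUY U(3,4)[OF xc] algebra_simps)
    ultimately show "2 * ?s x + ?R x = (\<Sum>i\<in>UNIV. \<Sum>j\<in>UNIV. ?J i j x)"
      by (simp add: sum.distrib sum_distrib_left[symmetric] mult.left_commute[of 2])
  qed
  also have "\<dots> = (\<Sum>i\<in>UNIV. \<Sum>j\<in>UNIV. vol (?J i j))"
    by (simp add: vol_sum continuous_intros cG C1c_grad_cont[OF UY])
  also have "\<dots> = (\<Sum>i\<in>UNIV. \<Sum>j\<in>UNIV. surf (?B i j))"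
    by (simp add: st)
  also have "\<dots> = surf (\<lambda>x. \<Sum>i\<in>UNIV. \<Sum>j\<in>UNIV. ?B i j x)"
    by (simp add: surf_sum continuous_intros cG C1c_cont[OF U(1)] C1c_cont[OF Yi] N_cont_component)
  also have "\<dots> = surf ?S"
  proof (rule surf_cong)
    fix x
    have "(\<Sum>i\<in>UNIV. \<Sum>j\<in>UNIV. ?B i j x)
        = U x * (\<Sum>i\<in>UNIV. \<Sum>j\<in>UNIV. Y x $ j * (G i i x * N x $ j - G i j x * N x $ i))"
      by (simp add: sum_distrib_left mult.assoc)
    also have "\<dots> = ?S x"
      unfolding sum_minors[where G = "\<lambda>i j. G i j x"]
      by (simp add: lin_trace_dfield dfield_sum inner_vec_def[of "dfield Z x (Y x)"] G_def)
    finally show "(\<Sum>i\<in>UNIV. \<Sum>j\<in>UNIV. ?B i j x) = ?S x" .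
  qed
  finally have 1: "vol (\<lambda>x. 2 * ?s x + ?R x) = surf ?S" .
  have cR: "continuous_on S ?R" for S by (intro continuous_intros cont)
  have 2: "vol (\<lambda>x. 2 * ?s x + ?R x) = 2 * vol ?s + vol ?R"
  proof -
    have "vol (\<lambda>x. 2 * ?s x + ?R x) = vol (\<lambda>x. 2 * ?s x) + vol ?R"
      using integrable_mult_right[OF integrable_interior[OF u v w], of 2] integrable_vol[OF cR]
      unfolding vol_def distrib_left by (intro Bochner_Integration.integral_add) (simp_all add: mult.left_commute)
    then show ?thesis by (simp only: vol_cmult)
  qed
  \<comment> \<open>The operator \<open>B2\<close> produces the same \<open>?S\<close>, which cancels, and a tangential divergence.\<close>
  have Dt: "C1c_field (\<lambda>y. (U y * (Z y \<bullet> N y)) *\<^sub>R tang Y y)"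
    by (intro C1c_field_scaleR C1c_mult C1c_field_inner C1c_tang U(1) ZC YC N)
  have D0: "surf ?D = 0" by (rule surf_sdiv_eq_0[OF Dt]) (simp add: tang_N)
  have cS: "continuous_on S ?S" for S by (intro continuous_intros cont)
  have cD: "continuous_on S ?D" for S by (rule sdiv_cont[OF Dt])
  have cE: "continuous_on S ?E" for S by (intro continuous_intros cont)
  have "2 * surf (\<lambda>x. u x * B2 X v w x) = surf (\<lambda>x. ?S x + ?D x - ?E x)"
    unfolding surf_cmult[symmetric]
  proof (rule surf_cong)
    fix x assume x: "x \<in> M"
    show "2 * (u x * B2 X v w x) = ?S x + ?D x - ?E x"
      using B2_divergence_form[OF v w U(1) x] U(3,4)[OF M_closure[OF x]] by simp
  qed
  also have "\<dots> = surf ?S - surf ?E"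
    using D0 by (simp add: surf_diff surf_add cS cD cE continuous_on_add)
  finally have 3: "2 * surf (\<lambda>x. u x * B2 X v w x) = surf ?S - surf ?E" .
  show ?thesis using 1 2 3 by (simp add: Q2_alt)
qed

text \<open>On \<open>X\<close> the matrix \<open>DZ\<close> is the Hessian of \<open>v\<close>, hence symmetric.\<close>

lemma Q2_swap_outer:
  assumes u: "jet_extension X u U A" and v: "jet_extension X v V Z" and w: "jet_extension X w W Y"
  shows "Q2 X \<mu> u v w = Q2 X \<mu> w v u"
proof -
  have "vol (\<lambda>x. (A x \<bullet> Y x) * lin_trace (dfield Z x) - dfield Z x (Y x) \<bullet> A x)
      = vol (\<lambda>x. (Y x \<bullet> A x) * lin_trace (dfield Z x) - dfield Z x (A x) \<bullet> Y x)"
  proof (rule vol_cong)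
    fix x assume x: "x \<in> X"
    have "dfield Z x (Y x) \<bullet> A x = dfield Z x (A x) \<bullet> Y x"
      by (rule second_derivative_symmetric[OF openX x, of V])
         (use v closure_subset in \<open>auto simp: jet_extension_def intro: C1c_C1_on C1c_field_C1\<close>)
    then show "(A x \<bullet> Y x) * lin_trace (dfield Z x) - dfield Z x (Y x) \<bullet> A x
        = (Y x \<bullet> A x) * lin_trace (dfield Z x) - dfield Z x (A x) \<bullet> Y x"
      by (simp add: inner_commute)
  qed
  moreover have "A x \<bullet> tang Y x = Y x \<bullet> tang A x" for x
    by (simp add: tang_def inner_diff_right inner_commute)
  ultimately show ?thesis
    using Q2_formula[OF u v w] Q2_formula[OF w v u] by simp
qed

lemma Q2_swap_inner:
  assumes v: "jet_extension X v V Z" and w: "jet_extension X w W Y"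
  shows "Q2 X \<mu> u v w = Q2 X \<mu> u w v"
  unfolding Q2_alt using surf_cong[of "\<lambda>x. u x * B2 X v w x" "\<lambda>x. u x * B2 X w v x"]
  by (simp add: sigma2_commute[of "hess v _"] B2_symmetric[OF v w])

lemma Q2_linear_first:
  assumes f: "jet_extension X f F A" and g: "jet_extension X g G B"
    and v: "jet_extension X v V Z" and w: "jet_extension X w W Y"
  shows "Q2 X \<mu> (\<lambda>x. a * f x + b * g x) v w = a * Q2 X \<mu> f v w + b * Q2 X \<mu> g v w"
proof -
  note ii = integrable_interior[OF f v w] integrable_interior[OF g v w]
  note ib = integrable_boundary[OF f v w] integrable_boundary[OF g v w]
  have "indicator S x * ((a * f x + b * g x) * c) = a * (indicator S x * (f x * c)) + b * (indicator S x * (g x * c))"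
    for S x and c :: real by (simp add: algebra_simps)
  then show ?thesis
    using ii ib by (simp add: Q2_alt vol_def surf_def algebra_simps)
qed

end

theorem proposition1p3:
  fixes X :: "(real^'n::finite) set" and \<mu> :: "(real^'n) measure"
  assumes "smooth_domain X" and "bounded X"
    and "induced_volume_measure (frontier X) \<mu>"
  shows "(\<forall>v\<in>C_closure 1 X \<inter> C_submanifold 2 (frontier X).
            \<forall>w\<in>C_closure 1 X \<inter> C_submanifold 2 (frontier X).
              continuous_on (frontier X) (B2 X v w)) \<and>
         C_closure 2 X \<subseteq> C_closure 1 X \<inter> C_submanifold 2 (frontier X) \<and>
         (\<forall>u\<in>C_closure 2 X. \<forall>v\<in>C_closure 2 X. \<forall>w\<in>C_closure 2 X.
            set_integrable lborel X (\<lambda>x. u x * sigma2 (hess v x) (hess w x)) \<and>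
            set_integrable \<mu> (frontier X) (\<lambda>x. u x * B2 X v w x)) \<and>
         trilinear_on (C_closure 2 X) (Q2 X \<mu>) \<and>
         symmetric_on (C_closure 2 X) (Q2 X \<mu>)"
proof -
  obtain N where "normal_extension X N" using normal_extension_exists[OF assms(1,2)] by blast
  then interpret boundary_measure X N \<mu>
    by (rule boundary_measure.intro) (simp add: boundary_measure_axioms_def assms(3))
  define jet where "jet v \<longleftrightarrow> (\<exists>V Z. jet_extension X v V Z)" for v
  have J: "jet v" if "v \<in> C_closure 2 X" for v
    using jet_extension_exists[OF assms(1,2) that] unfolding jet_def by blast
  have outer: "Q2 X \<mu> u v w = Q2 X \<mu> w v u" if "jet u" "jet v" "jet w" for u v w
    using that Q2_swap_outer unfolding jet_def by blast
  have inner: "Q2 X \<mu> u v w = Q2 X \<mu> u w v" if "jet v" "jet w" for u v w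
    using that Q2_swap_inner unfolding jet_def by blast
  have lin: "Q2 X \<mu> (\<lambda>x. a * f x + b * g x) v w = a * Q2 X \<mu> f v w + b * Q2 X \<mu> g v w"
    if "jet f" "jet g" "jet v" "jet w" for a b f g v w
    using that Q2_linear_first unfolding jet_def by blast
  have comb: "jet (\<lambda>x. a * f x + b * g x)" if "jet f" "jet g" for a b f g
    using that jet_extension_lin unfolding jet_def by blast
  have sub: "C_closure 2 X \<subseteq> C_closure 1 X \<inter> C_submanifold 2 M"
    using C_closure_2_subset_1 J jet_extension_C_submanifold unfolding jet_def by blast
  have "set_integrable lborel X (\<lambda>x. u x * sigma2 (hess v x) (hess w x)) \<and>
      set_integrable \<mu> M (\<lambda>x. u x * B2 X v w x)"
    if "u \<in> C_closure 2 X" "v \<in> C_closure 2 X" "w \<in> C_closure 2 X" for u v w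
    using J[OF that(1)] J[OF that(2)] J[OF that(3)] integrable_interior integrable_boundary
    unfolding jet_def set_integrable_def real_scaleR_def by blast
  moreover have "trilinear_on (C_closure 2 X) (Q2 X \<mu>)"
    unfolding trilinear_on_def
  proof (intro ballI allI conjI)
    fix f g v w and a b :: real
    assume "f \<in> C_closure 2 X" "g \<in> C_closure 2 X" "v \<in> C_closure 2 X" "w \<in> C_closure 2 X"
    then have j: "jet f" "jet g" "jet v" "jet w" using J by auto
    let ?c = "\<lambda>x. a * f x + b * g x"
    have c: "jet ?c" by (rule comb[OF j(1,2)])
    show first: "Q2 X \<mu> ?c v w = a * Q2 X \<mu> f v w + b * Q2 X \<mu> g v w" by (rule lin[OF j])
    show "Q2 X \<mu> v ?c w = a * Q2 X \<mu> v f w + b * Q2 X \<mu> v g w"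
    proof -
      have "Q2 X \<mu> v h w = Q2 X \<mu> h v w" if "jet h" for h
        using inner[OF that j(4), of v] outer[OF j(3) j(4) that] inner[OF j(4) j(3), of h] by simp
      then show ?thesis using first c j by simp
    qed
    show "Q2 X \<mu> v w ?c = a * Q2 X \<mu> v w f + b * Q2 X \<mu> v w g"
    proof -
      have "Q2 X \<mu> v w h = Q2 X \<mu> h w v" if "jet h" for h by (rule outer[OF j(3,4) that])
      then show ?thesis using lin[OF j(1,2) j(4,3)] c j by simp
    qed
  qed
  moreover have "symmetric_on (C_closure 2 X) (Q2 X \<mu>)"
    unfolding symmetric_on_def
  proof (intro ballI conjI)
    fix u v w assume "u \<in> C_closure 2 X" "v \<in> C_closure 2 X" "w \<in> C_closure 2 X"
    then have j: "jet u" "jet v" "jet w" using J by auto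
    show "Q2 X \<mu> u v w = Q2 X \<mu> u w v" by (rule inner[OF j(2,3)])
    show "Q2 X \<mu> u v w = Q2 X \<mu> w v u" by (rule outer[OF j])
    show "Q2 X \<mu> u v w = Q2 X \<mu> w u v" using outer[OF j] inner[OF j(2,1), of w] by simp
    show "Q2 X \<mu> u v w = Q2 X \<mu> v w u" using inner[OF j(2,3), of u] outer[OF j(1,3,2)] by simp
    show "Q2 X \<mu> u v w = Q2 X \<mu> v u w"
      using outer[OF j] inner[OF j(2,1), of w] outer[OF j(3,1,2)] by simp
  qed
  ultimately show ?thesis using continuous_on_B2 sub by blast
qed

end
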